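(* In the setting described in the context, a complete set of representatives of the indecomposable elements of $\mathcal{O}_K^+$ modulo multiplication by totally positive units is given by \[ 1,\qquad \rho,\qquad \gamma_j\ (1\le j\le 6n+1). \] Hence $\iota(K)=6n+3$, and \[ \frac{\log\Delta_K}{8w}\le\iota(K)\le\frac{\log\Delta_K}{8w}+1,\qquad w:=\log\Big(\tfrac{1+\sqrt5}{2}\Big), \] where $\Delta_K$ is the discriminant of $K$.
   Context: For integers $m\ge0$ define integers $x_m,y_m$ by $\frac{x_m+y_m\sqrt5}{2}=\big(\frac{1+\sqrt5}{2}\big)^m$. Let $n\ge0$ be an integer such that $p:=y_{12n+3}^2-1$ and $r:=x_{12n+3}^2-1$ are squarefree, and let $K=\mathbb{Q}(\sqrt5,\sqrt p)$ (note $r=5p$, so $\sqrt r\in K$). Write $X=x_{12n+3}$, $Y=y_{12n+3}$, and $[a,b,c,d]:=a+b\sqrt5+c\sqrt p+d\sqrt r$. Define $\rho:=[\frac{X+Y}{2},0,-\frac12,\frac12]$ and, for $1\le j\le 6n+1$, \[ \gamma_j:=\Big[\frac{y_{2j-1}X+1}{2},\ \frac{x_{2j-1}X-(-1)^j}{10},\ (-1)^j\frac{x_{2j-1}}{2},\ (-1)^j\frac{y_{2j-1}}{2}\Big]. \] $\mathcal{O}_K^+$ is the set of totally positive elements of $\mathcal{O}_K$; $\alpha\in\mathcal{O}_K^+$ is indecomposable if it is not a sum of two elements of $\mathcal{O}_K^+$; $\iota(K)$ is the number of indecomposables up to multiplication by totally positive units. *)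

theory Defs
  imports Complex_Main "HOL-Computational_Algebra.Computational_Algebra"
    "HOL-Combinatorics.Permutations"
begin

definition xy :: "nat \<Rightarrow> int \<times> int" where
  "xy m = (THE (a, b). (real_of_int a + real_of_int b * sqrt 5) / 2 = ((1 + sqrt 5) / 2) ^ m)"

definition xs :: "nat \<Rightarrow> int" where "xs m = fst (xy m)"
definition ys :: "nat \<Rightarrow> int" where "ys m = snd (xy m)"

definition elt :: "int \<Rightarrow> real \<Rightarrow> real \<Rightarrow> real \<Rightarrow> real \<Rightarrow> real" where
  "elt p a b c d = a + b * sqrt 5 + c * sqrt (of_int p) + d * sqrt (5 * of_int p)"

definition Kfield :: "int \<Rightarrow> real set" where
  "Kfield p = {elt p a b c d | a b c d. a \<in> \<rat> \<and> b \<in> \<rat> \<and> c \<in> \<rat> \<and> d \<in> \<rat>}"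

definition coords :: "int \<Rightarrow> real \<Rightarrow> real \<times> real \<times> real \<times> real" where
  "coords p x = (THE (a, b, c, d). a \<in> \<rat> \<and> b \<in> \<rat> \<and> c \<in> \<rat> \<and> d \<in> \<rat> \<and> x = elt p a b c d)"

text \<open>The four real embeddings: sqrt 5 \<mapsto> s sqrt 5, sqrt p \<mapsto> t sqrt p (s, t = +-1).\<close>
definition emb :: "int \<Rightarrow> real \<Rightarrow> real \<Rightarrow> real \<Rightarrow> real" where
  "emb p s t x = (case coords p x of (a, b, c, d) \<Rightarrow>
      a + s * b * sqrt 5 + t * c * sqrt (of_int p) + s * t * d * sqrt (5 * of_int p))"

definition sgnpair :: "nat \<Rightarrow> real \<times> real" where
  "sgnpair i = (if i = 0 then (1, 1) else if i = 1 then (1, -1) else if i = 2 then (-1, 1) else (-1, -1))"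

definition algebraic_integer :: "real \<Rightarrow> bool" where
  "algebraic_integer x \<longleftrightarrow> (\<exists>q :: int poly. lead_coeff q = 1 \<and> poly (map_poly of_int q) x = 0)"

definition OK :: "int \<Rightarrow> real set" where
  "OK p = {x \<in> Kfield p. algebraic_integer x}"

definition OKplus :: "int \<Rightarrow> real set" where
  "OKplus p = {x \<in> OK p. \<forall>s\<in>{-1, 1}. \<forall>t\<in>{-1, 1}. emb p s t x > 0}"

definition indecomposable :: "int \<Rightarrow> real \<Rightarrow> bool" where
  "indecomposable p \<alpha> \<longleftrightarrow> \<alpha> \<in> OKplus p \<and> \<not> (\<exists>\<beta>\<in>OKplus p. \<exists>\<gamma>\<in>OKplus p. \<alpha> = \<beta> + \<gamma>)"

definition totpos_unit :: "int \<Rightarrow> real \<Rightarrow> bool" where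
  "totpos_unit p \<epsilon> \<longleftrightarrow> \<epsilon> \<in> OKplus p \<and> (\<exists>\<eta>\<in>OK p. \<epsilon> * \<eta> = 1)"

definition assoc_tp :: "int \<Rightarrow> real \<Rightarrow> real \<Rightarrow> bool" where
  "assoc_tp p \<alpha> \<beta> \<longleftrightarrow> (\<exists>\<epsilon>. totpos_unit p \<epsilon> \<and> \<beta> = \<epsilon> * \<alpha>)"

definition iota :: "int \<Rightarrow> nat" where
  "iota p = card {{\<beta>. indecomposable p \<beta> \<and> assoc_tp p \<alpha> \<beta>} | \<alpha>. indecomposable p \<alpha>}"

definition det4 :: "(nat \<Rightarrow> nat \<Rightarrow> real) \<Rightarrow> real" where
  "det4 M = (\<Sum>\<pi> | \<pi> permutes {..<4::nat}. of_int (sign \<pi>) * (\<Prod>i<4. M i (\<pi> i)))"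

definition integral_basis :: "int \<Rightarrow> (nat \<Rightarrow> real) \<Rightarrow> bool" where
  "integral_basis p \<omega> \<longleftrightarrow> (\<forall>i<4. \<omega> i \<in> OK p)
     \<and> (\<forall>x\<in>OK p. \<exists>c :: nat \<Rightarrow> int. x = (\<Sum>i<4. of_int (c i) * \<omega> i))
     \<and> (\<forall>c :: nat \<Rightarrow> int. (\<Sum>i<4. of_int (c i) * \<omega> i) = 0 \<longrightarrow> (\<forall>i<4. c i = 0))"

definition disc :: "int \<Rightarrow> real" where
  "disc p = (THE d. \<exists>\<omega>. integral_basis p \<omega> \<and>
      d = (det4 (\<lambda>i j. emb p (fst (sgnpair i)) (snd (sgnpair i)) (\<omega> j))) ^ 2)"

end

theory Submission
  imports Defs "Jordan_Normal_Form.Determinant"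
begin

text \<open>
  Put \<open>m = 12 n + 3\<close>, \<open>theta = X + sqrt r\<close> and \<open>eta = Y + sqrt p\<close>, so that \<open>phi\<^sup>2\<close>, \<open>theta\<close>, \<open>eta\<close> are
  totally positive units. The ring of integers is free over \<open>Z[phi]\<close> with basis \<open>1, eta\<close>, and it also
  consists of the elements \<open>phi (x + y theta) / sqrt 5\<close> with \<open>x, y\<close> in \<open>Z[phi]\<close> congruent modulo \<open>sqrt 5\<close>.
  Up to multiplication by powers of \<open>theta\<close> and \<open>eta\<close>, every totally positive integer has totally
  nonnegative coordinates in one of these two descriptions. In the first case it is a sum of units. In
  the second case the congruences \<open>phi\<^sup>2 = -1\<close> modulo \<open>sqrt 5\<close> and \<open>3 = phi\<^sup>2 + phi\<^sup>-\<^sup>2\<close> allow one to split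
  off a term \<open>phi (phi\<^sup>2\<^sup>i + phi\<^sup>2\<^sup>k theta) / sqrt 5\<close> with \<open>i\<close> and \<open>k\<close> of equal parity, that is, a unit times
  \<open>B t = phi (1 + phi\<^sup>4\<^sup>t theta) / sqrt 5\<close>. For \<open>4 |t| > m + 1\<close> the element \<open>B t\<close> decomposes, and otherwise
  a totally positive functional of the codifferent takes the value 1 on it. Associated \<open>B t\<close> and \<open>B t'\<close>
  have equal norms, hence \<open>t' = t\<close> or \<open>t' = - t\<close>; the second case is excluded by the squarefreeness of \<open>p\<close>,
  except for \<open>4 |t| = m + 1\<close>, where \<open>B t = phi\<^sup>m\<^sup>+\<^sup>1 eta B (- t)\<close> is the class of \<open>rho\<close>.
\<close>

section \<open>The sequences and the golden ratio\<close>

text \<open>Since X is -1 modulo 5, x + y theta is divisible by sqrt 5 exactly when x and y are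
  congruent modulo sqrt 5; and phi / sqrt 5 is totally positive, whereas 1 / sqrt 5 is not, whence
  the factor \<open>phi\<close> in the second description. X and Y come from the same power of
  \<open>phi\<close>, so sqrt 5 eta = theta + 2 phi^-m. This relation links the two descriptions: it
  gives both the decomposition just beyond the range of t and the coincidence of classes at its end.
  The obstacle is the unit group. Only \<open>theta\<close>, \<open>eta\<close> and the even powers
  of \<open>phi\<close> are available, and whether they generate all totally positive units is not
  known here. Classes must therefore be told apart by invariants, and the norm cannot separate
  \<open>B t\<close> from \<open>B (- t)\<close>, which is a unit times a conjugate of
  \<open>B t\<close>. For this pair the argument is that an associated conjugate would make
  \<open>B t\<close> divide 2 sqrt p up to a unit.\<close>

definition phi :: real where "phi = (1 + sqrt 5) / 2"
definition psi :: real where "psi = (1 - sqrt 5) / 2"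

lemma phi_rel: "phi * phi = phi + 1" "psi * psi = psi + 1" "phi * psi = -1"
    "phi + psi = 1" "phi - psi = sqrt 5"
  by (simp_all add: phi_def psi_def field_simps)

lemma psi_eq: "psi = 1 - phi" and sqrt5_eq: "sqrt 5 = 2 * phi - 1"
  by (simp_all add: phi_def psi_def field_simps)

lemma sqrt5_bounds: "sqrt 5 > 2236/1000" "sqrt 5 < 2237/1000"
  by (rule real_less_rsqrt real_less_lsqrt; simp add: power2_eq_square)+

lemma phi_bounds: "phi > 1618/1000" "phi < 16185/10000"
  using sqrt5_bounds by (auto simp: phi_def)

lemma phi_pos [simp]: "phi > 0" "phi > 1" "phi \<noteq> 0"
  using phi_bounds by auto

lemma inverse_phi: "inverse phi = phi - 1" "inverse phi = - psi"
proof -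
  show 1: "inverse phi = phi - 1" by (rule inverse_unique) (simp add: algebra_simps phi_rel)
  thus "inverse phi = - psi" by (simp add: psi_eq)
qed

lemma psi_powi: "psi powi k = (if even k then 1 else -1) * phi powi (-k)"
proof -
  have "psi = (-1) * inverse phi" by (simp add: inverse_phi(2))
  hence "psi powi k = (-1) powi k * inverse phi powi k"
    by (metis power_int_mult_distrib)
  thus ?thesis
    by (simp add: power_int_inverse power_int_minus power_int_minus_left)
qed

lemma phi_power_small: "phi ^ 2 = phi + 1" "phi ^ 3 = 2 * phi + 1" "phi ^ 4 = 3 * phi + 2"
    "phi ^ 5 = 5 * phi + 3" "phi ^ 6 = 8 * phi + 5"
proof -
  show 2: "phi ^ 2 = phi + 1" by (simp add: power2_eq_square phi_rel)
  show 3: "phi ^ 3 = 2 * phi + 1"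
    using phi_rel(1) by (simp add: power3_eq_cube algebra_simps)
  show 4: "phi ^ 4 = 3 * phi + 2"
    using phi_rel(1) by (simp add: power4_eq_xxxx algebra_simps)
  have "phi ^ 5 = phi ^ 4 * phi" by (simp add: numeral_eq_Suc)
  thus 5: "phi ^ 5 = 5 * phi + 3" unfolding 4 using phi_rel(1) by (simp add: algebra_simps)
  have "phi ^ 6 = phi ^ 5 * phi" by (simp add: numeral_eq_Suc)
  thus "phi ^ 6 = 8 * phi + 5" unfolding 5 using phi_rel(1) by (simp add: algebra_simps)
qed

lemma rat_square_int:
  fixes x :: real
  assumes "x \<in> \<rat>" "x ^ 2 \<in> \<int>"
  shows "x \<in> \<int>"
proof -
  obtain k where k: "x ^ 2 = of_int k" using assms(2) by (auto elim: Ints_cases)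
  have "algebraic_int x"
    unfolding algebraic_int_altdef_ipoly
    by (rule exI[of _ "[:-k, 0, 1:]"]) (use k in \<open>simp add: power2_eq_square map_poly_pCons\<close>)
  with assms(1) show ?thesis by (rule rational_algebraic_int_is_int[rotated])
qed

lemma sqrt_notin_Rats:
  fixes k :: int
  assumes "k \<ge> 0" "\<And>j::int. j ^ 2 \<noteq> k"
  shows "sqrt (of_int k) \<notin> \<rat>"
proof
  assume "sqrt (of_int k) \<in> \<rat>"
  hence "sqrt (of_int k) \<in> \<int>" by (rule rat_square_int) (use assms in simp)
  then obtain j where "sqrt (of_int k) = of_int j" by (auto elim: Ints_cases)
  hence "of_int k = (of_int (j ^ 2) :: real)"
    using assms(1) by (metis of_int_0_le_iff of_int_power real_sqrt_pow2)
  hence "k = j ^ 2" by (simp only: of_int_eq_iff)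
  with assms(2) show False by auto
qed

lemma sqrt5_notin_Rats: "sqrt 5 \<notin> \<rat>"
proof -
  have "j ^ 2 \<noteq> 5" for j :: int
  proof
    assume h: "j ^ 2 = 5"
    have "\<bar>j\<bar> < 3" by (rule power2_less_imp_less) (use h in auto)
    moreover have "\<bar>j\<bar> > 2" by (rule power2_less_imp_less) (use h in auto)
    ultimately show False by linarith
  qed
  from sqrt_notin_Rats[OF _ this] show ?thesis by simp
qed

lemma sqrt5_indep:
  assumes "a \<in> \<rat>" "b \<in> \<rat>" "a + b * sqrt 5 = 0"
  shows "a = 0 \<and> b = 0"
proof (cases "b = 0")
  case False
  hence "sqrt 5 = - a / b" using assms(3) by (simp add: field_simps)
  hence "sqrt 5 \<in> \<rat>" using assms by simp
  with sqrt5_notin_Rats show ?thesis by simp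
qed (use assms in auto)

lemma xy_eqI:
  assumes "(real_of_int a + real_of_int b * sqrt 5) / 2 = phi ^ m"
  shows "xy m = (a, b)"
  unfolding xy_def
proof (rule the_equality)
  show "case (a, b) of (a, b) \<Rightarrow> (real_of_int a + real_of_int b * sqrt 5) / 2 = ((1 + sqrt 5) / 2) ^ m"
    using assms by (simp add: phi_def)
next
  fix z :: "int \<times> int"
  assume z: "case z of (a, b) \<Rightarrow> (real_of_int a + real_of_int b * sqrt 5) / 2 = ((1 + sqrt 5) / 2) ^ m"
  obtain c d where cd: "z = (c, d)" by (cases z)
  have "real_of_int c + real_of_int d * sqrt 5 = real_of_int a + real_of_int b * sqrt 5"
    using z assms unfolding cd phi_def by simp
  hence "real_of_int (c - a) + real_of_int (d - b) * sqrt 5 = 0" by (simp add: algebra_simps)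
  from sqrt5_indep[OF _ _ this] have "c = a" "d = b" by auto
  thus "z = (a, b)" by (simp add: cd)
qed

text \<open>Multiplication by \<open>phi\<close> sends (a, b) to ((a + 5b)/2, (a + b)/2), so the
  induction has to carry the parity of a - b. With a = b + 2k the new pair is (3b + k, b +
  k).\<close>

lemma xs_ys_exist:
  "\<exists>a b :: int. (real_of_int a + real_of_int b * sqrt 5) / 2 = phi ^ m
     \<and> (real_of_int a - real_of_int b * sqrt 5) / 2 = psi ^ m \<and> even (a - b)"
proof (induction m)
  case 0
  show ?case by (rule exI[of _ 2], rule exI[of _ 0]) simp
next
  case (Suc m)
  then obtain a b :: int where ab: "(real_of_int a + real_of_int b * sqrt 5) / 2 = phi ^ m"
    "(real_of_int a - real_of_int b * sqrt 5) / 2 = psi ^ m" "even (a - b)" by blast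
  obtain k where k: "a = b + 2 * k" using ab(3) by (metis add.commute diff_add_cancel evenE)
  show ?case
  proof (intro exI conjI)
    have "phi ^ Suc m = phi * phi ^ m" by simp
    thus "(real_of_int (3 * b + k) + real_of_int (b + k) * sqrt 5) / 2 = phi ^ Suc m"
      unfolding ab(1)[symmetric] by (simp add: k phi_def field_simps)
    have "psi ^ Suc m = psi * psi ^ m" by simp
    thus "(real_of_int (3 * b + k) - real_of_int (b + k) * sqrt 5) / 2 = psi ^ Suc m"
      unfolding ab(2)[symmetric] by (simp add: k psi_def field_simps)
    show "even (3 * b + k - (b + k))" by simp
  qed
qed

lemma xs_ys_phi: "(real_of_int (xs m) + real_of_int (ys m) * sqrt 5) / 2 = phi ^ m"
  and xs_ys_psi: "(real_of_int (xs m) - real_of_int (ys m) * sqrt 5) / 2 = psi ^ m"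
proof -
  obtain a b :: int where ab: "(real_of_int a + real_of_int b * sqrt 5) / 2 = phi ^ m"
    "(real_of_int a - real_of_int b * sqrt 5) / 2 = psi ^ m" using xs_ys_exist by blast
  from xy_eqI[OF ab(1)] have "xs m = a" "ys m = b" by (simp_all add: xs_def ys_def)
  with ab show "(real_of_int (xs m) + real_of_int (ys m) * sqrt 5) / 2 = phi ^ m"
    "(real_of_int (xs m) - real_of_int (ys m) * sqrt 5) / 2 = psi ^ m" by auto
qed

lemma xs_binet: "real_of_int (xs m) = phi ^ m + psi ^ m"
  and ys_binet: "real_of_int (ys m) * sqrt 5 = phi ^ m - psi ^ m"
  by (simp_all add: xs_ys_phi[symmetric] xs_ys_psi[symmetric] field_simps)

lemma phi_psi_rec: "phi ^ (m + 2) = phi ^ (m + 1) + phi ^ m" "psi ^ (m + 2) = psi ^ (m + 1) + psi ^ m"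
proof -
  have "phi ^ (m + 2) = phi ^ m * (phi * phi)" "psi ^ (m + 2) = psi ^ m * (psi * psi)" by simp_all
  thus "phi ^ (m + 2) = phi ^ (m + 1) + phi ^ m" "psi ^ (m + 2) = psi ^ (m + 1) + psi ^ m"
    unfolding phi_rel by (simp_all add: algebra_simps)
qed

lemma xs_rec:
  assumes "a = c + 2" "b = c + 1"
  shows "xs a = xs b + xs c"
proof -
  have "real_of_int (xs a) = real_of_int (xs b + xs c)"
    unfolding of_int_add xs_binet assms phi_psi_rec by simp
  thus ?thesis by (simp only: of_int_eq_iff)
qed

lemma ys_rec:
  assumes "a = c + 2" "b = c + 1"
  shows "ys a = ys b + ys c"
proof -
  have "real_of_int (ys a) * sqrt 5 = real_of_int (ys b + ys c) * sqrt 5"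
    unfolding of_int_add distrib_right ys_binet assms phi_psi_rec by simp
  hence "real_of_int (ys a) = real_of_int (ys b + ys c)" by simp
  thus ?thesis by (simp only: of_int_eq_iff)
qed

lemma xs_01 [simp]: "xs 0 = 2" "xs (Suc 0) = 1" and ys_01 [simp]: "ys 0 = 0" "ys (Suc 0) = 1"
proof -
  have "xy 0 = (2, 0)" "xy (Suc 0) = (1, 1)" by (rule xy_eqI; simp add: phi_def)+
  thus "xs 0 = 2" "xs (Suc 0) = 1" "ys 0 = 0" "ys (Suc 0) = 1" by (auto simp: xs_def ys_def)
qed

lemma xs_ys_norm: "xs m ^ 2 - 5 * ys m ^ 2 = 4 * (-1) ^ m"
proof -
  have "real_of_int (xs m ^ 2 - 5 * ys m ^ 2)
      = (real_of_int (xs m)) ^ 2 - (real_of_int (ys m) * sqrt 5) ^ 2"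
    by (simp add: power_mult_distrib)
  also have "\<dots> = 4 * (phi * psi) ^ m"
    unfolding xs_binet ys_binet by (simp add: power2_sum power2_diff power_mult_distrib)
  also have "\<dots> = real_of_int (4 * (-1) ^ m)" by (simp add: phi_rel)
  finally show ?thesis by (simp only: of_int_eq_iff)
qed

lemma xs_double: "xs (2 * m) = xs m ^ 2 - 2 * (-1) ^ m"
proof -
  have "real_of_int (xs m ^ 2 - 2 * (-1) ^ m) = (phi ^ m + psi ^ m) ^ 2 - 2 * (phi * psi) ^ m"
    by (simp add: xs_binet phi_rel)
  also have "\<dots> = phi ^ (2 * m) + psi ^ (2 * m)"
    by (simp add: power2_sum power_mult_distrib power_mult[symmetric] mult.commute)
  finally show ?thesis by (metis of_int_eq_iff xs_binet)
qed

text \<open>Modulo 5 the Lucas numbers repeat 2, 1, 3, 4. Two consecutive residues are carried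
  because the recurrence has order two.\<close>

lemma xs_mod5: "5 dvd xs (4 * k) - 2 \<and> 5 dvd xs (4 * k + 1) - 1"
proof (induction k)
  case (Suc k)
  have "xs (4 * k + 2) = xs (4 * k + 1) + xs (4 * k)" by (rule xs_rec) simp_all
  moreover have "xs (4 * k + 3) = xs (4 * k + 2) + xs (4 * k + 1)" by (rule xs_rec) simp_all
  moreover have "xs (4 * Suc k) = xs (4 * k + 3) + xs (4 * k + 2)" by (rule xs_rec) simp_all
  moreover have "xs (4 * Suc k + 1) = xs (4 * Suc k) + xs (4 * k + 3)" by (rule xs_rec) simp_all
  ultimately have
    "xs (4 * Suc k) - 2 = 3 * (xs (4 * k + 1) - 1) + 2 * (xs (4 * k) - 2) + 5"
    "xs (4 * Suc k + 1) - 1 = 3 * (xs (4 * k) - 2) + 5 * (xs (4 * k + 1) + 1)" by (simp_all add: algebra_simps)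
  moreover have "5 dvd 3 * (xs (4 * k + 1) - 1) + 2 * (xs (4 * k) - 2) + 5"
    "5 dvd 3 * (xs (4 * k) - 2) + 5 * (xs (4 * k + 1) + 1)"
    using Suc by (simp_all only: dvd_add dvd_mult dvd_triv_left dvd_refl)
  ultimately show ?case by (simp only: simp_thms)
qed simp

lemma xs_mod5': "5 dvd xs (4 * k + 3) + 1"
proof -
  have "xs (4 * k + 2) = xs (4 * k + 1) + xs (4 * k)" by (rule xs_rec) simp_all
  moreover have "xs (4 * k + 3) = xs (4 * k + 2) + xs (4 * k + 1)" by (rule xs_rec) simp_all
  ultimately have "xs (4 * k + 3) + 1 = 2 * (xs (4 * k + 1) - 1) + (xs (4 * k) - 2) + 5" by (simp add: algebra_simps)
  moreover have "5 dvd 2 * (xs (4 * k + 1) - 1) + (xs (4 * k) - 2) + 5"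
    using xs_mod5[of k] by (simp only: dvd_add dvd_mult dvd_refl)
  ultimately show ?thesis by (simp only:)
qed

lemma xs_ys_even: "even (xs (3 * k)) \<and> even (ys (3 * k))"
proof (induction k)
  case (Suc k)
  have "xs (3 * k + 2) = xs (3 * k + 1) + xs (3 * k)" by (rule xs_rec) simp_all
  moreover have "xs (3 * Suc k) = xs (3 * k + 2) + xs (3 * k + 1)" by (rule xs_rec) simp_all
  moreover have "ys (3 * k + 2) = ys (3 * k + 1) + ys (3 * k)" by (rule ys_rec) simp_all
  moreover have "ys (3 * Suc k) = ys (3 * k + 2) + ys (3 * k + 1)" by (rule ys_rec) simp_all
  ultimately have "xs (3 * Suc k) = 2 * xs (3 * k + 1) + xs (3 * k)"
    "ys (3 * Suc k) = 2 * ys (3 * k + 1) + ys (3 * k)" by (simp_all add: algebra_simps)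
  with Suc show ?case by simp
qed simp

section \<open>The ring Z[phi]\<close>

definition Zphi :: "real set" where
  "Zphi = {of_int a + of_int b * phi | a b :: int. True}"

lemma Zphi_I: "of_int a + of_int b * phi \<in> Zphi"
  by (auto simp: Zphi_def)

lemma Zphi_cases:
  assumes "x \<in> Zphi" obtains a b :: int where "x = of_int a + of_int b * phi"
  using assms by (auto simp: Zphi_def)

lemma Zphi_int [simp]: "of_int a \<in> Zphi"
  using Zphi_I[of a 0] by simp

lemma Zphi_0_1 [simp]: "0 \<in> Zphi" "1 \<in> Zphi" "numeral k \<in> Zphi" "of_nat j \<in> Zphi"
  using Zphi_int[of 0] Zphi_int[of 1] Zphi_int[of "numeral k"] Zphi_int[of "int j"] by simp_all

lemma Zphi_phi [simp]: "phi \<in> Zphi"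
  using Zphi_I[of 0 1] by simp

lemma Zphi_add [simp]: "x \<in> Zphi \<Longrightarrow> y \<in> Zphi \<Longrightarrow> x + y \<in> Zphi"
proof (elim Zphi_cases)
  fix a b c d :: int assume "x = of_int a + of_int b * phi" "y = of_int c + of_int d * phi"
  thus "x + y \<in> Zphi" using Zphi_I[of "a + c" "b + d"] by (simp add: algebra_simps)
qed

lemma phi_int_mult:
  "(of_int a + of_int b * phi) * (of_int c + of_int d * phi)
    = of_int (a * c + b * d) + of_int (a * d + b * c + b * d) * phi"
proof -
  have "(of_int a + of_int b * phi) * (of_int c + of_int d * phi)
    = of_int a * of_int c + of_int b * of_int d * (phi * phi) + (of_int a * of_int d + of_int b * of_int c) * phi"
    by (simp add: algebra_simps)
  thus ?thesis unfolding phi_rel by (simp add: algebra_simps)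
qed

lemma Zphi_mult [simp]: "x \<in> Zphi \<Longrightarrow> y \<in> Zphi \<Longrightarrow> x * y \<in> Zphi"
  by (elim Zphi_cases) (simp only: phi_int_mult Zphi_I)

lemma Zphi_minus [simp]: "x \<in> Zphi \<Longrightarrow> - x \<in> Zphi"
  using Zphi_mult[OF Zphi_int[of "-1"]] by simp

lemma Zphi_diff [simp]: "x \<in> Zphi \<Longrightarrow> y \<in> Zphi \<Longrightarrow> x - y \<in> Zphi"
  using Zphi_add[OF _ Zphi_minus, of x y] by simp

lemma Zphi_power [simp]: "x \<in> Zphi \<Longrightarrow> x ^ k \<in> Zphi"
  by (induction k) simp_all

lemma Zphi_sqrt5 [simp]: "sqrt 5 \<in> Zphi"
  by (simp add: sqrt5_eq)

lemma Zphi_phi_powi [simp]: "phi powi k \<in> Zphi"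
  by (cases "k \<ge> 0") (simp_all add: power_int_def inverse_phi(1))

lemma Zphi_unique:
  fixes a b c d :: int
  assumes "of_int a + of_int b * phi = of_int c + of_int d * phi"
  shows "a = c \<and> b = d"
proof -
  have "(of_int (a - c) + of_int (b - d) / 2) + (of_int (b - d) / 2) * sqrt 5 = (0::real)"
    using assms by (simp add: phi_def field_simps)
  hence "of_int (a - c) + of_int (b - d) / 2 = (0::real) \<and> of_int (b - d) / 2 = (0::real)"
    by (rule sqrt5_indep[rotated 2]) simp_all
  hence "of_int (b - d) = (0::real) \<and> of_int (a - c) = (0::real)" by auto
  thus ?thesis by simp
qed

text \<open>A common divisor of x and the cofactor q / gcd(q, x) also divides the gcd, so its square
  divides q. Hence the cofactor is coprime to x, and as a divisor of x^k it is a unit.\<close>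

lemma squarefree_dvd_power:
  fixes q :: int
  assumes "squarefree q" "q dvd x ^ k"
  shows "q dvd x"
proof -
  define d where "d = gcd q x"
  obtain e where e: "q = d * e" unfolding d_def by (metis dvd_def gcd_dvd1)
  define c where "c = gcd e x"
  have "c dvd d" unfolding d_def c_def by (simp add: e)
  moreover have "c dvd e" by (simp add: c_def)
  ultimately have "c ^ 2 dvd q" unfolding e power2_eq_square by (rule mult_dvd_mono)
  with assms(1) have "is_unit c" by (rule squarefreeD)
  hence "coprime e x" by (simp add: c_def coprime_iff_gcd_eq_1)
  hence "coprime e (x ^ k)" by simp
  moreover have "e dvd x ^ k" using assms(2) e by (metis dvd_mult_right)
  ultimately have "is_unit e" by (metis coprime_absorb_left)
  hence "q dvd d" unfolding e by simp
  also have "d dvd x" by (simp add: d_def)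
  finally show ?thesis .
qed

text \<open>The two numbers are the coordinates of u^2 + v^2 for u = g + h phi and v = k + l phi.
  Modulo the inert prime 2 this is (u + v)^2, so u and v agree modulo 2; then u^2 + v^2 is 2 u^2
  modulo 4, and u is divisible by 2 as well.\<close>

lemma sum_squares_mod4:
  fixes g h k l :: int
  assumes 1: "4 dvd g * g + h * h + (k * k + l * l)"
    and 2: "4 dvd 2 * g * h + h * h + (2 * k * l + l * l)"
  shows "even g \<and> even h \<and> even k \<and> even l"
proof -
  have not4: "\<not> 4 dvd 4 * z + 2" for z :: int by presburger
  have "even (2 * g * h + h * h + (2 * k * l + l * l))"
    using 2 by (meson dvd_trans even_numeral)
  hence hl: "even h \<longleftrightarrow> even l" by auto
  have "even (g * g + h * h + (k * k + l * l))"
    using 1 by (meson dvd_trans even_numeral)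
  hence gk: "even g \<longleftrightarrow> even k" using hl by auto
  have "even h"
  proof (rule ccontr)
    assume "odd h"
    with hl obtain h' l' where h': "h = 2 * h' + 1" and l': "l = 2 * l' + 1" by (metis oddE)
    obtain e where e: "g + k = 2 * e" using gk by (metis even_add evenE)
    hence k: "k = 2 * e - g" by simp
    have "2 * g * h + h * h + (2 * k * l + l * l)
        = 4 * (g * h' + h' * h' + h' + e - (g * l') + 2 * e * l' + l' * l' + l') + 2"
      unfolding h' l' k by (simp add: algebra_simps)
    thus False using 2 not4 by metis
  qed
  moreover have "even g"
  proof (rule ccontr)
    assume "odd g"
    with gk obtain g' k' where g': "g = 2 * g' + 1" and k': "k = 2 * k' + 1" by (metis oddE)
    obtain h' l' where h': "h = 2 * h'" and l': "l = 2 * l'" using \<open>even h\<close> hl by (metis evenE)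
    have "g * g + h * h + (k * k + l * l) = 4 * (g' * g' + g' + h' * h' + k' * k' + k' + l' * l') + 2"
      unfolding g' h' k' l' by (simp add: algebra_simps)
    thus False using 1 not4 by metis
  qed
  ultimately show ?thesis using hl gk by blast
qed

text \<open>In lowest terms x^k has denominator b^k, which must divide D for every k. The exponent k
  = D already forces b = 1, because 2^D > D.\<close>

lemma int_of_bounded_denominators:
  fixes x :: real
  assumes "x \<in> \<rat>" "D > 0" and int: "\<And>k. of_nat D * x ^ k \<in> \<int>"
  shows "x \<in> \<int>"
proof -
  from assms(1) obtain a b :: int where b: "b > 0" "coprime a b" "x = of_int a / of_int b"
    by (rule Rats_cases')
  have dvd: "b ^ k dvd int D" for k
  proof -
    obtain j where "of_nat D * x ^ k = of_int j" using int[of k] by (auto elim: Ints_cases)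
    hence "of_int (int D * a ^ k) = (of_int (j * b ^ k) :: real)"
      using b by (simp add: field_simps)
    hence "int D * a ^ k = j * b ^ k" by (simp only: of_int_eq_iff)
    hence "b ^ k dvd int D * a ^ k" by simp
    moreover have "coprime (b ^ k) (a ^ k)" using b(2) by (simp add: ac_simps)
    ultimately show ?thesis by (simp add: coprime_dvd_mult_left_iff)
  qed
  have "b = 1"
  proof (rule ccontr)
    assume "b \<noteq> 1"
    hence "b \<ge> 2" using b by linarith
    hence "2 ^ D \<le> b ^ D" by (simp add: power_mono)
    moreover have "int D < 2 ^ D" by (metis of_nat_less_two_power)
    moreover have "b ^ D \<le> int D" using dvd[of D] assms(2) by (simp add: zdvd_imp_le)
    ultimately show False by linarith
  qed
  thus ?thesis using b by simp
qed

section \<open>Elementary inequalities and determinants\<close>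

lemma powi_bracket:
  fixes b R :: real
  assumes "b > 1" "R > 0"
  shows "\<exists>k::int. b powi k \<le> R \<and> R < b powi (k + 1)"
proof -
  define k where "k = \<lfloor>log b R\<rfloor>"
  have "b powr real_of_int k \<le> R"
    using assms by (subst powr_le_iff) (auto simp: k_def)
  moreover have "R < b powr real_of_int (k + 1)"
    using assms by (subst less_powr_iff) (auto simp: k_def)
  moreover have "b powr real_of_int k = b powi k" "b powr real_of_int (k + 1) = b powi (k + 1)"
    by (rule powr_real_of_int'; use assms in simp)+
  ultimately show ?thesis by (intro exI[of _ k]) simp
qed

text \<open>The two differences are c y (e - 1/e) and c x (e^2 - 1). The factor c stands for 1, phi
  / sqrt 5 or its conjugate.\<close>

lemma quadrant_coords:
  fixes c e x y :: real
  assumes "e > 1" "c > 0"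
  shows "c * (x + y * inverse e) \<le> c * (x + y * e) \<Longrightarrow> y \<ge> 0"
    and "c * (x + y * e) \<le> e ^ 2 * (c * (x + y * inverse e)) \<Longrightarrow> x \<ge> 0"
proof -
  have e0: "e > 0" using assms by simp
  have ie: "inverse e < e"
  proof -
    have "inverse e < 1" using assms by (simp add: field_simps)
    thus ?thesis using assms by simp
  qed
  show "y \<ge> 0" if "c * (x + y * inverse e) \<le> c * (x + y * e)"
  proof -
    have "x + y * inverse e \<le> x + y * e" using that assms(2) by simp
    hence "0 \<le> y * (e - inverse e)" by (simp add: algebra_simps)
    thus ?thesis using ie by (simp add: zero_le_mult_iff)
  qed
  show "x \<ge> 0" if "c * (x + y * e) \<le> e ^ 2 * (c * (x + y * inverse e))"
  proof -
    have "e ^ 2 * (c * (x + y * inverse e)) = c * (e ^ 2 * x + y * e)"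
      using e0 by (simp add: field_simps power2_eq_square)
    hence "x + y * e \<le> e ^ 2 * x + y * e" using that assms(2) by simp
    hence "0 \<le> x * (e ^ 2 - 1)" by (simp add: algebra_simps)
    moreover have "e ^ 2 > 1" using assms by (simp add: one_less_power)
    ultimately show ?thesis by (simp add: zero_le_mult_iff)
  qed
qed

text \<open>The passage to matrices supplies multiplicativity, on which the change of basis in
  \<open>det4_int_mult\<close> rests.\<close>

lemma det4_eq_det: "det4 M = det (mat 4 4 (\<lambda>(i, j). M i j))"
proof -
  have "det (mat 4 4 (\<lambda>(i, j). M i j)) = (\<Sum>\<pi> | \<pi> permutes {0..<4::nat}.
      of_int (sign \<pi>) * (\<Prod>i = 0..<4. mat 4 4 (\<lambda>(i, j). M i j) $$ (i, \<pi> i)))"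
    by (subst det_def'[of _ 4]) simp_all
  also have "\<dots> = det4 M" unfolding det4_def atLeast0LessThan
  proof (intro sum.cong refl arg_cong2[where f = "(*)"] prod.cong)
    fix \<pi> :: "nat \<Rightarrow> nat" and i :: nat
    assume "\<pi> \<in> {\<pi>. \<pi> permutes {..<4}}" "i \<in> {..<4}"
    hence "\<pi> i < 4" using permutes_in_image[of \<pi> "{..<4}" i] by auto
    thus "mat 4 4 (\<lambda>(i, j). M i j) $$ (i, \<pi> i) = M i (\<pi> i)" using \<open>i \<in> {..<4}\<close> by simp
  qed
  finally show ?thesis ..
qed

lemma det4_cong:
  assumes "\<And>i j. i < 4 \<Longrightarrow> j < 4 \<Longrightarrow> M i j = M' i j"
  shows "det4 M = det4 M'"
proof -
  have "mat 4 4 (\<lambda>(i, j). M i j) = mat 4 4 (\<lambda>(i, j). M' i j)" by (rule eq_matI) (auto simp: assms)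
  thus ?thesis by (simp add: det4_eq_det)
qed

lemma det4_int_mult:
  "\<exists>k::int. det4 (\<lambda>i j. \<Sum>l<4. M i l * of_int (c j l)) = det4 M * of_int k"
proof -
  let ?C = "mat 4 4 (\<lambda>(l, j). c j l)" and ?M = "mat 4 4 (\<lambda>(i, j). M i j)"
  have "mat 4 4 (\<lambda>(i, j). \<Sum>l<4. M i l * of_int (c j l)) = ?M * map_mat of_int ?C"
    by (rule eq_matI) (auto simp: scalar_prod_def atLeast0LessThan)
  hence "det4 (\<lambda>i j. \<Sum>l<4. M i l * of_int (c j l)) = det ?M * det (map_mat of_int ?C)"
    unfolding det4_eq_det by (subst det_mult[of _ 4, symmetric]) simp_all
  also have "\<dots> = det4 M * of_int (det ?C)" by (simp add: det4_eq_det)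
  finally show ?thesis ..
qed

text \<open>With the two middle columns exchanged this is the Kronecker product of (1 f; 1 g) and (1
  s; 1 -s), whose determinant is 4 s^2 (f - g)^2. The exchange accounts for the minus sign before
  squaring.\<close>

lemma det4_explicit:
  "det4 (\<lambda>i j. if i = 0 then (if j = 0 then 1 else if j = 1 then f else if j = 2 then s else f * s)
     else if i = 1 then (if j = 0 then 1 else if j = 1 then f else if j = 2 then - s else - (f * s))
     else if i = 2 then (if j = 0 then 1 else if j = 1 then g else if j = 2 then s else g * s)
     else (if j = 0 then 1 else if j = 1 then g else if j = 2 then - s else - (g * s))) ^ 2
   = 16 * s ^ 4 * (f - g) ^ 4"
proof -
  have set4: "{..<4::nat} = {0, 1, 2, 3}" by auto
  have f1: "finite {1, 2, 3::nat}" "0 \<notin> {1, 2, 3::nat}" by auto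
  have f2: "finite {2, 3::nat}" "1 \<notin> {2, 3::nat}" by auto
  have f3: "finite {3::nat}" "2 \<notin> {3::nat}" by auto
  have "det4 M = (M 0 0 * (M 1 1 * (M 2 2 * M 3 3 - M 2 3 * M 3 2) - M 1 2 * (M 2 1 * M 3 3 - M 2 3 * M 3 1) + M 1 3 * (M 2 1 * M 3 2 - M 2 2 * M 3 1))
    - M 0 1 * (M 1 0 * (M 2 2 * M 3 3 - M 2 3 * M 3 2) - M 1 2 * (M 2 0 * M 3 3 - M 2 3 * M 3 0) + M 1 3 * (M 2 0 * M 3 2 - M 2 2 * M 3 0))
    + M 0 2 * (M 1 0 * (M 2 1 * M 3 3 - M 2 3 * M 3 1) - M 1 1 * (M 2 0 * M 3 3 - M 2 3 * M 3 0) + M 1 3 * (M 2 0 * M 3 1 - M 2 1 * M 3 0))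
    - M 0 3 * (M 1 0 * (M 2 1 * M 3 2 - M 2 2 * M 3 1) - M 1 1 * (M 2 0 * M 3 2 - M 2 2 * M 3 0) + M 1 2 * (M 2 0 * M 3 1 - M 2 1 * M 3 0)))" for M
    unfolding det4_def set4
    unfolding sum_over_permutations_insert[OF f1]
    unfolding sum_over_permutations_insert[OF f2]
    unfolding sum_over_permutations_insert[OF f3]
    unfolding permutes_sing
    by (simp add: sign_swap_id permutation_swap_id permutation_compose sign_compose sign_id swap_id_eq) (simp add: algebra_simps)
  note this[of "\<lambda>i j. if i = 0 then (if j = 0 then 1 else if j = 1 then f else if j = 2 then s else f * s)
     else if i = 1 then (if j = 0 then 1 else if j = 1 then f else if j = 2 then - s else - (f * s))
     else if i = 2 then (if j = 0 then 1 else if j = 1 then g else if j = 2 then s else g * s)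
     else (if j = 0 then 1 else if j = 1 then g else if j = 2 then - s else - (g * s))"]
  hence "det4 (\<lambda>i j. if i = 0 then (if j = 0 then 1 else if j = 1 then f else if j = 2 then s else f * s)
     else if i = 1 then (if j = 0 then 1 else if j = 1 then f else if j = 2 then - s else - (f * s))
     else if i = 2 then (if j = 0 then 1 else if j = 1 then g else if j = 2 then s else g * s)
     else (if j = 0 then 1 else if j = 1 then g else if j = 2 then - s else - (g * s)))
    = - 4 * (s * s) * ((f - g) * (f - g))" by (simp add: algebra_simps)
  thus ?thesis by (simp add: power2_eq_square power4_eq_xxxx)
qed

section \<open>The field and its embeddings\<close>

text \<open>As m is odd, X^2 - 5 Y^2 = -4 and so r = 5 p; \<open>sqf_5p\<close> is the hypothesis on
  r. That m is 3 modulo 12 makes X and Y even and X congruent to -1 modulo 5.\<close>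

locale fibonacci_biquadratic =
  fixes n m :: nat and X Y p :: int
  assumes m_eq: "m = 12 * n + 3"
    and X_eq: "X = xs m" and Y_eq: "Y = ys m" and p_eq: "p = Y ^ 2 - 1"
    and sqf_p: "squarefree p" and sqf_5p: "squarefree (5 * p)"
begin

abbreviation sp :: real where "sp \<equiv> sqrt (of_int p)"

lemma odd_m: "odd m" by (simp add: m_eq)

lemma psi_m: "psi ^ m = - inverse (phi ^ m)"
proof -
  have "phi ^ m * psi ^ m = -1" using odd_m by (simp add: power_mult_distrib[symmetric] phi_rel)
  thus ?thesis by (simp add: field_simps)
qed

lemma X_phi: "real_of_int X = phi ^ m - inverse (phi ^ m)"
  and Y_phi: "real_of_int Y * sqrt 5 = phi ^ m + inverse (phi ^ m)"
  by (simp_all add: X_eq Y_eq xs_binet ys_binet psi_m)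

lemma phi_m_ge: "phi ^ m \<ge> phi ^ 3"
  by (rule power_increasing) (simp_all add: m_eq less_imp_le)

lemma phi_m_gt: "phi ^ m > 4236/1000"
  using phi_m_ge phi_bounds by (simp add: phi_power_small)

lemma inverse_phi_m_lt: "inverse (phi ^ m) < 1/4" "inverse (phi ^ m) > 0"
  using phi_m_gt by (auto simp: field_simps)

lemma X_ge: "X \<ge> 4"
proof -
  have "real_of_int X > 3" using phi_m_gt inverse_phi_m_lt unfolding X_phi by linarith
  thus ?thesis by linarith
qed

lemma Y_ge: "Y \<ge> 2"
proof -
  have "real_of_int Y * sqrt 5 > 1 * sqrt 5"
    using phi_m_gt inverse_phi_m_lt sqrt5_bounds unfolding Y_phi by linarith
  hence "real_of_int Y > 1" by (rule mult_right_less_imp_less) simp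
  thus ?thesis by linarith
qed

lemma X_Y_even: "even X" "even Y"
  using xs_ys_even[of "4 * n + 1"] by (simp_all add: X_eq Y_eq m_eq add_ac)

lemma X_mod5: "5 dvd X + 1"
  using xs_mod5'[of "3 * n"] by (simp add: X_eq m_eq)

lemma X_sq: "X ^ 2 - 1 = 5 * p"
  using xs_ys_norm[of m] odd_m by (simp add: X_eq Y_eq p_eq)

lemma p_ge: "p \<ge> 3"
  using power_mono[OF Y_ge, of 2] by (simp add: p_eq)

lemma p_mod4: "4 dvd p + 1"
proof -
  obtain k where "Y = 2 * k" using X_Y_even(2) by (rule evenE)
  thus ?thesis by (simp add: p_eq power_mult_distrib)
qed

lemma not_5_dvd_p: "\<not> 5 dvd p"
proof
  assume "5 dvd p"
  hence "5 ^ 2 dvd 5 * p" by (auto simp: power2_eq_square)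
  from squarefreeD[OF sqf_5p this] show False by simp
qed

lemma sp_sq: "sp * sp = of_int p" and sp_pos: "sp > 0"
  using p_ge by simp_all

lemma sqrt_5p: "sqrt (5 * of_int p) = sqrt 5 * sp"
  by (simp add: real_sqrt_mult)

lemma nonsquare_pred:
  fixes z :: int
  assumes "z \<ge> 2"
  shows "j ^ 2 \<noteq> z ^ 2 - 1"
proof
  assume h: "j ^ 2 = z ^ 2 - 1"
  have "\<bar>j\<bar> < z" by (rule power2_less_imp_less) (use h assms in auto)
  moreover have "(z - 1) ^ 2 < \<bar>j\<bar> ^ 2" using h assms by (simp add: power2_eq_square algebra_simps)
  hence "z - 1 < \<bar>j\<bar>" by (rule power2_less_imp_less) simp
  ultimately show False by linarith
qed

lemma sp_irrat: "sp \<notin> \<rat>" and sqrt_5p_irrat: "sqrt 5 * sp \<notin> \<rat>"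
proof -
  show "sp \<notin> \<rat>"
    by (rule sqrt_notin_Rats) (use p_ge nonsquare_pred[OF Y_ge] p_eq in auto)
  have "sqrt (of_int (5 * p)) \<notin> \<rat>"
    by (rule sqrt_notin_Rats) (use p_ge nonsquare_pred[of X] X_ge X_sq in auto)
  thus "sqrt 5 * sp \<notin> \<rat>" by (simp add: sqrt_5p)
qed

text \<open>If c + d sqrt 5 were nonzero, division would give sqrt p = u + v sqrt 5. Squaring yields
  u v = 0, so sqrt p or sqrt (5 p) would be rational.\<close>

lemma indep:
  assumes "a \<in> \<rat>" "b \<in> \<rat>" "c \<in> \<rat>" "d \<in> \<rat>"
    and eq: "(a + b * sqrt 5) + (c + d * sqrt 5) * sp = 0"
  shows "a = 0 \<and> b = 0 \<and> c = 0 \<and> d = 0"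
proof -
  have cd: "c = 0 \<and> d = 0"
  proof (rule ccontr)
    assume n: "\<not> (c = 0 \<and> d = 0)"
    define N where "N = c ^ 2 - 5 * d ^ 2"
    have "- d \<in> \<rat>" using assms(4) by simp
    hence cd0: "c + d * sqrt 5 \<noteq> 0" "c + (-d) * sqrt 5 \<noteq> 0"
      using n sqrt5_indep[OF assms(3,4)] sqrt5_indep[OF assms(3), of "-d"] by (blast, force)
    have N_eq: "N = (c + d * sqrt 5) * (c + (-d) * sqrt 5)"
      by (simp add: N_def power2_eq_square algebra_simps)
    hence N0: "N \<noteq> 0" using cd0 by auto
    define u v where "u = - (a * c - 5 * b * d) / N" and "v = - (b * c - a * d) / N"
    have uv: "u \<in> \<rat>" "v \<in> \<rat>" using assms unfolding u_def v_def N_def by (auto simp: power2_eq_square)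
    have "sp * N = - (a + b * sqrt 5) * (c + (-d) * sqrt 5)"
    proof -
      have "sp * N = ((c + d * sqrt 5) * sp) * (c + (-d) * sqrt 5)" by (simp add: N_eq)
      also have "(c + d * sqrt 5) * sp = - (a + b * sqrt 5)" using eq by linarith
      finally show ?thesis .
    qed
    also have "\<dots> = (u + v * sqrt 5) * N" using N0 by (simp add: u_def v_def field_simps)
    finally have s: "sp = u + v * sqrt 5" using N0 by simp
    have "of_int p = (u + v * sqrt 5) * (u + v * sqrt 5)" using sp_sq s by simp
    hence "(u * u + 5 * v * v - of_int p) + (2 * u * v) * sqrt 5 = 0" by (simp add: algebra_simps)
    from sqrt5_indep[OF _ _ this] uv have "2 * u * v = 0" by simp
    hence "u = 0 \<or> v = 0" by simp
    thus False
    proof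
      assume "u = 0"
      hence "sqrt 5 * sp = 5 * v" using s by simp
      thus False using sqrt_5p_irrat uv by simp
    next
      assume "v = 0"
      thus False using s sp_irrat uv by simp
    qed
  qed
  with eq have "a + b * sqrt 5 = 0" by simp
  from sqrt5_indep[OF assms(1,2) this] cd show ?thesis by blast
qed

lemma elt_eq: "elt p a b c d = (a + b * sqrt 5) + (c + d * sqrt 5) * sp"
  unfolding elt_def sqrt_5p by (simp add: algebra_simps)

lemma coords_elt:
  assumes "a \<in> \<rat>" "b \<in> \<rat>" "c \<in> \<rat>" "d \<in> \<rat>"
  shows "coords p (elt p a b c d) = (a, b, c, d)"
  unfolding coords_def
proof (rule the_equality)
  fix z :: "real \<times> real \<times> real \<times> real"
  assume z: "case z of (a', b', c', d') \<Rightarrow> a' \<in> \<rat> \<and> b' \<in> \<rat> \<and> c' \<in> \<rat> \<and> d' \<in> \<rat> \<and>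
      elt p a b c d = elt p a' b' c' d'"
  obtain a' b' c' d' where zz: "z = (a', b', c', d')" by (cases z) auto
  have "((a - a') + (b - b') * sqrt 5) + ((c - c') + (d - d') * sqrt 5) * sp = 0"
    using z by (simp add: zz elt_eq algebra_simps)
  from indep[OF _ _ _ _ this] z assms have "a - a' = 0 \<and> b - b' = 0 \<and> c - c' = 0 \<and> d - d' = 0"
    by (simp add: zz)
  thus "z = (a, b, c, d)" by (simp add: zz)
qed (use assms in simp)

lemma emb_elt:
  assumes "a \<in> \<rat>" "b \<in> \<rat>" "c \<in> \<rat>" "d \<in> \<rat>"
  shows "emb p s t (elt p a b c d) = (a + b * (s * sqrt 5)) + (c + d * (s * sqrt 5)) * (t * sp)"
  unfolding emb_def coords_elt[OF assms] sqrt_5p by (simp add: algebra_simps)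

lemma K_cases:
  assumes "x \<in> Kfield p"
  obtains a b c d where "a \<in> \<rat>" "b \<in> \<rat>" "c \<in> \<rat>" "d \<in> \<rat>" "x = elt p a b c d"
  using assms by (auto simp: Kfield_def)

lemma K_elt [intro]: "a \<in> \<rat> \<Longrightarrow> b \<in> \<rat> \<Longrightarrow> c \<in> \<rat> \<Longrightarrow> d \<in> \<rat> \<Longrightarrow> elt p a b c d \<in> Kfield p"
  by (auto simp: Kfield_def)

lemma K_rat: "a \<in> \<rat> \<Longrightarrow> a \<in> Kfield p" and emb_rat: "a \<in> \<rat> \<Longrightarrow> emb p s t a = a"
  using K_elt[of a 0 0 0] emb_elt[of a 0 0 0 s t] by (simp_all add: elt_def)

lemma emb_sqrt5: "emb p s t (sqrt 5) = s * sqrt 5"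
  using emb_elt[of 0 1 0 0 s t] by (simp_all add: elt_def)

lemma K_sp: "sp \<in> Kfield p" and emb_sp: "emb p s t sp = t * sp"
  using K_elt[of 0 0 1 0] emb_elt[of 0 0 1 0 s t] by (simp_all add: elt_def)

lemma K_add: "x \<in> Kfield p \<Longrightarrow> y \<in> Kfield p \<Longrightarrow> x + y \<in> Kfield p"
  and emb_add: "x \<in> Kfield p \<Longrightarrow> y \<in> Kfield p \<Longrightarrow> emb p s t (x + y) = emb p s t x + emb p s t y"
proof -
  assume xK: "x \<in> Kfield p" and yK: "y \<in> Kfield p"
  obtain a b c d where r: "a \<in> \<rat>" "b \<in> \<rat>" "c \<in> \<rat>" "d \<in> \<rat>" and x: "x = elt p a b c d"
    using xK by (rule K_cases)
  obtain a' b' c' d' where r2: "a' \<in> \<rat>" "b' \<in> \<rat>" "c' \<in> \<rat>" "d' \<in> \<rat>" and y: "y = elt p a' b' c' d'"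
    using yK by (rule K_cases)
  note xy = x y
  have e: "x + y = elt p (a + a') (b + b') (c + c') (d + d')"
    by (simp add: xy elt_eq algebra_simps)
  show "x + y \<in> Kfield p" unfolding e using r r2 by auto
  show "emb p s t (x + y) = emb p s t x + emb p s t y"
    unfolding e unfolding xy using r r2 by (simp add: emb_elt algebra_simps)
qed

text \<open>Stated for arbitrary square roots q of 5 and w of P, so that the same identity gives the
  product in K and in each conjugate embedding. This is why \<open>emb\<close> is
  multiplicative.\<close>

lemma mult_identity:
  fixes q w :: real
  assumes "q * q = 5" "w * w = P"
  shows "((a + b * q) + (c + d * q) * w) * ((a' + b' * q) + (c' + d' * q) * w)
    = ((a * a' + 5 * b * b' + P * (c * c' + 5 * d * d')) + (a * b' + b * a' + P * (c * d' + d * c')) * q)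
      + ((a * c' + c * a' + 5 * (b * d' + d * b')) + (a * d' + d * a' + b * c' + c * b') * q) * w"
proof -
  have 1: "(a + b * q) * (a' + b' * q) = (a * a' + 5 * b * b') + (a * b' + b * a') * q"
    for a b a' b' :: real
  proof -
    have "(a + b * q) * (a' + b' * q) = a * a' + b * b' * (q * q) + (a * b' + b * a') * q"
      by (simp add: algebra_simps)
    thus ?thesis by (simp add: assms)
  qed
  have 2: "(A + C * w) * (A' + C' * w) = (A * A' + P * (C * C')) + (A * C' + C * A') * w" for A C A' C'
  proof -
    have "(A + C * w) * (A' + C' * w) = A * A' + (w * w) * (C * C') + (A * C' + C * A') * w"
      by (simp add: algebra_simps)
    thus ?thesis by (simp add: assms)
  qed
  show ?thesis unfolding 2 1 by (simp add: algebra_simps)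
qed

lemma K_mult: "x \<in> Kfield p \<Longrightarrow> y \<in> Kfield p \<Longrightarrow> x * y \<in> Kfield p"
  and emb_mult: "x \<in> Kfield p \<Longrightarrow> y \<in> Kfield p \<Longrightarrow> s \<in> {-1, 1} \<Longrightarrow> t \<in> {-1, 1} \<Longrightarrow>
    emb p s t (x * y) = emb p s t x * emb p s t y"
proof -
  assume xK: "x \<in> Kfield p" and yK: "y \<in> Kfield p"
  obtain a b c d where r: "a \<in> \<rat>" "b \<in> \<rat>" "c \<in> \<rat>" "d \<in> \<rat>" and x: "x = elt p a b c d"
    using xK by (rule K_cases)
  obtain a' b' c' d' where r2: "a' \<in> \<rat>" "b' \<in> \<rat>" "c' \<in> \<rat>" "d' \<in> \<rat>" and y: "y = elt p a' b' c' d'"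
    using yK by (rule K_cases)
  note xy = x y
  let ?a = "a * a' + 5 * b * b' + of_int p * (c * c' + 5 * d * d')"
    and ?b = "a * b' + b * a' + of_int p * (c * d' + d * c')"
    and ?c = "a * c' + c * a' + 5 * (b * d' + d * b')" and ?d = "a * d' + d * a' + b * c' + c * b'"
  have e: "x * y = elt p ?a ?b ?c ?d"
    unfolding xy elt_eq by (rule mult_identity) (simp, rule sp_sq)
  have r': "?a \<in> \<rat>" "?b \<in> \<rat>" "?c \<in> \<rat>" "?d \<in> \<rat>" using r r2 by auto
  show "x * y \<in> Kfield p" unfolding e using r' by blast
  assume st: "s \<in> {-1, 1}" "t \<in> {-1, 1}"
  show "emb p s t (x * y) = emb p s t x * emb p s t y"
    unfolding e emb_elt[OF r'] unfolding xy emb_elt[OF r] emb_elt[OF r2]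
    by (rule mult_identity[symmetric]) (use st p_ge in auto)
qed

lemma emb_emb: "x \<in> Kfield p \<Longrightarrow> s' \<in> \<rat> \<Longrightarrow> t' \<in> \<rat> \<Longrightarrow> emb p s t (emb p s' t' x) = emb p (s * s') (t * t') x"
  and emb_1_1: "x \<in> Kfield p \<Longrightarrow> emb p 1 1 x = x"
proof -
  assume "x \<in> Kfield p"
  then obtain a b c d where r: "a \<in> \<rat>" "b \<in> \<rat>" "c \<in> \<rat>" "d \<in> \<rat>" and x: "x = elt p a b c d"
    by (rule K_cases)
  have e: "emb p s t x = elt p a (b * s) (c * t) (d * s * t)" for s t
    unfolding x emb_elt[OF r] unfolding elt_eq by (simp add: algebra_simps)
  show "emb p 1 1 x = x" unfolding x emb_elt[OF r] by (simp add: elt_eq)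
  show "emb p s t (emb p s' t' x) = emb p (s * s') (t * t') x" if "s' \<in> \<rat>" "t' \<in> \<rat>"
    unfolding e[of s' t'] using r that
    by (subst emb_elt) (auto simp: e elt_eq algebra_simps)
qed

subsection \<open>The ring of integers\<close>

text \<open>This will be the whole ring of integers: p is 3 modulo 4, so no halves occur over
  Z[phi]. As \<open>eta\<close> and \<open>sp\<close> differ by the integer Y, 1 and
  \<open>eta\<close> form another basis.\<close>

definition Lam :: "real set" where
  "Lam = {x + y * sp | x y. x \<in> Zphi \<and> y \<in> Zphi}"

lemma Lam_I: "x \<in> Zphi \<Longrightarrow> y \<in> Zphi \<Longrightarrow> x + y * sp \<in> Lam"
  by (auto simp: Lam_def)

lemma Lam_cases:
  assumes "z \<in> Lam" obtains x y where "x \<in> Zphi" "y \<in> Zphi" "z = x + y * sp"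
  using assms by (auto simp: Lam_def)

lemma Lam_Zphi [simp]: "x \<in> Zphi \<Longrightarrow> x \<in> Lam"
  using Lam_I[of x 0] by simp

lemma Lam_sp [simp]: "sp \<in> Lam"
  using Lam_I[of 0 1] by simp

lemma Lam_add [simp]: "z \<in> Lam \<Longrightarrow> w \<in> Lam \<Longrightarrow> z + w \<in> Lam"
proof (elim Lam_cases)
  fix x y x' y' assume "x \<in> Zphi" "y \<in> Zphi" "x' \<in> Zphi" "y' \<in> Zphi" "z = x + y * sp" "w = x' + y' * sp"
  thus "z + w \<in> Lam" using Lam_I[of "x + x'" "y + y'"] by (simp add: algebra_simps)
qed

lemma Lam_mult [simp]: "z \<in> Lam \<Longrightarrow> w \<in> Lam \<Longrightarrow> z * w \<in> Lam"
proof (elim Lam_cases)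
  fix x y x' y' assume h: "x \<in> Zphi" "y \<in> Zphi" "x' \<in> Zphi" "y' \<in> Zphi" "z = x + y * sp" "w = x' + y' * sp"
  have "z * w = (x * x' + y * y' * (sp * sp)) + (x * y' + y * x') * sp"
    unfolding h by (simp add: algebra_simps)
  also have "\<dots> \<in> Lam" unfolding sp_sq using h(1-4) by (intro Lam_I) auto
  finally show "z * w \<in> Lam" .
qed

lemma Lam_minus [simp]: "z \<in> Lam \<Longrightarrow> - z \<in> Lam"
  using Lam_mult[of "-1" z] by simp

lemma Lam_diff [simp]: "z \<in> Lam \<Longrightarrow> w \<in> Lam \<Longrightarrow> z - w \<in> Lam"
  using Lam_add[OF _ Lam_minus, of z w] by simp

lemma Lam_power [simp]: "z \<in> Lam \<Longrightarrow> z ^ k \<in> Lam"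
  by (induction k) simp_all

lemma Lam_sum: "(\<And>i. i \<in> I \<Longrightarrow> f i \<in> Lam) \<Longrightarrow> sum f I \<in> Lam"
  by (induction I rule: infinite_finite_induct) simp_all

lemma Zphi_K: "x \<in> Zphi \<Longrightarrow> x \<in> Kfield p"
proof (elim Zphi_cases)
  fix a b :: int assume "x = of_int a + of_int b * phi"
  hence "x = elt p (of_int a + of_int b / 2) (of_int b / 2) 0 0" by (simp add: elt_eq phi_def field_simps)
  also have "\<dots> \<in> Kfield p" by (rule K_elt) simp_all
  finally show ?thesis .
qed

lemma Lam_K: "x \<in> Lam \<Longrightarrow> x \<in> Kfield p"
  by (elim Lam_cases) (auto intro: K_add K_mult Zphi_K K_sp)

lemma Lam_Rats:
  assumes "x \<in> Lam" "x \<in> \<rat>" shows "x \<in> \<int>"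
proof -
  from assms(1) obtain a b c d :: int where
    x: "x = (of_int a + of_int b * phi) + (of_int c + of_int d * phi) * sp"
    by (elim Lam_cases Zphi_cases) auto
  have "((of_int a + of_int b / 2 - x) + (of_int b / 2) * sqrt 5)
      + ((of_int c + of_int d / 2) + (of_int d / 2) * sqrt 5) * sp = 0"
    unfolding x by (simp add: phi_def field_simps)
  from indep[OF _ _ _ _ this] assms(2) have "of_int a + of_int b / 2 - x = 0 \<and> of_int b / (2::real) = 0"
    by simp
  hence "x = of_int a" by simp
  thus ?thesis by simp
qed

lemma emb_Zphi:
  "s \<in> {-1, 1} \<Longrightarrow> emb p s t (of_int a + of_int b * phi) = of_int a + of_int b * (if s = 1 then phi else psi)"
proof -
  assume s: "s \<in> {-1, 1}"
  have "of_int a + of_int b * phi = elt p (of_int a + of_int b / 2) (of_int b / 2) 0 0"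
    by (simp add: elt_eq phi_def field_simps)
  thus ?thesis using s by (subst \<open>_ = _\<close>, subst emb_elt) (auto simp: phi_def psi_def field_simps)
qed

lemma emb_Zphi_in: "x \<in> Zphi \<Longrightarrow> s \<in> {-1, 1} \<Longrightarrow> emb p s t x \<in> Zphi"
  by (elim Zphi_cases) (simp add: emb_Zphi psi_eq)

lemma emb_Zphi_s1: "x \<in> Zphi \<Longrightarrow> emb p 1 t x = x"
  by (elim Zphi_cases) (simp add: emb_Zphi)

lemma emb_Lam: "x \<in> Lam \<Longrightarrow> s \<in> {-1, 1} \<Longrightarrow> t \<in> {-1, 1} \<Longrightarrow> emb p s t x \<in> Lam"
proof (elim Lam_cases)
  fix a b assume h: "s \<in> {-1, 1}" "t \<in> {-1, 1}" "a \<in> Zphi" "b \<in> Zphi" "x = a + b * sp"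
  have "emb p s t x = emb p s t a + emb p s t b * (t * sp)"
    using h(1-4) unfolding h(5) by (simp only: emb_add emb_mult emb_sp Zphi_K K_mult K_sp)
  thus "emb p s t x \<in> Lam" using h emb_Zphi_in[of a s t] emb_Zphi_in[of b s t] by auto
qed

text \<open>Unlike integrality, this weaker property is evidently closed under sums and products.\<close>
definition almost_integral :: "real \<Rightarrow> bool" where
  "almost_integral x \<longleftrightarrow> (\<exists>D::nat. D > 0 \<and> (\<forall>k. of_nat D * x ^ k \<in> Lam))"

lemma almost_integral_Lam: "x \<in> Lam \<Longrightarrow> almost_integral x"
  unfolding almost_integral_def by (intro exI[of _ 1]) simp

lemma almost_integral_mult: "almost_integral x \<Longrightarrow> almost_integral y \<Longrightarrow> almost_integral (x * y)"
  unfolding almost_integral_def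
proof (elim exE conjE)
  fix D E :: nat assume h: "\<forall>k. of_nat D * x ^ k \<in> Lam" "\<forall>k. of_nat E * y ^ k \<in> Lam" "D > 0" "E > 0"
  have "of_nat (D * E) * (x * y) ^ k = (of_nat D * x ^ k) * (of_nat E * y ^ k)" for k
    by (simp add: power_mult_distrib)
  thus "\<exists>D::nat. D > 0 \<and> (\<forall>k. of_nat D * (x * y) ^ k \<in> Lam)" using h
    by (intro exI[of _ "D * E"]) (auto intro!: Lam_mult simp del: of_nat_mult)
qed

lemma almost_integral_add: "almost_integral x \<Longrightarrow> almost_integral y \<Longrightarrow> almost_integral (x + y)"
  unfolding almost_integral_def
proof (elim exE conjE)
  fix D E :: nat assume h: "\<forall>k. of_nat D * x ^ k \<in> Lam" "\<forall>k. of_nat E * y ^ k \<in> Lam" "D > 0" "E > 0"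
  have "of_nat (D * E) * (x + y) ^ k \<in> Lam" for k
  proof -
    have "of_nat (D * E) * (x + y) ^ k
        = (\<Sum>i\<le>k. of_nat (k choose i) * ((of_nat D * x ^ i) * (of_nat E * y ^ (k - i))))"
      unfolding binomial_ring sum_distrib_left by (intro sum.cong) (simp_all add: algebra_simps)
    also have "\<dots> \<in> Lam"
    proof (rule Lam_sum)
      fix i
      show "of_nat (k choose i) * ((of_nat D * x ^ i) * (of_nat E * y ^ (k - i))) \<in> Lam"
        using h(1,2) by (meson Lam_Zphi Lam_mult Zphi_0_1(4))
    qed
    finally show ?thesis .
  qed
  thus "\<exists>D::nat. D > 0 \<and> (\<forall>k. of_nat D * (x + y) ^ k \<in> Lam)" using h
    by (intro exI[of _ "D * E"]) auto
qed

lemma emb_power: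
  assumes "x \<in> Kfield p" "s \<in> {-1, 1}" "t \<in> {-1, 1}"
  shows "x ^ k \<in> Kfield p \<and> emb p s t (x ^ k) = emb p s t x ^ k"
  by (induction k) (use assms in \<open>simp_all add: K_rat emb_rat K_mult emb_mult\<close>)

lemma almost_integral_emb:
  assumes "almost_integral x" "x \<in> Kfield p" "s \<in> {-1, 1}" "t \<in> {-1, 1}"
  shows "almost_integral (emb p s t x)"
proof -
  from assms(1) obtain D :: nat where D: "D > 0" "\<And>k. of_nat D * x ^ k \<in> Lam"
    by (auto simp: almost_integral_def)
  have "of_nat D * emb p s t x ^ k = emb p s t (of_nat D * x ^ k)" for k
    using assms emb_power[OF assms(2-4), of k] by (simp add: emb_mult K_rat emb_rat)
  thus ?thesis unfolding almost_integral_def using D assms by (intro exI[of _ D]) (simp add: emb_Lam)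
qed

lemma K_denominator:
  assumes "x \<in> Kfield p" shows "\<exists>N::nat. N > 0 \<and> of_nat N * x \<in> Lam"
proof -
  from assms obtain a b c d where r: "a \<in> \<rat>" "b \<in> \<rat>" "c \<in> \<rat>" "d \<in> \<rat>" and x: "x = elt p a b c d"
    by (rule K_cases)
  have den: "\<exists>N::nat. N > 0 \<and> of_nat N * u \<in> \<int>" if "u \<in> \<rat>" for u :: real
  proof -
    from that obtain i j :: int where "j > 0" "u = of_int i / of_int j" by (rule Rats_cases')
    thus ?thesis by (intro exI[of _ "nat j"]) auto
  qed
  obtain N1 N2 N3 N4 :: nat where N: "N1 > 0" "of_nat N1 * a \<in> \<int>" "N2 > 0" "of_nat N2 * b \<in> \<int>"
    "N3 > 0" "of_nat N3 * c \<in> \<int>" "N4 > 0" "of_nat N4 * d \<in> \<int>"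
    using den[OF r(1)] den[OF r(2)] den[OF r(3)] den[OF r(4)] by blast
  have Zi: "u \<in> \<int> \<Longrightarrow> u \<in> Lam" for u by (auto elim!: Ints_cases)
  have "of_nat (N1 * N2 * N3 * N4) * x
     = of_nat (N2 * N3 * N4) * (of_nat N1 * a) + of_nat (N1 * N3 * N4) * (of_nat N2 * b) * sqrt 5
     + (of_nat (N1 * N2 * N4) * (of_nat N3 * c) + of_nat (N1 * N2 * N3) * (of_nat N4 * d) * sqrt 5) * sp"
    unfolding x elt_eq by (simp add: algebra_simps)
  also have "\<dots> \<in> Lam"
    using Zi[OF N(2)] Zi[OF N(4)] Zi[OF N(6)] Zi[OF N(8)]
    by (simp only: Lam_add Lam_mult Lam_Zphi Zphi_0_1 Zphi_sqrt5 Lam_sp)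
  finally show ?thesis using N by (intro exI[of _ "N1 * N2 * N3 * N4"]) simp
qed

text \<open>If N x lies in \<open>Lam\<close> and the monic equation has degree e, then N^e clears
  the denominators of x^k for k < e. The equation expresses each higher power by lower ones with
  integer coefficients.\<close>

lemma algebraic_integer_almost_integral:
  assumes "x \<in> Kfield p" "algebraic_integer x"
  shows "almost_integral x"
proof -
  obtain q :: "int poly" where q: "lead_coeff q = 1" "poly (map_poly of_int q) x = 0"
    using assms(2) by (auto simp: algebraic_integer_def)
  obtain N :: nat where N: "N > 0" "of_nat N * x \<in> Lam" using K_denominator[OF assms(1)] by blast
  define e where "e = degree q"
  have "poly (map_poly of_int q) x = (\<Sum>i\<le>e. of_int (coeff q i) * x ^ i)"
    by (simp add: poly_altdef e_def coeff_map_poly degree_map_poly)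
  also have "\<dots> = (\<Sum>i<e. of_int (coeff q i) * x ^ i) + x ^ e"
    using q(1) by (simp add: lessThan_Suc_atMost[symmetric] e_def)
  finally have xe: "x ^ e = - (\<Sum>i<e. of_int (coeff q i) * x ^ i)" using q(2) by simp
  have "of_nat (N ^ e) * x ^ k \<in> Lam" for k
  proof (induction k rule: less_induct)
    case (less k)
    show ?case
    proof (cases "k < e")
      case True
      hence "of_nat (N ^ e) * x ^ k = of_nat (N ^ (e - k)) * (of_nat N * x) ^ k"
        by (simp add: power_mult_distrib power_add[symmetric] mult.assoc[symmetric])
      also have "\<dots> \<in> Lam" using Lam_power[OF N(2)] by (rule Lam_mult[rotated]) simp
      finally show ?thesis .
    next
      case False
      hence "of_nat (N ^ e) * x ^ k = of_nat (N ^ e) * (x ^ (k - e) * x ^ e)"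
        by (simp add: power_add[symmetric])
      also have "\<dots> = - (\<Sum>i<e. of_int (coeff q i) * (of_nat (N ^ e) * x ^ (k - e + i)))"
        unfolding xe by (simp add: sum_distrib_left power_add algebra_simps)
      also have "\<dots> \<in> Lam"
      proof (intro Lam_minus Lam_sum)
        fix i assume "i \<in> {..<e}"
        hence "of_nat (N ^ e) * x ^ (k - e + i) \<in> Lam" using False by (intro less) auto
        thus "of_int (coeff q i) * (of_nat (N ^ e) * x ^ (k - e + i)) \<in> Lam" by (rule Lam_mult[rotated]) simp
      qed
      finally show ?thesis .
    qed
  qed
  thus ?thesis unfolding almost_integral_def using N by (intro exI[of _ "N ^ e"]) simp
qed

lemma almost_integral_Rats: "almost_integral x \<Longrightarrow> x \<in> \<rat> \<Longrightarrow> x \<in> \<int>"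
  unfolding almost_integral_def by (elim exE conjE, rule int_of_bounded_denominators) (auto intro: Lam_Rats)

text \<open>Z[phi] is integrally closed: the trace c and the norm N of x are rational and almost
  integral, hence integers, and they determine x up to conjugation.\<close>

lemma almost_integral_quadratic:
  assumes "almost_integral x" "x = a + b * sqrt 5" "a \<in> \<rat>" "b \<in> \<rat>"
  shows "x \<in> Zphi"
proof -
  have xe: "x = elt p a b 0 0" using assms by (simp add: elt_eq)
  hence xK: "x \<in> Kfield p" using assms by auto
  have tx: "emb p (-1) 1 x = a - b * sqrt 5" unfolding xe using assms by (subst emb_elt) auto
  have ax: "almost_integral (emb p (-1) 1 x)" by (rule almost_integral_emb) (use assms xK in auto)
  have "x + emb p (-1) 1 x \<in> \<int>" by (rule almost_integral_Rats[OF almost_integral_add[OF assms(1) ax]]) (use assms tx in auto)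
  hence "2 * a \<in> \<int>" unfolding tx by (simp add: assms(2))
  then obtain c where c: "2 * a = of_int c" by (auto elim: Ints_cases)
  have xx: "x * emb p (-1) 1 x = a * a - 5 * b * b" unfolding tx unfolding assms(2) by (simp add: algebra_simps)
  have "x * emb p (-1) 1 x \<in> \<int>"
    by (rule almost_integral_Rats[OF almost_integral_mult[OF assms(1) ax]]) (unfold xx, use assms(3,4) in auto)
  then obtain N where N: "a * a - 5 * b * b = of_int N" unfolding xx by (auto elim: Ints_cases)
  have e2: "(10 * b) ^ 2 = of_int (5 * (c * c - 4 * N))"
    by (simp add: c[symmetric] N[symmetric] power2_eq_square algebra_simps)
  \<comment> \<open>The square of 10 b is the integer 5 (c^2 - 4 N). The prime 5 then divides 10 b
    itself, which leaves 2 b as an integer of the same parity as c.\<close>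
  have "10 * b \<in> \<int>" by (rule rat_square_int) (use assms e2 in auto)
  then obtain e where e: "10 * b = of_int e" by (auto elim: Ints_cases)
  have "of_int (e ^ 2) = (of_int (5 * (c * c - 4 * N)) :: real)" using e2 e by simp
  hence ee: "e ^ 2 = 5 * (c * c - 4 * N)" by (simp only: of_int_eq_iff)
  have "prime (5::int)" by (simp add: prime_int_numeral_eq)
  hence "5 dvd e" using ee by (metis dvd_triv_left prime_dvd_power)
  then obtain d where d: "e = 5 * d" by auto
  have dd: "5 * (d * d) = c * c - 4 * N" using ee unfolding d by (simp add: power2_eq_square)
  hence "even (5 * (d * d)) = even (c * c)" by simp
  hence "even (c - d)" by auto
  then obtain k where k: "c = d + 2 * k" by (metis add.commute diff_add_cancel evenE)
  have "x = of_int k + of_int d * phi"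
    using c e unfolding assms(2) d k phi_def by (simp add: field_simps)
  thus ?thesis by (simp add: Zphi_I)
qed

text \<open>For x = A + B sqrt p the numbers 2A, 2pB and N = A^2 - p B^2 are traces and a norm over
  Q(sqrt 5), hence lie in Z[phi]. From (2pB)^2 = p ((2A)^2 - 4N) the denominator p of 2B is removed,
  and (2A)^2 = p (2B)^2 + 4N modulo 4 then removes the denominator 2.\<close>

lemma almost_integral_imp_Lam:
  assumes "almost_integral x" "x \<in> Kfield p" shows "x \<in> Lam"
proof -
  from assms(2) obtain a b c d where r: "a \<in> \<rat>" "b \<in> \<rat>" "c \<in> \<rat>" "d \<in> \<rat>" and x: "x = elt p a b c d"
    by (rule K_cases)
  define A B where "A = a + b * sqrt 5" and "B = c + d * sqrt 5"
  have xAB: "x = A + B * sp" by (simp add: x elt_eq A_def B_def)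
  have sx: "emb p 1 (-1) x = A - B * sp" unfolding x using r by (subst emb_elt) (auto simp: A_def B_def)
  have ax: "almost_integral (emb p 1 (-1) x)" by (rule almost_integral_emb) (use assms in auto)
  have A2: "2 * A \<in> Zphi"
  proof (rule almost_integral_quadratic)
    show "almost_integral (2 * A)" using almost_integral_add[OF assms(1) ax] unfolding sx by (simp add: xAB)
    show "2 * A = 2 * a + 2 * b * sqrt 5" by (simp add: A_def)
  qed (use r in auto)
  have W: "of_int p * (2 * B) \<in> Zphi"
  proof (rule almost_integral_quadratic)
    have "almost_integral ((x + (-1) * emb p 1 (-1) x) * sp)"
      by (intro almost_integral_mult almost_integral_add assms ax almost_integral_Lam) auto
    moreover have "(x + (-1) * emb p 1 (-1) x) * sp = (sp * sp) * (2 * B)"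
      unfolding sx unfolding xAB by (simp only: algebra_simps)
    ultimately show "almost_integral (of_int p * (2 * B))" by (simp only: sp_sq)
    show "of_int p * (2 * B) = of_int p * (2 * c) + of_int p * (2 * d) * sqrt 5"
      by (simp add: B_def algebra_simps)
  qed (use r in auto)
  have Neq: "x * emb p 1 (-1) x = A * A - of_int p * (B * B)"
  proof -
    have "x * emb p 1 (-1) x = A * A - (sp * sp) * (B * B)" unfolding sx unfolding xAB by (simp add: algebra_simps)
    thus ?thesis by (simp only: sp_sq)
  qed
  have N: "A * A - of_int p * (B * B) \<in> Zphi"
  proof (rule almost_integral_quadratic)
    show "almost_integral (A * A - of_int p * (B * B))" using almost_integral_mult[OF assms(1) ax] by (simp add: Neq)
    show "A * A - of_int p * (B * B) = (a * a + 5 * b * b - of_int p * (c * c + 5 * d * d))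
       + (2 * a * b - of_int p * (2 * c * d)) * sqrt 5"
      by (simp add: A_def B_def algebra_simps)
  qed (use r in auto)
  obtain g h where gh: "of_int p * (2 * B) = of_int g + of_int h * phi" using W by (rule Zphi_cases)
  obtain g1 h1 where gh1: "2 * A = of_int g1 + of_int h1 * phi" using A2 by (rule Zphi_cases)
  obtain e f where ef: "A * A - of_int p * (B * B) = of_int e + of_int f * phi" using N by (rule Zphi_cases)
  have "(of_int g + of_int h * phi) * (of_int g + of_int h * phi)
      = of_int p * ((of_int g1 + of_int h1 * phi) * (of_int g1 + of_int h1 * phi) - 4 * (of_int e + of_int f * phi))"
    unfolding gh[symmetric] gh1[symmetric] ef[symmetric] by (simp add: algebra_simps)
  hence "of_int (g * g + h * h) + of_int (g * h + h * g + h * h) * phi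
      = of_int (p * (g1 * g1 + h1 * h1 - 4 * e)) + of_int (p * (g1 * h1 + h1 * g1 + h1 * h1 - 4 * f)) * phi"
    unfolding phi_int_mult by (simp add: algebra_simps)
  from Zphi_unique[OF this] have p1: "p dvd g * g + h * h" and p2: "p dvd g * h + h * g + h * h" by auto
  \<comment> \<open>Squarefreeness of p persists in Z[phi], because only 5 ramifies there and 5 does
    not divide p. In coordinates: p divides g^2 + h^2 and g^2 - 2gh, hence also 5 g^4.\<close>
  have pg: "p dvd g"
  proof -
    have "p dvd (g * g + h * h) - (g * h + h * g + h * h)" using p1 p2 by (rule dvd_diff)
    hence "p dvd g * g - 2 * g * h" by (simp add: algebra_simps)
    hence "p dvd (g * g - 2 * g * h) * (g * g + 2 * g * h) + 4 * g * g * (g * g + h * h)"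
      by (intro dvd_add dvd_mult[OF p1] dvd_mult2)
    also have "(g * g - 2 * g * h) * (g * g + 2 * g * h) + 4 * g * g * (g * g + h * h) = 5 * g ^ 4"
      by (simp add: power4_eq_xxxx algebra_simps)
    finally have "p dvd 5 * g ^ 4" .
    moreover have "coprime p 5"
      using not_5_dvd_p prime_imp_coprime[of "5::int" p] by (simp add: prime_int_numeral_eq coprime_commute)
    ultimately have "p dvd g ^ 4" by (simp add: coprime_dvd_mult_right_iff)
    thus ?thesis by (rule squarefree_dvd_power[OF sqf_p])
  qed
  have ph: "p dvd h"
  proof -
    have "p dvd (g * g + h * h) - g * g" using p1 pg by (intro dvd_diff) auto
    hence "p dvd h ^ 2" by (simp add: power2_eq_square)
    thus ?thesis by (rule squarefree_dvd_power[OF sqf_p])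
  qed
  obtain k l where kl: "g = p * k" "h = p * l" using pg ph by blast
  have B2: "2 * B = of_int k + of_int l * phi"
  proof -
    have "of_int p * (2 * B) = of_int p * (of_int k + of_int l * phi)" using gh kl by (simp add: algebra_simps)
    thus ?thesis using p_ge by simp
  qed
  have "(of_int g1 + of_int h1 * phi) * (of_int g1 + of_int h1 * phi)
      = of_int p * ((of_int k + of_int l * phi) * (of_int k + of_int l * phi)) + 4 * (of_int e + of_int f * phi)"
    unfolding gh1[symmetric] B2[symmetric] ef[symmetric] by (simp add: algebra_simps)
  hence "of_int (g1 * g1 + h1 * h1) + of_int (g1 * h1 + h1 * g1 + h1 * h1) * phi
      = of_int (p * (k * k + l * l) + 4 * e) + of_int (p * (k * l + l * k + l * l) + 4 * f) * phi"
    unfolding phi_int_mult by (simp add: algebra_simps)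
  from Zphi_unique[OF this] have q1: "g1 * g1 + h1 * h1 = p * (k * k + l * l) + 4 * e"
    and q2: "g1 * h1 + h1 * g1 + h1 * h1 = p * (k * l + l * k + l * l) + 4 * f" by auto
  obtain u where u: "p = 4 * u - 1" using p_mod4 by (metis add_diff_cancel_right' dvdE)
  \<comment> \<open>As p is -1 modulo 4, the equation says that (2A)^2 + (2B)^2 vanishes modulo
    4.\<close>
  have "even g1 \<and> even h1 \<and> even k \<and> even l"
  proof (rule sum_squares_mod4)
    have "g1 * g1 + h1 * h1 + (k * k + l * l) = 4 * (u * (k * k + l * l) + e)"
      unfolding q1 u by (simp add: algebra_simps)
    thus "4 dvd g1 * g1 + h1 * h1 + (k * k + l * l)" by simp
    have "2 * g1 * h1 + h1 * h1 + (2 * k * l + l * l) = 4 * (u * (k * l + l * k + l * l) + f)"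
      using q2 unfolding u by (simp add: algebra_simps)
    thus "4 dvd 2 * g1 * h1 + h1 * h1 + (2 * k * l + l * l)" by simp
  qed
  then obtain g' h' k' l' where "g1 = 2 * g'" "h1 = 2 * h'" "k = 2 * k'" "l = 2 * l'" by (metis evenE)
  hence "A = of_int g' + of_int h' * phi" "B = of_int k' + of_int l' * phi" using gh1 B2 by auto
  thus ?thesis unfolding xAB by (simp add: Lam_I Zphi_I)
qed

text \<open>x is a root of T^2 - 2A T + N over Z[phi], written U + V phi with integer polynomials U
  and V. Its norm (U + V phi)(U + V psi) = U^2 + U V - V^2 is monic with integer
  coefficients.\<close>

lemma Lam_algebraic_integer:
  assumes "x \<in> Lam" shows "algebraic_integer x"
proof -
  from assms obtain A B where AB: "A \<in> Zphi" "B \<in> Zphi" "x = A + B * sp" by (rule Lam_cases)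
  have "2 * A \<in> Zphi" "A * A - of_int p * (B * B) \<in> Zphi" using AB by auto
  then obtain g h e f where gh: "2 * A = of_int g + of_int h * phi"
    and ef: "A * A - of_int p * (B * B) = of_int e + of_int f * phi" by (metis Zphi_cases)
  define U V :: "int poly" where "U = [:e, -g, 1:]" and "V = [:f, -h:]"
  define q where "q = U * U + U * V - V * V"
  have "lead_coeff q = 1" by (simp add: q_def U_def V_def)
  moreover have "poly (map_poly of_int q) x = 0"
  proof -
    let ?u = "x * x - of_int g * x + of_int e" and ?v = "of_int f - of_int h * x"
    have pq: "map_poly of_int q = map_poly of_int U * map_poly of_int U + map_poly of_int U * map_poly of_int V
         - map_poly of_int V * map_poly (of_int :: int \<Rightarrow> real) V"
      unfolding q_def by (intro poly_eqI) (simp add: coeff_map_poly coeff_mult)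
    have "poly (map_poly of_int q) x = ?u * ?u + ?u * ?v - ?v * ?v"
      unfolding pq by (simp add: U_def V_def map_poly_pCons algebra_simps)
    moreover have "?u = - ?v * phi"
    proof -
      have "?u + ?v * phi = x * x - (of_int g + of_int h * phi) * x + (of_int e + of_int f * phi)"
        by (simp add: algebra_simps)
      also have "\<dots> = (sp * sp - of_int p) * (B * B)"
        unfolding gh[symmetric] ef[symmetric] AB(3) by (simp add: algebra_simps)
      finally have "?u + ?v * phi = 0" by (simp only: sp_sq) simp
      thus ?thesis by (simp add: algebra_simps)
    qed
    ultimately have "poly (map_poly of_int q) x = ?v * ?v * (phi * phi - phi - 1)"
      by (simp only:) (simp add: algebra_simps)
    thus ?thesis by (simp add: phi_rel)
  qed
  ultimately show ?thesis unfolding algebraic_integer_def by blast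
qed

theorem OK_eq_Lam: "OK p = Lam"
  unfolding OK_def using Lam_algebraic_integer Lam_K almost_integral_imp_Lam algebraic_integer_almost_integral by auto

subsection \<open>Totally positive units\<close>

definition theta :: real where "theta = of_int X + sqrt 5 * sp"
definition eta :: real where "eta = of_int Y + sp"

lemma sign_simps [simp]: "(-1::real) \<in> {-1, 1}" "(1::real) \<in> {-1, 1}"
  by simp_all

lemma embL_hom:
  assumes "x \<in> Lam" "y \<in> Lam" "s \<in> {-1, 1}" "t \<in> {-1, 1}"
  shows "emb p s t (x + y) = emb p s t x + emb p s t y"
    "emb p s t (x * y) = emb p s t x * emb p s t y"
    "emb p s t (- x) = - emb p s t x"
    "emb p s t (x - y) = emb p s t x - emb p s t y"
proof -
  have K: "x \<in> Kfield p" "y \<in> Kfield p" using assms by (simp_all add: Lam_K)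
  show "emb p s t (x + y) = emb p s t x + emb p s t y" by (rule emb_add[OF K])
  show "emb p s t (x * y) = emb p s t x * emb p s t y" by (rule emb_mult[OF K assms(3,4)])
  have m: "emb p s t (- z) = - emb p s t z" if "z \<in> Kfield p" for z
    using emb_mult[OF K_rat[of "-1"] that assms(3,4)] emb_rat[of "-1" s t] by simp
  show "emb p s t (- x) = - emb p s t x" by (rule m[OF K(1)])
  have "- y \<in> Kfield p" using assms by (simp add: Lam_K)
  from emb_add[OF K(1) this] m[OF K(2)]
  show "emb p s t (x - y) = emb p s t x - emb p s t y" by simp
qed

lemma emb_int [simp]: "emb p s t (of_int a) = of_int a" "emb p s t 1 = 1" "emb p s t 0 = 0"
    "emb p s t (numeral k) = numeral k"
  by (simp_all add: emb_rat)

lemma emb_phi: "emb p 1 t phi = phi" "emb p (-1) t phi = psi"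
  using emb_Zphi[of 1 t 0 1] emb_Zphi[of "-1" t 0 1] by simp_all

lemma sta_Zphi: "x \<in> Zphi \<Longrightarrow> emb p (-1) (-1) x = emb p (-1) 1 x"
  by (elim Zphi_cases) (simp add: emb_Zphi)

lemma theta_Lam [simp]: "theta \<in> Lam" and eta_Lam [simp]: "eta \<in> Lam"
  by (simp_all add: theta_def eta_def)

lemma theta_gt: "theta > 4" and eta_gt: "eta > 2"
proof -
  have "sqrt 5 * sp > 0" "real_of_int X \<ge> 4" "real_of_int Y \<ge> 2" using sp_pos X_ge Y_ge by simp_all
  thus "theta > 4" "eta > 2" unfolding theta_def eta_def using sp_pos by linarith+
qed

lemma theta_pos [simp]: "theta > 0" "theta \<noteq> 0" "theta > 1"
  and eta_pos [simp]: "eta > 0" "eta \<noteq> 0" "eta > 1"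
  using theta_gt eta_gt by auto

lemma X_sq_real: "of_int X * of_int X = 5 * real_of_int p + 1"
  and Y_sq_real: "of_int Y * of_int Y = real_of_int p + 1"
proof -
  have "X * X = 5 * p + 1" "Y * Y = p + 1" using X_sq p_eq by (simp_all add: power2_eq_square)
  thus "of_int X * of_int X = 5 * real_of_int p + 1" "of_int Y * of_int Y = real_of_int p + 1"
    by (metis of_int_add of_int_mult of_int_numeral of_int_1)+
qed

lemma inverse_theta: "inverse theta = of_int X - sqrt 5 * sp"
proof (rule inverse_unique)
  have "theta * (of_int X - sqrt 5 * sp) = of_int X * of_int X - (sqrt 5 * sqrt 5) * (sp * sp)"
    unfolding theta_def by (simp only: algebra_simps)
  thus "theta * (of_int X - sqrt 5 * sp) = 1" unfolding sp_sq X_sq_real by simp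
qed

lemma inverse_eta: "inverse eta = of_int Y - sp"
proof (rule inverse_unique)
  have "eta * (of_int Y - sp) = of_int Y * of_int Y - sp * sp"
    unfolding eta_def by (simp only: algebra_simps)
  thus "eta * (of_int Y - sp) = 1" unfolding sp_sq Y_sq_real by simp
qed

lemma emb_theta:
  "emb p 1 1 theta = theta" "emb p 1 (-1) theta = inverse theta" "emb p (-1) 1 theta = inverse theta"
  "emb p (-1) (-1) theta = theta"
  unfolding inverse_theta unfolding theta_def
  by (simp_all add: embL_hom emb_sqrt5 emb_sp)

lemma emb_eta:
  "emb p 1 1 eta = eta" "emb p 1 (-1) eta = inverse eta" "emb p (-1) 1 eta = eta"
  "emb p (-1) (-1) eta = inverse eta"
  unfolding inverse_eta unfolding eta_def
  by (simp_all add: embL_hom emb_sp)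

lemma inverse_Lam [simp]: "inverse theta \<in> Lam" "inverse eta \<in> Lam" "inverse phi \<in> Lam"
  by (simp_all add: inverse_theta inverse_eta inverse_phi(1))

text \<open>sqrt 5 Y and X are the sum and the difference of phi^m and phi^-m. This relation enters
  \<open>B_decomp1\<close> and \<open>B_top_assoc\<close>.\<close>

lemma theta_eta: "sqrt 5 * eta = theta + 2 * inverse (phi ^ m)"
proof -
  have "sqrt 5 * eta = of_int Y * sqrt 5 + sqrt 5 * sp" by (simp add: eta_def algebra_simps)
  thus ?thesis unfolding theta_def Y_phi X_phi by simp
qed

lemma eta_le_theta: "eta \<le> theta"
proof -
  have "Y ^ 2 \<le> X ^ 2" using X_sq p_eq p_ge by simp
  hence "Y \<le> X" by (rule power2_le_imp_le) (use X_ge in simp)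
  moreover have "1 * sp \<le> sqrt 5 * sp" using sp_pos sqrt5_bounds by (intro mult_right_mono) auto
  ultimately show ?thesis by (simp add: eta_def theta_def)
qed

text \<open>\<open>theta\<close> is close to 2X, hence to 2 phi^m, and phi < 2. The bound fixes the
  range of exponents in \<open>trace_functional\<close>, and thereby the range of t.\<close>

lemma theta_gt_phi: "theta > phi ^ (m + 1)"
proof -
  have "theta + inverse theta = 2 * (phi ^ m - inverse (phi ^ m))"
    unfolding inverse_theta unfolding theta_def X_phi by simp
  moreover have "inverse theta < 1 / 4" using theta_gt by (simp add: field_simps)
  moreover have "phi * phi ^ m < 16185 / 10000 * phi ^ m"
    using phi_bounds by (intro mult_strict_right_mono) auto
  ultimately have "theta > phi * phi ^ m" using phi_m_gt inverse_phi_m_lt unfolding right_diff_distrib by linarith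
  thus ?thesis by simp
qed

lemma OKplus_iff:
  "x \<in> OKplus p \<longleftrightarrow> x \<in> Lam \<and> x > 0 \<and> emb p 1 (-1) x > 0 \<and> emb p (-1) 1 x > 0 \<and> emb p (-1) (-1) x > 0"
  unfolding OKplus_def OK_eq_Lam by (auto simp: emb_1_1[OF Lam_K])

lemma OKplus_Lam: "x \<in> OKplus p \<Longrightarrow> x \<in> Lam" and OKplus_pos: "x \<in> OKplus p \<Longrightarrow> x > 0"
  by (simp_all add: OKplus_iff)

lemma OKplus_mult: "x \<in> OKplus p \<Longrightarrow> y \<in> OKplus p \<Longrightarrow> x * y \<in> OKplus p"
  by (auto simp: OKplus_iff embL_hom)

lemma OKplus_emb: "x \<in> OKplus p \<Longrightarrow> s \<in> {-1, 1} \<Longrightarrow> t \<in> {-1, 1} \<Longrightarrow> emb p s t x \<in> OKplus p"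
proof -
  assume h: "x \<in> OKplus p" "s \<in> {-1, 1}" "t \<in> {-1, 1}"
  have st: "s \<in> \<rat>" "t \<in> \<rat>" using h by auto
  have "emb p s t x \<in> Lam" using h by (intro emb_Lam) (auto simp: OKplus_Lam)
  moreover have "emb p s' t' (emb p s t x) > 0" if "s' \<in> {-1, 1}" "t' \<in> {-1, 1}" for s' t'
  proof -
    have "emb p s' t' (emb p s t x) = emb p (s' * s) (t' * t) x"
      using st OKplus_Lam[OF h(1)] by (intro emb_emb Lam_K)
    moreover have "s' * s \<in> {-1, 1}" "t' * t \<in> {-1, 1}" using h that by auto
    ultimately show ?thesis using h(1) by (auto simp: OKplus_def)
  qed
  ultimately show ?thesis unfolding OKplus_def OK_eq_Lam by blast
qed

lemma emb_inverse:
  assumes "x \<in> Lam" "inverse x \<in> Lam" "x \<noteq> 0" "s \<in> {-1, 1}" "t \<in> {-1, 1}"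
  shows "emb p s t (inverse x) = inverse (emb p s t x)"
proof -
  have "emb p s t x * emb p s t (inverse x) = emb p s t (x * inverse x)"
    using assms by (simp only: embL_hom)
  also have "\<dots> = 1" using assms by simp
  finally show ?thesis by (rule inverse_unique[symmetric])
qed

lemma totpos_unit_iff: "totpos_unit p x \<longleftrightarrow> x \<in> OKplus p \<and> inverse x \<in> Lam"
proof
  assume "totpos_unit p x"
  then obtain y where y: "x \<in> OKplus p" "y \<in> Lam" "x * y = 1"
    by (auto simp: totpos_unit_def OK_eq_Lam)
  from y(3) have "inverse x = y" by (rule inverse_unique)
  with y show "x \<in> OKplus p \<and> inverse x \<in> Lam" by simp
next
  assume h: "x \<in> OKplus p \<and> inverse x \<in> Lam"
  hence "x * inverse x = 1" using OKplus_pos[of x] by simp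
  with h show "totpos_unit p x" by (auto simp: totpos_unit_def OK_eq_Lam)
qed

lemma tpu_inverse: "totpos_unit p x \<Longrightarrow> totpos_unit p (inverse x)"
  unfolding totpos_unit_iff by (auto simp: OKplus_iff emb_inverse)

lemma tpu_mult: "totpos_unit p x \<Longrightarrow> totpos_unit p y \<Longrightarrow> totpos_unit p (x * y)"
  unfolding totpos_unit_iff by (auto intro: OKplus_mult)

lemma tpu_1: "totpos_unit p 1"
  by (simp add: totpos_unit_iff OKplus_iff)

lemma tpu_power: "totpos_unit p x \<Longrightarrow> totpos_unit p (x ^ k)"
  by (induction k) (simp_all add: tpu_1 tpu_mult)

lemma tpu_powi: "totpos_unit p x \<Longrightarrow> totpos_unit p (x powi k)"
  by (simp add: power_int_def tpu_power tpu_inverse)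

lemma tpu_theta: "totpos_unit p theta" and tpu_eta: "totpos_unit p eta"
  by (simp_all add: totpos_unit_iff OKplus_iff emb_theta emb_eta)

lemma tpu_phi: "totpos_unit p (phi powi (2 * k))"
proof -
  have "psi * psi > 0" using phi_rel(2) psi_eq phi_bounds by linarith
  hence "totpos_unit p (phi ^ 2)"
    by (simp add: totpos_unit_iff OKplus_iff power2_eq_square embL_hom emb_phi)
  hence "totpos_unit p ((phi ^ 2) powi k)" by (rule tpu_powi)
  thus ?thesis by (simp add: power_int_power)
qed

lemma tpu_OKplus: "totpos_unit p x \<Longrightarrow> x \<in> OKplus p"
  by (simp add: totpos_unit_iff)

lemma emb_phi_powi:
  "s \<in> {-1, 1} \<Longrightarrow> t \<in> {-1, 1} \<Longrightarrow> emb p s t (phi powi k) = (if s = 1 then phi powi k else psi powi k)"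
proof -
  assume st: "s \<in> {-1, 1}" "t \<in> {-1, 1}"
  have pw: "emb p s t (x ^ j) = emb p s t x ^ j" if "x \<in> Lam" for x j
    using emb_power[OF Lam_K[OF that] st] by simp
  have "emb p s t (phi powi k) = emb p s t phi powi k"
    using st by (simp add: power_int_def pw emb_inverse)
  thus ?thesis using st by (auto simp: emb_phi)
qed

lemma tau_phi_even: "emb p (-1) 1 (phi powi (2 * k)) = phi powi (- (2 * k))"
  by (simp add: emb_phi_powi psi_powi)

lemma assoc_refl: "assoc_tp p x x"
  unfolding assoc_tp_def using tpu_1 by force

lemma assoc_sym: "assoc_tp p x y \<Longrightarrow> assoc_tp p y x"
  unfolding assoc_tp_def
proof (elim exE conjE)
  fix e assume e: "totpos_unit p e" "y = e * x"
  have "e > 0" using e(1) by (simp add: totpos_unit_iff OKplus_iff)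
  hence "x = inverse e * y" using e(2) by simp
  with tpu_inverse[OF e(1)] show "\<exists>e. totpos_unit p e \<and> x = e * y" by blast
qed

lemma assoc_trans: "assoc_tp p x y \<Longrightarrow> assoc_tp p y z \<Longrightarrow> assoc_tp p x z"
  unfolding assoc_tp_def by (metis mult.assoc tpu_mult)

lemma assoc_I: "totpos_unit p e \<Longrightarrow> assoc_tp p x (e * x)"
  unfolding assoc_tp_def by blast

lemma indec_unit_mult:
  assumes "indecomposable p x" "totpos_unit p e"
  shows "indecomposable p (e * x)"
proof -
  have e: "e > 0" "inverse e \<in> OKplus p" "e \<in> OKplus p"
    using assms(2) tpu_inverse[OF assms(2)] by (auto simp: totpos_unit_iff OKplus_pos)
  have False if "y \<in> OKplus p" "z \<in> OKplus p" "e * x = y + z" for y z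
  proof -
    have "x = inverse e * (e * x)" using e by simp
    also have "\<dots> = inverse e * y + inverse e * z" unfolding that(3) by (simp add: algebra_simps)
    finally show False using assms(1) OKplus_mult[OF e(2) that(1)] OKplus_mult[OF e(2) that(2)]
      by (auto simp: indecomposable_def)
  qed
  moreover have "e * x \<in> OKplus p" using assms(1) e by (auto simp: indecomposable_def intro: OKplus_mult)
  ultimately show ?thesis unfolding indecomposable_def by blast
qed

lemma indec_assoc: "indecomposable p x \<Longrightarrow> assoc_tp p x y \<Longrightarrow> indecomposable p y"
  unfolding assoc_tp_def using indec_unit_mult by blast

lemma indec_emb:
  assumes "indecomposable p x" "s \<in> {-1, 1}" "t \<in> {-1, 1}"
  shows "indecomposable p (emb p s t x)"
proof -
  have xp: "x \<in> OKplus p" using assms by (simp add: indecomposable_def)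
  have st: "s \<in> \<rat>" "t \<in> \<rat>" "s * s = 1" "t * t = 1" using assms by auto
  have xx: "emb p s t (emb p s t x) = x"
    using emb_emb[OF Lam_K[OF OKplus_Lam[OF xp]] st(1,2)] emb_1_1[OF Lam_K[OF OKplus_Lam[OF xp]]] st by simp
  have False if "y \<in> OKplus p" "z \<in> OKplus p" "emb p s t x = y + z" for y z
  proof -
    have "x = emb p s t y + emb p s t z"
      using xx that embL_hom(1)[OF OKplus_Lam[OF that(1)] OKplus_Lam[OF that(2)] assms(2,3)] by simp
    with assms OKplus_emb[OF that(1) assms(2,3)] OKplus_emb[OF that(2) assms(2,3)] show False
      by (auto simp: indecomposable_def)
  qed
  with OKplus_emb[OF xp assms(2,3)] show ?thesis unfolding indecomposable_def by blast
qed

section \<open>The description of the ring of integers by \<open>theta\<close> and congruences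
  modulo sqrt 5\<close>

definition sqrt5_ideal :: "real set" where "sqrt5_ideal = {x. x / sqrt 5 \<in> Zphi}"

definition bl :: "real \<Rightarrow> real \<Rightarrow> real" where
  "bl x y = phi / sqrt 5 * (x + y * theta)"

text \<open>With X = 5k - 1 the quotient (x + y theta) / sqrt 5 equals (x - y) / sqrt 5 + sqrt 5 k y
  + y sqrt p.\<close>

lemma bl_Lam:
  assumes "x \<in> Zphi" "y \<in> Zphi" "x - y \<in> sqrt5_ideal"
  shows "bl x y \<in> Lam"
proof -
  obtain k where k: "X + 1 = 5 * k" using X_mod5 by (auto elim: dvdE)
  have X': "real_of_int X = 5 * of_int k - 1" using k by (metis add_diff_cancel_right' of_int_1 of_int_diff of_int_mult of_int_numeral)
  have s5: "5 / sqrt 5 = sqrt 5" by (simp add: real_div_sqrt)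
  have "bl x y = phi * ((x - y) / sqrt 5 + y * of_int k * (5 / sqrt 5)) + phi * y * sp"
    unfolding bl_def theta_def X' by (simp add: field_simps)
  also have "\<dots> \<in> Lam" unfolding s5 using assms by (intro Lam_I) (auto simp: sqrt5_ideal_def)
  finally show ?thesis .
qed

text \<open>Solves the formula in the proof of \<open>bl_Lam\<close> for x and y. No denominators
  arise because \<open>phi\<close> is a unit.\<close>

lemma Lam_bl:
  assumes "z \<in> Lam"
  obtains x y where "x \<in> Zphi" "y \<in> Zphi" "x - y \<in> sqrt5_ideal" "z = bl x y"
proof -
  from assms obtain A B where AB: "A \<in> Zphi" "B \<in> Zphi" "z = A + B * sp" by (rule Lam_cases)
  obtain k where k: "X + 1 = 5 * k" using X_mod5 by (auto elim: dvdE)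
  have X': "real_of_int X = 5 * of_int k - 1" using k by (metis add_diff_cancel_right' of_int_1 of_int_diff of_int_mult of_int_numeral)
  define y where "y = inverse phi * B"
  define x where "x = y + sqrt 5 * (inverse phi * A - sqrt 5 * of_int k * y)"
  have iz: "inverse phi \<in> Zphi" by (simp add: inverse_phi(1))
  show ?thesis
  proof (rule that[of x y])
    show yz: "y \<in> Zphi" unfolding y_def using AB iz by simp
    show "x \<in> Zphi" unfolding x_def using AB iz yz by simp
    show "x - y \<in> sqrt5_ideal" unfolding x_def sqrt5_ideal_def using AB iz yz by simp
    have "x + y * theta = sqrt 5 * (inverse phi * A) + sqrt 5 * y * sp"
      unfolding x_def theta_def X' by (simp add: algebra_simps)
    also have "\<dots> = sqrt 5 / phi * z" unfolding AB(3) y_def by (simp add: field_simps)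
    finally show "z = bl x y" unfolding bl_def by simp
  qed
qed

lemma emb_bl:
  assumes "x \<in> Zphi" "y \<in> Zphi"
  shows "emb p 1 (-1) (bl x y) = phi / sqrt 5 * (x + y * inverse theta)"
    and "emb p (-1) 1 (bl x y) = inverse phi / sqrt 5 * (emb p (-1) 1 x + emb p (-1) 1 y * inverse theta)"
    and "emb p (-1) (-1) (bl x y) = inverse phi / sqrt 5 * (emb p (-1) 1 x + emb p (-1) 1 y * theta)"
proof -
  \<comment> \<open>Without the congruence \<open>bl x y\<close> need not lie in \<open>Lam\<close>.
    The rational factor 1/5 is split off so that the rest does.\<close>
  have bl: "bl x y = (1 / 5) * (sqrt 5 * (phi * (x + y * theta)))"
    by (simp add: bl_def field_simps)
  have s5: "s * sqrt 5 * z / 5 = s * z / sqrt 5" for s z by (simp add: field_simps)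
  have L: "sqrt 5 * (phi * (x + y * theta)) \<in> Lam" using assms by simp
  have e: "emb p s t (bl x y)
      = s / sqrt 5 * (emb p s t phi * (emb p s t x + emb p s t y * emb p s t theta))"
    if "s \<in> {-1, 1}" "t \<in> {-1, 1}" for s t
    using that emb_mult[OF K_rat Lam_K[OF L] that, of "1/5"] assms unfolding bl s5
    by (simp add: emb_rat embL_hom emb_sqrt5 s5)
  show "emb p 1 (-1) (bl x y) = phi / sqrt 5 * (x + y * inverse theta)"
    using assms by (subst e) (simp_all add: emb_phi emb_theta emb_Zphi_s1 field_simps)
  have psi: "psi = - inverse phi" by (simp add: inverse_phi(2))
  show "emb p (-1) 1 (bl x y) = inverse phi / sqrt 5 * (emb p (-1) 1 x + emb p (-1) 1 y * inverse theta)"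
    using assms by (subst e) (simp_all add: emb_phi emb_theta psi field_simps)
  show "emb p (-1) (-1) (bl x y) = inverse phi / sqrt 5 * (emb p (-1) 1 x + emb p (-1) 1 y * theta)"
    using assms by (subst e) (simp_all add: emb_phi emb_theta psi sta_Zphi field_simps)
qed

subsection \<open>Reduction modulo units\<close>

lemma emb_unit_powi:
  assumes "x \<in> Lam" "inverse x \<in> Lam" "x \<noteq> 0" "s \<in> {-1, 1}" "t \<in> {-1, 1}"
  shows "emb p s t (x powi k) = emb p s t x powi k"
proof -
  have pw: "emb p s t (z ^ j) = emb p s t z ^ j" if "z \<in> Lam" for z j
    using emb_power[OF Lam_K[OF that] assms(4,5)] by simp
  show ?thesis using assms by (simp add: power_int_def pw emb_inverse)
qed

lemma powi_Lam: "x \<in> Lam \<Longrightarrow> inverse x \<in> Lam \<Longrightarrow> x powi k \<in> Lam"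
  by (simp add: power_int_def)

lemma emb_theta_mult:
  assumes "z \<in> Lam"
  shows "emb p 1 (-1) (theta powi k * z) = theta powi (-k) * emb p 1 (-1) z"
    "emb p (-1) 1 (theta powi k * z) = theta powi (-k) * emb p (-1) 1 z"
    "emb p (-1) (-1) (theta powi k * z) = theta powi k * emb p (-1) (-1) z"
  using assms by (simp_all add: embL_hom powi_Lam emb_unit_powi emb_theta power_int_inverse power_int_minus)

lemma emb_eta_mult:
  assumes "z \<in> Lam"
  shows "emb p 1 (-1) (eta powi k * z) = eta powi (-k) * emb p 1 (-1) z"
    "emb p (-1) 1 (eta powi k * z) = eta powi k * emb p (-1) 1 z"
    "emb p (-1) (-1) (eta powi k * z) = eta powi (-k) * emb p (-1) (-1) z"
  using assms by (simp_all add: embL_hom powi_Lam emb_unit_powi emb_eta power_int_inverse power_int_minus)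

text \<open>Quotients of conjugates that differ in the sign of sqrt p, one for each embedding of
  Q(sqrt 5). Factors from Q(sqrt 5), in particular powers of \<open>phi\<close>, cancel in
  them.\<close>

definition R1 :: "real \<Rightarrow> real" where "R1 z = z / emb p 1 (-1) z"
definition R2 :: "real \<Rightarrow> real" where "R2 z = emb p (-1) 1 z / emb p (-1) (-1) z"

lemma R_theta:
  assumes "z \<in> Lam"
  shows "R1 (theta powi k * z) = theta powi (2 * k) * R1 z" "R2 (theta powi k * z) = theta powi (2 * (-k)) * R2 z"
  using assms unfolding R1_def R2_def
  by (simp_all only: emb_theta_mult mult_2 power_int_add[OF disjI1[OF theta_pos(2)]])
    (simp_all add: power_int_minus field_simps)

lemma R_eta:
  assumes "z \<in> Lam"
  shows "R1 (eta powi k * z) = eta powi (2 * k) * R1 z" "R2 (eta powi k * z) = eta powi (2 * k) * R2 z"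
  using assms unfolding R1_def R2_def
  by (simp_all only: emb_eta_mult mult_2 power_int_add[OF disjI1[OF eta_pos(2)]])
    (simp_all add: power_int_minus field_simps)

lemma R_pos: "z \<in> OKplus p \<Longrightarrow> R1 z > 0" "z \<in> OKplus p \<Longrightarrow> R2 z > 0"
  by (auto simp: R1_def R2_def OKplus_iff)

definition Q1 :: "real \<Rightarrow> bool" where
  "Q1 z \<longleftrightarrow> 1 \<le> R1 z \<and> R1 z \<le> theta ^ 2 \<and> inverse (theta ^ 2) \<le> R2 z \<and> R2 z \<le> 1"
definition Q2 :: "real \<Rightarrow> bool" where
  "Q2 z \<longleftrightarrow> 1 \<le> R1 z \<and> R1 z \<le> eta ^ 2 \<and> 1 \<le> R2 z \<and> R2 z \<le> eta ^ 2"

text \<open>In the coordinates \<open>(ln R1, ln R2) / 2\<close> the units \<open>theta\<close> and \<open>eta\<close> act as the translations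
  \<open>(L, -L)\<close> and \<open>(L', L')\<close>, and \<open>Q1\<close>, \<open>Q2\<close> are the squares \<open>[0, L] \<times> [-L, 0]\<close> and \<open>[0, L'] \<times> [0, L']\<close>;
  as \<open>L' \<le> L\<close>, their translates cover the plane.\<close>
lemma unit_reduction:
  assumes "z \<in> OKplus p"
  shows "\<exists>u. totpos_unit p u \<and> (Q1 (u * z) \<or> Q2 (u * z))"
proof -
  have e4: "1 < eta ^ 4" and t2: "1 < theta ^ 2" by (simp_all add: one_less_power)
  \<comment> \<open>\<open>eta\<close> multiplies R1 R2 by eta^4 and \<open>theta\<close> leaves it
    fixed. So \<open>eta\<close> normalises the product, and \<open>theta\<close> afterwards R1
    alone.\<close>
  obtain j where j: "(eta ^ 4) powi j \<le> R1 z * R2 z" "R1 z * R2 z < (eta ^ 4) powi (j + 1)"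
    using powi_bracket[OF e4] R_pos[OF assms] by (meson mult_pos_pos)
  define z1 where "z1 = eta powi (-j) * z"
  have z1p: "z1 \<in> OKplus p" unfolding z1_def
    by (intro OKplus_mult tpu_OKplus tpu_powi tpu_eta assms)
  have "R1 z1 * R2 z1 = eta powi (2 * (-j)) * eta powi (2 * (-j)) * (R1 z * R2 z)"
    unfolding z1_def R_eta[OF OKplus_Lam[OF assms]] by simp
  also have "eta powi (2 * (-j)) * eta powi (2 * (-j)) = inverse ((eta ^ 4) powi j)"
    by (simp add: power_int_add[symmetric] power_int_minus[symmetric] power_int_power)
  finally have D1: "R1 z1 * R2 z1 = R1 z * R2 z / (eta ^ 4) powi j" by (simp add: field_simps)
  have p4: "(eta ^ 4) powi j > 0" by simp
  have D: "1 \<le> R1 z1 * R2 z1" "R1 z1 * R2 z1 < eta ^ 4"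
    unfolding D1 using j p4 by (simp_all add: field_simps power_int_add)
  obtain i where i: "(theta ^ 2) powi i \<le> R1 z1" "R1 z1 < (theta ^ 2) powi (i + 1)"
    using powi_bracket[OF t2] R_pos[OF z1p] by blast
  define z2 where "z2 = theta powi (-i) * z1"
  have z2p: "z2 \<in> OKplus p" unfolding z2_def
    by (intro OKplus_mult tpu_OKplus tpu_powi tpu_theta z1p)
  have Rz2: "R1 z2 = theta powi (2 * (-i)) * R1 z1" "R2 z2 = theta powi (2 * i) * R2 z1"
    unfolding z2_def R_theta[OF OKplus_Lam[OF z1p]] by simp_all
  have D2: "1 \<le> R1 z2 * R2 z2" "R1 z2 * R2 z2 < eta ^ 4"
  proof -
    have "R1 z2 * R2 z2 = (theta powi (2 * (-i)) * theta powi (2 * i)) * (R1 z1 * R2 z1)"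
      unfolding Rz2 by simp
    also have "theta powi (2 * (-i)) * theta powi (2 * i) = 1" by (simp add: power_int_add[symmetric])
    finally show "1 \<le> R1 z2 * R2 z2" "R1 z2 * R2 z2 < eta ^ 4" using D by simp_all
  qed
  have ti: "(theta ^ 2) powi i > 0" by simp
  have "theta powi (2 * (-i)) = inverse ((theta ^ 2) powi i)"
    by (simp add: power_int_power power_int_minus)
  hence R1z2: "R1 z2 = R1 z1 / (theta ^ 2) powi i" unfolding Rz2 by (simp add: field_simps)
  have R1b: "1 \<le> R1 z2" "R1 z2 < theta ^ 2"
    unfolding R1z2 using i ti by (simp_all add: field_simps power_int_add)
  have R2p: "R2 z2 > 0" by (rule R_pos[OF z2p])
  have et: "eta ^ 2 \<le> theta ^ 2" using eta_le_theta by (intro power_mono) (auto simp: less_imp_le)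
  have e2: "eta ^ 2 > 1" by (simp add: one_less_power)
  have ee: "eta ^ 4 = eta ^ 2 * eta ^ 2" by (simp add: power_add[symmetric])
  have u2: "totpos_unit p (theta powi (-i) * eta powi (-j))"
    by (intro tpu_mult tpu_powi tpu_theta tpu_eta)
  have z2z: "(theta powi (-i) * eta powi (-j)) * z = z2" by (simp add: z2_def z1_def)
  have red: ?thesis if "totpos_unit p v" "Q1 (v * z2) \<or> Q2 (v * z2)" for v
  proof (intro exI conjI)
    show "totpos_unit p (v * (theta powi (-i) * eta powi (-j)))" by (intro tpu_mult that u2)
    have eq: "v * (theta powi (-i) * eta powi (-j)) * z = v * z2" unfolding z2z[symmetric] by simp
    show "Q1 (v * (theta powi (-i) * eta powi (-j)) * z) \<or> Q2 (v * (theta powi (-i) * eta powi (-j)) * z)"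
      unfolding eq by (rule that(2))
  qed
  \<comment> \<open>In the logarithmic coordinates (u, v) now 0 <= u < L and 0 <= u + v < 2 L'. The
    first case lies in \<open>Q1\<close> and the third in \<open>Q2\<close>. The second is moved
    into \<open>Q1\<close> by the translation by (-L', -L'), the fourth by (L - L', -L - L'), that
    is, by theta / eta. The two moves rely on L' <= L.\<close>
  consider "R2 z2 \<le> 1" | "R2 z2 > 1" "R1 z2 > eta ^ 2" | "R2 z2 > 1" "R1 z2 \<le> eta ^ 2" "R2 z2 \<le> eta ^ 2"
    | "R1 z2 \<le> eta ^ 2" "R2 z2 > eta ^ 2" by linarith
  thus ?thesis
  proof cases
    case 1
    have "inverse (theta ^ 2) \<le> R2 z2"
    proof -
      have "1 \<le> theta ^ 2 * R2 z2"
        using D2(1) mult_right_mono[OF less_imp_le[OF R1b(2)] less_imp_le[OF R2p]] by linarith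
      thus ?thesis by (simp add: field_simps)
    qed
    with 1 R1b have "Q1 (1 * z2)" by (simp add: Q1_def)
    thus ?thesis using red[OF tpu_1] by blast
  next
    case 3
    with R1b have "Q2 (1 * z2)" by (simp add: Q2_def)
    thus ?thesis using red[OF tpu_1] by blast
  next
    case 2
    let ?v = "eta powi (-1)"
    have R: "R1 (?v * z2) = R1 z2 / eta ^ 2" "R2 (?v * z2) = R2 z2 / eta ^ 2"
      unfolding R_eta[OF OKplus_Lam[OF z2p]] by (simp_all add: power_int_minus field_simps)
    have "R2 z2 * eta ^ 2 < eta ^ 2 * eta ^ 2"
      using D2(2) mult_strict_right_mono[OF 2(2) R2p] unfolding ee by (simp add: mult.commute)
    hence "R2 z2 < eta ^ 2" by (rule mult_right_less_imp_less) (use e2 in simp)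
    moreover have "R1 z2 / eta ^ 2 \<le> theta ^ 2"
    proof -
      have "R1 z2 \<le> theta ^ 2 * 1" using R1b by simp
      also have "\<dots> \<le> theta ^ 2 * eta ^ 2" by (rule mult_left_mono) (use e2 in linarith, simp)
      finally show ?thesis using e2 by (simp add: field_simps)
    qed
    moreover have "inverse (theta ^ 2) \<le> R2 z2 / eta ^ 2"
    proof -
      have "eta ^ 2 * 1 \<le> theta ^ 2 * R2 z2" using et 2 by (intro mult_mono) auto
      thus ?thesis by (simp add: field_simps)
    qed
    ultimately have "Q1 (?v * z2)" unfolding Q1_def R using 2 e2 by simp
    thus ?thesis using red[of ?v] tpu_powi[OF tpu_eta] by blast
  next
    case 4
    let ?v = "theta powi 1 * eta powi (-1)"
    have R: "R1 (?v * z2) = R1 z2 * theta ^ 2 / eta ^ 2" "R2 (?v * z2) = R2 z2 / (theta ^ 2 * eta ^ 2)"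
    proof -
      have "eta powi (-1) * z2 \<in> Lam" by (intro Lam_mult powi_Lam OKplus_Lam[OF z2p]) auto
      note RR = R_theta[OF this, of 1] R_eta[OF OKplus_Lam[OF z2p], of "-1"]
      show "R1 (?v * z2) = R1 z2 * theta ^ 2 / eta ^ 2" "R2 (?v * z2) = R2 z2 / (theta ^ 2 * eta ^ 2)"
        unfolding mult.assoc RR by (simp_all add: power_int_minus field_simps)
    qed
    have "R2 z2 < eta ^ 4"
      using D2(2) mult_right_mono[OF R1b(1) less_imp_le[OF R2p]] by simp
    hence "R2 z2 \<le> theta ^ 2 * eta ^ 2" unfolding ee
      using mult_right_mono[OF et, of "eta ^ 2"] by simp
    moreover have "R1 z2 * theta ^ 2 \<le> eta ^ 2 * theta ^ 2" using 4 by (intro mult_right_mono) auto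
    moreover have "1 * eta ^ 2 \<le> R1 z2 * theta ^ 2" using R1b et by (intro mult_mono) auto
    ultimately have "Q1 (?v * z2)" unfolding Q1_def R using 4 e2 by (simp add: field_simps)
    thus ?thesis using red[of ?v] tpu_mult[OF tpu_powi[OF tpu_theta] tpu_powi[OF tpu_eta]] by blast
  qed
qed

section \<open>Totally nonnegative elements of Z[phi]\<close>

lemma tau_eq_0:
  assumes "x \<in> Zphi" "emb p (-1) 1 x = 0" shows "x = 0"
proof -
  have "x = emb p (-1) 1 (emb p (-1) 1 x)"
    using emb_emb[OF Zphi_K[OF assms(1)], of "-1" 1 "-1" 1] emb_1_1[OF Zphi_K[OF assms(1)]] by simp
  thus ?thesis by (simp add: assms(2))
qed

lemma Zphi_OKplus: "x \<in> Zphi \<Longrightarrow> x > 0 \<Longrightarrow> emb p (-1) 1 x > 0 \<Longrightarrow> x \<in> OKplus p"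
  by (simp add: OKplus_iff sta_Zphi emb_Zphi_s1)

definition totally_nonneg :: "real \<Rightarrow> bool" where
  "totally_nonneg x \<longleftrightarrow> x \<in> Zphi \<and> x \<ge> 0 \<and> emb p (-1) 1 x \<ge> 0"

lemma totally_nonneg_pos: "totally_nonneg x \<Longrightarrow> x \<noteq> 0 \<Longrightarrow> x > 0 \<and> emb p (-1) 1 x > 0"
  unfolding totally_nonneg_def using tau_eq_0[of x] by force

lemma bl_OKplus:
  assumes "totally_nonneg x" "totally_nonneg y" "x \<noteq> 0 \<or> y \<noteq> 0" "x - y \<in> sqrt5_ideal"
  shows "bl x y \<in> OKplus p"
proof -
  have z: "x \<in> Zphi" "y \<in> Zphi" using assms by (auto simp: totally_nonneg_def)
  have pos: "x + y * c > 0 \<and> emb p (-1) 1 x + emb p (-1) 1 y * c > 0" if "c > 0" for c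
  proof (cases "x = 0")
    case True
    hence "y > 0 \<and> emb p (-1) 1 y > 0" using assms totally_nonneg_pos by blast
    thus ?thesis using True that by simp
  next
    case False
    hence "x > 0 \<and> emb p (-1) 1 x > 0" using assms totally_nonneg_pos by blast
    thus ?thesis using assms(2) that by (simp add: totally_nonneg_def add_pos_nonneg)
  qed
  show ?thesis unfolding OKplus_iff emb_bl[OF z]
    using bl_Lam[OF z assms(4)] pos[of theta] pos[of "inverse theta"]
    unfolding bl_def by simp
qed

lemma phi_sq_diff: "phi ^ 2 - psi ^ 2 = sqrt 5"
  using phi_rel by (simp add: power2_eq_square)

text \<open>The quadrant is covered by the cones spanned by phi^(2i) and phi^(2i+2). Multiplication
  by phi^2 changes the quotient of the conjugates by phi^4, so some power moves x into the cone of 1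
  and phi^2. These form a basis of Z[phi], which makes the coefficients integers; they are found by
  Cramer's rule with determinant phi^2 - psi^2 = sqrt 5.\<close>

lemma tp_decomp:
  assumes "x \<in> Zphi" "x > 0" "emb p (-1) 1 x > 0"
  shows "\<exists>(i::int) (c::nat) (d::nat). x = phi powi (2 * i) * (of_nat c + of_nat d * phi ^ 2) \<and> (c > 0 \<or> d > 0)"
proof -
  have p4: "1 < phi ^ 4" by (simp add: one_less_power)
  obtain i where i: "(phi ^ 4) powi i \<le> x / emb p (-1) 1 x" "x / emb p (-1) 1 x < (phi ^ 4) powi (i + 1)"
    using powi_bracket[OF p4] assms by (meson divide_pos_pos)
  define z where "z = phi powi (2 * (-i)) * x"
  have zZ: "z \<in> Zphi" unfolding z_def using assms by simp
  have tz: "emb p (-1) 1 z = phi powi (2 * i) * emb p (-1) 1 x"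
    unfolding z_def using assms by (subst embL_hom) (auto simp: tau_phi_even[of "-i", simplified])
  obtain a b where ab: "z = of_int a + of_int b * phi" using zZ by (rule Zphi_cases)
  have z2: "z = of_int (a - b) + of_int b * phi ^ 2" unfolding ab by (simp add: phi_power_small algebra_simps)
  have tz2: "emb p (-1) 1 z = of_int (a - b) + of_int b * psi ^ 2"
    unfolding ab by (subst emb_Zphi) (simp_all add: power2_eq_square phi_rel algebra_simps)
  have pp: "(phi ^ 4) powi i = phi powi (2 * i) * phi powi (2 * i)"
    by (simp add: power_int_power power_int_add[symmetric])
  have zt1: "emb p (-1) 1 z \<le> z"
  proof -
    have "phi powi (2 * i) * phi powi (2 * i) * emb p (-1) 1 x \<le> x"
      using i(1) assms(3) unfolding pp by (simp add: field_simps)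
    thus ?thesis unfolding tz unfolding z_def by (simp add: power_int_minus field_simps)
  qed
  have zt2: "z < phi ^ 4 * emb p (-1) 1 z"
  proof -
    have "x < phi ^ 4 * (phi powi (2 * i) * phi powi (2 * i)) * emb p (-1) 1 x"
      using i(2) assms(3) unfolding pp[symmetric] by (simp add: field_simps power_int_add)
    thus ?thesis unfolding tz unfolding z_def by (simp add: power_int_minus field_simps)
  qed
  have "of_int b * sqrt 5 = z - emb p (-1) 1 z"
    unfolding phi_sq_diff[symmetric] tz2 unfolding z2 by (simp add: algebra_simps)
  hence "of_int b * sqrt 5 \<ge> 0" using zt1 by simp
  hence b: "b \<ge> 0" by (simp add: zero_le_mult_iff)
  have pp1: "phi ^ 2 * psi ^ 2 = 1" by (simp add: power_mult_distrib[symmetric] phi_rel)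
  have "of_int (a - b) * sqrt 5 = phi ^ 2 * emb p (-1) 1 z - psi ^ 2 * z"
    unfolding phi_sq_diff[symmetric] tz2 unfolding z2 by (simp add: algebra_simps)
  moreover have "psi ^ 2 * z \<le> psi ^ 2 * (phi ^ 4 * emb p (-1) 1 z)" using zt2 by (intro mult_left_mono) auto
  moreover have "psi ^ 2 * (phi ^ 4 * emb p (-1) 1 z) = (phi ^ 2 * psi ^ 2) * (phi ^ 2 * emb p (-1) 1 z)"
    by (simp add: power4_eq_xxxx power2_eq_square)
  ultimately have "of_int (a - b) * sqrt 5 \<ge> 0" unfolding pp1 by simp
  hence a: "a - b \<ge> 0" by (simp add: zero_le_mult_iff)
  have xz: "x = phi powi (2 * i) * z" unfolding z_def by (simp add: power_int_minus)
  have "a - b > 0 \<or> b > 0"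
  proof (rule ccontr)
    assume "\<not> ?thesis"
    hence "a - b = 0" "b = 0" using a b by auto
    hence "x = 0" using xz z2 by simp
    thus False using assms by simp
  qed
  thus ?thesis using a b xz unfolding z2
    by (intro exI[of _ i] exI[of _ "nat (a - b)"] exI[of _ "nat b"]) auto
qed

lemma totally_nonneg_comb: "totally_nonneg (phi powi (2 * i) * (of_nat c + of_nat d * phi ^ 2))"
proof -
  have "of_nat c + of_nat d * phi ^ 2 = of_int (int c + int d) + of_int (int d) * phi"
    by (simp add: phi_power_small algebra_simps)
  hence "emb p (-1) 1 (of_nat c + of_nat d * phi ^ 2) = of_nat c + of_nat d * (psi + 1)"
    by (simp only: emb_Zphi sign_simps) (simp add: algebra_simps)
  moreover have "psi + 1 > 0" using phi_bounds by (simp add: psi_eq)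
  ultimately have "emb p (-1) 1 (of_nat c + of_nat d * phi ^ 2) \<ge> 0" by simp
  moreover have "emb p (-1) 1 (phi powi (2 * i) * (of_nat c + of_nat d * phi ^ 2))
      = phi powi (- (2 * i)) * emb p (-1) 1 (of_nat c + of_nat d * phi ^ 2)"
    by (subst embL_hom) (auto simp: tau_phi_even)
  ultimately show ?thesis unfolding totally_nonneg_def by (simp add: zero_le_mult_iff less_imp_le)
qed

lemma totally_nonneg_Zphi_OKplus: "totally_nonneg x \<Longrightarrow> x \<noteq> 0 \<Longrightarrow> x \<in> OKplus p"
  using totally_nonneg_pos Zphi_OKplus by (auto simp: totally_nonneg_def)

lemma indec_Zphi:
  assumes "indecomposable p x" "totally_nonneg x"
  shows "assoc_tp p 1 x"
proof -
  have xp: "x > 0" using assms(1) by (simp add: indecomposable_def OKplus_pos)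
  hence "x \<in> Zphi" "x > 0" "emb p (-1) 1 x > 0" using assms(2) totally_nonneg_pos[OF assms(2)] by (auto simp: totally_nonneg_def)
  from tp_decomp[OF this] obtain i and c d :: nat
    where x: "x = phi powi (2 * i) * (of_nat c + of_nat d * phi ^ 2)" and cd: "c > 0 \<or> d > 0" by blast
  have key: "x = phi powi (2 * j)" if "totally_nonneg (x - phi powi (2 * j))" for j
  proof (rule ccontr)
    assume "x \<noteq> phi powi (2 * j)"
    hence "x - phi powi (2 * j) \<in> OKplus p" using that by (intro totally_nonneg_Zphi_OKplus) auto
    moreover have "x = phi powi (2 * j) + (x - phi powi (2 * j))" by simp
    ultimately show False using assms(1) tpu_OKplus[OF tpu_phi] unfolding indecomposable_def by blast
  qed
  have "\<exists>j. totally_nonneg (x - phi powi (2 * j))"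
  proof (cases "c > 0")
    case True
    then obtain c' where "c = Suc c'" by (metis gr0_implies_Suc)
    hence "x - phi powi (2 * i) = phi powi (2 * i) * (of_nat c' + of_nat d * phi ^ 2)"
      unfolding x by (simp add: algebra_simps)
    thus ?thesis using totally_nonneg_comb by metis
  next
    case False
    then obtain d' where "d = Suc d'" using cd by (metis gr0_implies_Suc)
    hence "x - phi powi (2 * (i + 1)) = phi powi (2 * i) * (of_nat c + of_nat d' * phi ^ 2)"
      unfolding x by (simp add: algebra_simps power_int_add)
    thus ?thesis using totally_nonneg_comb by metis
  qed
  then obtain j where "x = phi powi (2 * j)" using key by blast
  thus ?thesis using assoc_I[OF tpu_phi, of 1 j] by simp
qed

subsection \<open>Classification of indecomposables\<close>

lemma sqrt5_ideal_sqrt5 [simp]: "z \<in> Zphi \<Longrightarrow> sqrt 5 * z \<in> sqrt5_ideal"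
  by (simp add: sqrt5_ideal_def)

lemma sqrt5_ideal_add: "x \<in> sqrt5_ideal \<Longrightarrow> y \<in> sqrt5_ideal \<Longrightarrow> x + y \<in> sqrt5_ideal"
  and sqrt5_ideal_diff: "x \<in> sqrt5_ideal \<Longrightarrow> y \<in> sqrt5_ideal \<Longrightarrow> x - y \<in> sqrt5_ideal"
  and sqrt5_ideal_mult: "x \<in> sqrt5_ideal \<Longrightarrow> z \<in> Zphi \<Longrightarrow> z * x \<in> sqrt5_ideal"
  and sqrt5_ideal_minus: "x \<in> sqrt5_ideal \<Longrightarrow> - x \<in> sqrt5_ideal"
proof -
  show "x + y \<in> sqrt5_ideal" "x - y \<in> sqrt5_ideal" if "x \<in> sqrt5_ideal" "y \<in> sqrt5_ideal"
    using that by (simp_all add: sqrt5_ideal_def add_divide_distrib diff_divide_distrib)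
  show "z * x \<in> sqrt5_ideal" if "x \<in> sqrt5_ideal" "z \<in> Zphi"
    using that Zphi_mult[of z "x / sqrt 5"] by (simp add: sqrt5_ideal_def)
  show "- x \<in> sqrt5_ideal" if "x \<in> sqrt5_ideal" using that Zphi_minus[of "x / sqrt 5"] by (simp add: sqrt5_ideal_def)
qed

lemma phi_powi_4_sqrt5_ideal: "phi powi (4 * j) - 1 \<in> sqrt5_ideal"
proof -
  have 1: "phi ^ 4 - 1 \<in> sqrt5_ideal"
  proof -
    have "phi ^ 4 - 1 = sqrt 5 * (phi + 1)"
      using phi_rel(1) unfolding phi_power_small sqrt5_eq by (simp add: algebra_simps)
    thus ?thesis by simp
  qed
  have nat: "phi ^ (4 * k) - 1 \<in> sqrt5_ideal" for k
  proof (induction k)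
    case (Suc k)
    have "phi ^ (4 * Suc k) - 1 = phi ^ 4 * (phi ^ (4 * k) - 1) + (phi ^ 4 - 1)"
      by (simp add: algebra_simps power_add)
    also have "\<dots> \<in> sqrt5_ideal" by (intro sqrt5_ideal_add sqrt5_ideal_mult Suc 1) simp
    finally show ?case .
  qed (simp add: sqrt5_ideal_def)
  show ?thesis
  proof (cases "j \<ge> 0")
    case True
    hence "phi powi (4 * j) = phi ^ (4 * nat j)" by (simp add: power_int_def nat_mult_distrib)
    thus ?thesis using nat by simp
  next
    case False
    define k where "k = nat (- j)"
    have j: "4 * j = - int (4 * k)" using False by (simp add: k_def)
    have "phi powi (4 * j) - 1 = - (phi powi (4 * j) * (phi ^ (4 * k) - 1))"
      unfolding j power_int_minus power_int_of_nat by (simp add: algebra_simps)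
    thus ?thesis using nat[of k] by (simp add: sqrt5_ideal_minus sqrt5_ideal_mult)
  qed
qed

lemma phi_powi_even_sqrt5_ideal:
  "even i \<Longrightarrow> phi powi (2 * i) - 1 \<in> sqrt5_ideal" "odd i \<Longrightarrow> phi powi (2 * i) + 1 \<in> sqrt5_ideal"
proof -
  show "phi powi (2 * i) - 1 \<in> sqrt5_ideal" if "even i"
    using that phi_powi_4_sqrt5_ideal by (auto elim!: evenE)
  show "phi powi (2 * i) + 1 \<in> sqrt5_ideal" if "odd i"
  proof -
    from that obtain j where j: "i = 2 * j + 1" by (rule oddE)
    have "phi powi (2 * i) + 1 = phi ^ 2 * (phi powi (4 * j) - 1) + (phi ^ 2 + 1)"
      unfolding j by (simp add: power_int_add algebra_simps)
    moreover have "phi ^ 2 + 1 = sqrt 5 * phi"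
      using phi_rel(1) unfolding phi_power_small sqrt5_eq by (simp add: algebra_simps)
    ultimately show ?thesis by (simp add: sqrt5_ideal_add sqrt5_ideal_mult phi_powi_4_sqrt5_ideal)
  qed
qed

lemma sqrt5_ideal_parity: "even i \<longleftrightarrow> even k \<Longrightarrow> phi powi (2 * i) - phi powi (2 * k) \<in> sqrt5_ideal"
proof (cases "even i")
  case True
  assume "even i \<longleftrightarrow> even k"
  with True have "(phi powi (2 * i) - 1) - (phi powi (2 * k) - 1) \<in> sqrt5_ideal"
    by (intro sqrt5_ideal_diff phi_powi_even_sqrt5_ideal) auto
  thus ?thesis by simp
next
  case False
  assume "even i \<longleftrightarrow> even k"
  with False have "(phi powi (2 * i) + 1) - (phi powi (2 * k) + 1) \<in> sqrt5_ideal"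
    by (intro sqrt5_ideal_diff phi_powi_even_sqrt5_ideal) auto
  thus ?thesis by simp
qed

lemma sqrt5_ideal_int: "of_int a \<in> sqrt5_ideal \<Longrightarrow> 5 dvd a"
proof -
  assume "of_int a \<in> sqrt5_ideal"
  then obtain b c where "of_int a / sqrt 5 = of_int b + of_int c * phi"
    by (auto simp: sqrt5_ideal_def elim: Zphi_cases)
  hence "of_int a = sqrt 5 * (of_int b + of_int c * phi)" by (simp add: field_simps)
  hence "of_int a = (of_int (-1) + of_int 2 * phi) * (of_int b + of_int c * phi)"
    unfolding sqrt5_eq by simp
  hence "of_int a + of_int 0 * phi = of_int (- b + 2 * c) + of_int (2 * b + c) * phi"
    unfolding phi_int_mult by simp
  from Zphi_unique[OF this] have "a = - b + 2 * c" "0 = 2 * b + c" by auto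
  hence "a = 5 * (- b)" by simp
  thus ?thesis by (rule dvdI)
qed

text \<open>From c = 3 on, 3 phi^(2i) = phi^(2i+2) + phi^(2i-2) makes it possible to split off an
  exponent of either parity. The multiples c = 1 and c = 2 remain as exceptions.\<close>

lemma pure_terms:
  assumes "x = of_nat c * phi powi (2 * i)" "c > 0"
  shows "(\<forall>b. \<exists>i. even i = b \<and> totally_nonneg (x - phi powi (2 * i))) \<or>
    (\<exists>i c. c \<in> {1, 2::nat} \<and> x = of_nat c * phi powi (2 * i))"
proof (cases "c \<le> 2")
  case True
  hence "c \<in> {1, 2}" using assms by auto
  thus ?thesis using assms by blast
next
  case False
  then obtain e where e: "c = e + 3" by (metis add.commute le_Suc_ex not_less_eq_eq numeral_2_eq_2 numeral_3_eq_3)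
  have "x - phi powi (2 * i) = phi powi (2 * i) * (of_nat (e + 2) + of_nat 0 * phi ^ 2)"
    unfolding assms e by (simp add: algebra_simps)
  hence t1: "totally_nonneg (x - phi powi (2 * i))" using totally_nonneg_comb by metis
  define w where "w = phi powi (2 * (i - 1))"
  have "2 * i = 2 * (i - 1) + 2" "2 * (i + 1) = 2 * (i - 1) + 4" by simp_all
  hence w: "phi powi (2 * i) = w * phi ^ 2" "phi powi (2 * (i + 1)) = w * phi ^ 4"
    unfolding w_def by (simp_all only: power_int_add phi_pos simp_thms power_int_numeral)
  have "x - phi powi (2 * (i + 1)) = w * (of_nat 1 + of_nat e * phi ^ 2)"
    unfolding assms w e phi_power_small by (simp add: algebra_simps)
  hence t2: "totally_nonneg (x - phi powi (2 * (i + 1)))" unfolding w_def using totally_nonneg_comb by metis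
  have "\<exists>k. even k = b \<and> totally_nonneg (x - phi powi (2 * k))" for b
  proof (cases "even i = b")
    case False
    hence "even (i + 1) = b" by simp
    thus ?thesis using t2 by blast
  qed (use t1 in blast)
  thus ?thesis by blast
qed

text \<open>If both coefficients of \<open>tp_decomp\<close> are positive, phi^(2i) and phi^(2i+2)
  already provide both parities; otherwise \<open>pure_terms\<close> applies.\<close>

lemma tp_terms:
  assumes "totally_nonneg x" "x \<noteq> 0"
  shows "(\<forall>b. \<exists>i. even i = b \<and> totally_nonneg (x - phi powi (2 * i))) \<or>
    (\<exists>i c. c \<in> {1, 2::nat} \<and> x = of_nat c * phi powi (2 * i))"
proof -
  have "x \<in> Zphi" "x > 0" "emb p (-1) 1 x > 0" using assms totally_nonneg_pos[OF assms] by (auto simp: totally_nonneg_def)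
  from tp_decomp[OF this] obtain i and c d :: nat
    where x: "x = phi powi (2 * i) * (of_nat c + of_nat d * phi ^ 2)" and cd: "c > 0 \<or> d > 0" by blast
  have i1: "phi powi (2 * (i + 1)) = phi powi (2 * i) * phi ^ 2"
    by (simp add: distrib_left power_int_add)
  consider "d = 0" | "c = 0" "d > 0" | c' d' where "c = Suc c'" "d = Suc d'"
    using cd by (metis gr0_implies_Suc neq0_conv)
  thus ?thesis
  proof cases
    case 1
    thus ?thesis using cd x by (intro pure_terms[of x c i]) (simp_all add: mult.commute)
  next
    case 2
    thus ?thesis using cd x by (intro pure_terms[of x d "i + 1"]) (simp_all only: i1, simp_all)
  next
    case 3
    have "x - phi powi (2 * i) = phi powi (2 * i) * (of_nat c' + of_nat d * phi ^ 2)"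
      unfolding x 3 by (simp add: algebra_simps)
    hence t1: "totally_nonneg (x - phi powi (2 * i))" using totally_nonneg_comb by metis
    have "x - phi powi (2 * (i + 1)) = phi powi (2 * i) * (of_nat c + of_nat d' * phi ^ 2)"
      unfolding x 3 i1 by (simp add: algebra_simps)
    hence t2: "totally_nonneg (x - phi powi (2 * (i + 1)))" using totally_nonneg_comb by metis
    have "\<exists>k. even k = b \<and> totally_nonneg (x - phi powi (2 * k))" for b
    proof (cases "even i = b")
      case False
      hence "even (i + 1) = b" by simp
      thus ?thesis using t2 by blast
    qed (use t1 in blast)
    thus ?thesis by blast
  qed
qed

text \<open>Only two exceptional elements could lack terms of equal parity. They are c or -c and d
  or -d modulo sqrt 5, the sign being that of the parity; unequal parities would make c + d
  divisible by 5, but it lies between 2 and 4.\<close>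

lemma common_terms:
  assumes x: "totally_nonneg x" "x \<noteq> 0" and y: "totally_nonneg y" "y \<noteq> 0" and xy: "x - y \<in> sqrt5_ideal"
  shows "\<exists>i k. (even i \<longleftrightarrow> even k) \<and> totally_nonneg (x - phi powi (2 * i)) \<and> totally_nonneg (y - phi powi (2 * k))"
proof -
  have pure: "totally_nonneg (of_nat c * phi powi (2 * i) - phi powi (2 * i))" if "c \<in> {1, 2::nat}" for c i
  proof -
    have "of_nat c * phi powi (2 * i) - phi powi (2 * i) = phi powi (2 * i) * (of_nat (c - 1) + of_nat 0 * phi ^ 2)"
      using that by (auto simp: algebra_simps)
    thus ?thesis using totally_nonneg_comb by metis
  qed
  have some: "\<exists>i. totally_nonneg (z - phi powi (2 * i))" if "totally_nonneg z" "z \<noteq> 0" for z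
    using tp_terms[OF that] pure by blast
  show ?thesis
  proof (cases "(\<forall>b. \<exists>i. even i = b \<and> totally_nonneg (x - phi powi (2 * i))) \<or> (\<forall>b. \<exists>i. even i = b \<and> totally_nonneg (y - phi powi (2 * i)))")
    case True
    thus ?thesis using some[OF x] some[OF y] by metis
  next
    case False
    then obtain i k and c d :: nat where cd: "c \<in> {1, 2}" "d \<in> {1, 2}"
      and xe: "x = of_nat c * phi powi (2 * i)" and ye: "y = of_nat d * phi powi (2 * k)"
      using tp_terms[OF x] tp_terms[OF y] by metis
    have "even i \<longleftrightarrow> even k"
    proof (rule ccontr)
      assume n: "\<not> (even i \<longleftrightarrow> even k)"
      have no: "\<not> of_int (int c + int d) \<in> sqrt5_ideal" "\<not> of_int (- (int c + int d)) \<in> sqrt5_ideal"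
        using sqrt5_ideal_int[of "int c + int d"] sqrt5_ideal_int[of "- (int c + int d)"] cd by auto
      show False
      proof (cases "even i")
        case True
        hence "(x - y) - of_nat c * (phi powi (2 * i) - 1) + of_nat d * (phi powi (2 * k) + 1) \<in> sqrt5_ideal"
          using n by (intro sqrt5_ideal_add sqrt5_ideal_diff sqrt5_ideal_mult phi_powi_even_sqrt5_ideal xy) auto
        also have "(x - y) - of_nat c * (phi powi (2 * i) - 1) + of_nat d * (phi powi (2 * k) + 1)
            = of_int (int c + int d)" unfolding xe ye by (simp add: algebra_simps)
        finally show False using no by blast
      next
        case False
        hence "(x - y) - of_nat c * (phi powi (2 * i) + 1) + of_nat d * (phi powi (2 * k) - 1) \<in> sqrt5_ideal"
          using n by (intro sqrt5_ideal_add sqrt5_ideal_diff sqrt5_ideal_mult phi_powi_even_sqrt5_ideal xy) auto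
        also have "(x - y) - of_nat c * (phi powi (2 * i) + 1) + of_nat d * (phi powi (2 * k) - 1)
            = of_int (- (int c + int d))" unfolding xe ye by (simp add: algebra_simps)
        finally show False using no by blast
      qed
    qed
    thus ?thesis using pure[OF cd(1), of i] pure[OF cd(2), of k] unfolding xe ye by blast
  qed
qed

definition B :: "int \<Rightarrow> real" where "B t = bl 1 (phi powi (4 * t))"

lemma bl_phi:
  assumes "even i \<longleftrightarrow> even k"
  obtains t where "bl (phi powi (2 * i)) (phi powi (2 * k)) = phi powi (2 * i) * B t"
proof -
  have "even (k - i)" using assms by simp
  then obtain t where "k - i = 2 * t" by (rule evenE)
  hence "2 * k = 2 * i + 4 * t" by simp
  hence "phi powi (2 * k) = phi powi (2 * i) * phi powi (4 * t)" by (simp add: power_int_add)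
  hence "bl (phi powi (2 * i)) (phi powi (2 * k)) = phi powi (2 * i) * B t"
    by (simp add: bl_def B_def algebra_simps)
  thus ?thesis by (rule that)
qed

lemma totally_nonneg_phi: "totally_nonneg (phi powi (2 * i))"
  using totally_nonneg_comb[of i 1 0] by simp

lemma B_OKplus: "B t \<in> OKplus p"
proof -
  have "totally_nonneg 1" "totally_nonneg (phi powi (4 * t))" using totally_nonneg_phi[of 0] totally_nonneg_phi[of "2 * t"] by simp_all
  moreover have "1 - phi powi (4 * t) \<in> sqrt5_ideal" using sqrt5_ideal_minus[OF phi_powi_4_sqrt5_ideal] by simp
  ultimately show ?thesis unfolding B_def by (intro bl_OKplus) auto
qed

text \<open>\<open>theta\<close> is inverted at (1, -1) and at (-1, 1) but fixed at (-1, -1). Hence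
  the interval for R2 in \<open>Q1\<close> is the reciprocal of that for R1, and
  \<open>quadrant_coords\<close> applies to x, y and to their conjugates. In
  \<open>Q2_coords\<close> the intervals agree because \<open>eta\<close> is fixed at (-1,
  1).\<close>

lemma Q1_coords:
  assumes "bl x y \<in> OKplus p" "Q1 (bl x y)" "x \<in> Zphi" "y \<in> Zphi"
  shows "totally_nonneg x \<and> totally_nonneg y"
proof -
  have c: "phi / sqrt 5 > 0" "inverse phi / sqrt 5 > 0" by simp_all
  note R = R1_def R2_def emb_bl[OF assms(3,4)]
  have pos: "phi / sqrt 5 * (x + y * inverse theta) > 0"
    "inverse phi / sqrt 5 * (emb p (-1) 1 x + emb p (-1) 1 y * inverse theta) > 0"
    "inverse phi / sqrt 5 * (emb p (-1) 1 x + emb p (-1) 1 y * theta) > 0"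
    using assms(1) unfolding OKplus_iff emb_bl[OF assms(3,4)] by blast+
  have "phi / sqrt 5 * (x + y * inverse theta) \<le> phi / sqrt 5 * (x + y * theta)"
    using assms(2) pos(1) unfolding Q1_def R unfolding bl_def by (simp only: le_divide_eq_1_pos)
  hence "y \<ge> 0" by (rule quadrant_coords(1)[OF theta_pos(3) c(1)])
  moreover have "phi / sqrt 5 * (x + y * theta) \<le> theta ^ 2 * (phi / sqrt 5 * (x + y * inverse theta))"
    using assms(2) pos(1) unfolding Q1_def R unfolding bl_def by (simp only: pos_divide_le_eq)
  hence "x \<ge> 0" by (rule quadrant_coords(2)[OF theta_pos(3) c(1)])
  moreover have "inverse phi / sqrt 5 * (emb p (-1) 1 x + emb p (-1) 1 y * inverse theta)
      \<le> inverse phi / sqrt 5 * (emb p (-1) 1 x + emb p (-1) 1 y * theta)"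
    using assms(2) pos(3) unfolding Q1_def R by (simp only: divide_le_eq_1_pos)
  hence "emb p (-1) 1 y \<ge> 0" by (rule quadrant_coords(1)[OF theta_pos(3) c(2)])
  moreover have "inverse phi / sqrt 5 * (emb p (-1) 1 x + emb p (-1) 1 y * theta)
      \<le> theta ^ 2 * (inverse phi / sqrt 5 * (emb p (-1) 1 x + emb p (-1) 1 y * inverse theta))"
  proof -
    have "inverse (theta ^ 2) * (inverse phi / sqrt 5 * (emb p (-1) 1 x + emb p (-1) 1 y * theta))
      \<le> inverse phi / sqrt 5 * (emb p (-1) 1 x + emb p (-1) 1 y * inverse theta)"
      using assms(2) pos(3) unfolding Q1_def R by (simp only: pos_le_divide_eq)
    hence "theta ^ 2 * (inverse (theta ^ 2) * (inverse phi / sqrt 5 * (emb p (-1) 1 x + emb p (-1) 1 y * theta)))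
      \<le> theta ^ 2 * (inverse phi / sqrt 5 * (emb p (-1) 1 x + emb p (-1) 1 y * inverse theta))"
      by (rule mult_left_mono) simp
    thus ?thesis by (simp add: mult.assoc[symmetric])
  qed
  hence "emb p (-1) 1 x \<ge> 0" by (rule quadrant_coords(2)[OF theta_pos(3) c(2)])
  ultimately show ?thesis using assms by (simp add: totally_nonneg_def)
qed

lemma Q2_coords:
  assumes "x + y * eta \<in> OKplus p" "Q2 (x + y * eta)" "x \<in> Zphi" "y \<in> Zphi"
  shows "totally_nonneg x \<and> totally_nonneg y"
proof -
  have e: "emb p 1 (-1) (x + y * eta) = x + y * inverse eta"
    "emb p (-1) 1 (x + y * eta) = emb p (-1) 1 x + emb p (-1) 1 y * eta"
    "emb p (-1) (-1) (x + y * eta) = emb p (-1) 1 x + emb p (-1) 1 y * inverse eta"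
    using assms(3,4) by (simp_all add: embL_hom emb_eta emb_Zphi_s1 sta_Zphi)
  note R = R1_def R2_def e
  have pos: "x + y * inverse eta > 0" "emb p (-1) 1 x + emb p (-1) 1 y * inverse eta > 0"
    using assms(1) unfolding OKplus_iff e by blast+
  have "x + y * inverse eta \<le> x + y * eta"
    using assms(2) pos(1) unfolding Q2_def R by (simp only: le_divide_eq_1_pos)
  hence "y \<ge> 0" using quadrant_coords(1)[OF eta_pos(3), of 1 x y] by simp
  moreover have "x + y * eta \<le> eta ^ 2 * (x + y * inverse eta)"
    using assms(2) pos(1) unfolding Q2_def R by (simp only: pos_divide_le_eq)
  hence "x \<ge> 0" using quadrant_coords(2)[OF eta_pos(3), of 1 x y] by simp
  moreover have "emb p (-1) 1 x + emb p (-1) 1 y * inverse eta \<le> emb p (-1) 1 x + emb p (-1) 1 y * eta"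
    using assms(2) pos(2) unfolding Q2_def R by (simp only: le_divide_eq_1_pos)
  hence "emb p (-1) 1 y \<ge> 0" using quadrant_coords(1)[OF eta_pos(3), of 1 "emb p (-1) 1 x" "emb p (-1) 1 y"] by simp
  moreover have "emb p (-1) 1 x + emb p (-1) 1 y * eta \<le> eta ^ 2 * (emb p (-1) 1 x + emb p (-1) 1 y * inverse eta)"
    using assms(2) pos(2) unfolding Q2_def R by (simp only: pos_divide_le_eq)
  hence "emb p (-1) 1 x \<ge> 0" using quadrant_coords(2)[OF eta_pos(3), of 1 "emb p (-1) 1 x" "emb p (-1) 1 y"] by simp
  ultimately show ?thesis using assms by (simp add: totally_nonneg_def)
qed

lemma indec_Zphi_unit:
  assumes "indecomposable p (e * x)" "totally_nonneg x" "totpos_unit p e"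
  shows "assoc_tp p 1 (e * x)"
proof -
  have e0: "e > 0" using assms(3) by (simp add: tpu_OKplus OKplus_pos)
  have "indecomposable p (inverse e * (e * x))" by (rule indec_unit_mult[OF assms(1) tpu_inverse[OF assms(3)]])
  hence "indecomposable p x" using e0 by (simp add: mult.assoc[symmetric])
  hence "assoc_tp p 1 x" using assms(2) by (rule indec_Zphi)
  thus ?thesis using assoc_I[OF assms(3)] by (rule assoc_trans)
qed

text \<open>Under \<open>Q2\<close> the summands x and y eta are integers, so one of them vanishes.
  Under \<open>Q1\<close> the two summands need not be integral; a pair of even powers of
  \<open>phi\<close> congruent modulo sqrt 5 is split off instead, and indecomposability forces the
  remainder to be 0.\<close>

lemma indec_reduced:
  assumes ind: "indecomposable p z" and Q: "Q1 z \<or> Q2 z"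
  shows "assoc_tp p 1 z \<or> (\<exists>t. assoc_tp p (B t) z)"
  using Q
proof
  have zp: "z \<in> OKplus p" using ind by (simp add: indecomposable_def)
  have nodec: False if "u \<in> OKplus p" "v \<in> OKplus p" "z = u + v" for u v
    using ind that unfolding indecomposable_def by blast
  {
    assume Q2: "Q2 z"
    obtain a y where ay: "a \<in> Zphi" "y \<in> Zphi" "z = a + y * sp" using OKplus_Lam[OF zp] by (rule Lam_cases)
    define x where "x = a - y * of_int Y"
    have x: "x \<in> Zphi" using ay by (simp add: x_def)
    have z: "z = x + y * eta" by (simp add: x_def ay(3) eta_def algebra_simps)
    have t: "totally_nonneg x" "totally_nonneg y" using Q2_coords[OF _ _ x ay(2)] zp Q2 z by auto
    consider "x = 0" | "y = 0" | "x \<noteq> 0" "y \<noteq> 0" by blast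
    hence "assoc_tp p 1 z"
    proof cases
      case 1
      hence "z = eta * y" by (simp add: z)
      thus ?thesis using indec_Zphi_unit[of eta y] ind t tpu_eta by simp
    next
      case 2
      thus ?thesis using indec_Zphi ind t z by simp
    next
      case 3
      have "x \<in> OKplus p" "y * eta \<in> OKplus p"
        using 3 t by (simp_all add: OKplus_mult totally_nonneg_Zphi_OKplus tpu_OKplus[OF tpu_eta])
      thus ?thesis using nodec z by blast
    qed
    thus ?thesis by blast
  }
  assume Q1: "Q1 z"
  obtain x y where xy: "x \<in> Zphi" "y \<in> Zphi" "x - y \<in> sqrt5_ideal" and z: "z = bl x y"
    using OKplus_Lam[OF zp] by (rule Lam_bl)
  have t: "totally_nonneg x" "totally_nonneg y" using Q1_coords[OF _ _ xy(1,2)] zp Q1 z by auto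
  \<comment> \<open>If one coordinate is 0, the congruence makes the other divisible by sqrt 5. The
    element is then a unit times an element of Z[phi], and \<open>indec_Zphi\<close>
    decides.\<close>
  have div5: "assoc_tp p 1 (e * (phi / sqrt 5 * w))"
    if w: "w \<in> sqrt5_ideal" "totally_nonneg w" and e: "totpos_unit p e" and ind: "indecomposable p (e * (phi / sqrt 5 * w))" for e w
  proof (rule indec_Zphi_unit[OF ind _ e])
    have Z: "phi / sqrt 5 * w \<in> Zphi" using Zphi_mult[OF Zphi_phi, of "w / sqrt 5"] w(1) by (simp add: sqrt5_ideal_def)
    have "bl w 0 = phi / sqrt 5 * w" by (simp add: bl_def)
    moreover have "0 \<in> Zphi" "w \<in> Zphi" using w by (auto simp: totally_nonneg_def)
    ultimately have "emb p (-1) 1 (phi / sqrt 5 * w) = inverse phi / sqrt 5 * emb p (-1) 1 w"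
      using emb_bl(2)[of w 0] by simp
    thus "totally_nonneg (phi / sqrt 5 * w)" using Z w(2)
      by (simp add: totally_nonneg_def zero_le_mult_iff less_imp_le)
  qed
  consider "x = 0" | "y = 0" | "x \<noteq> 0" "y \<noteq> 0" by blast
  thus ?thesis
  proof cases
    case 1
    hence "z = theta * (phi / sqrt 5 * y)" by (simp add: z bl_def)
    moreover have "y \<in> sqrt5_ideal" using xy(3) 1 sqrt5_ideal_minus[of "-y"] by simp
    ultimately show ?thesis using div5[of y theta] t tpu_theta ind by simp
  next
    case 2
    hence "z = 1 * (phi / sqrt 5 * x)" by (simp add: z bl_def)
    thus ?thesis using div5[of x 1] t tpu_1 ind xy(3) 2 by simp
  next
    case 3
    obtain i k where ik: "even i \<longleftrightarrow> even k" "totally_nonneg (x - phi powi (2 * i))" "totally_nonneg (y - phi powi (2 * k))"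
      using common_terms[OF t(1) 3(1) t(2) 3(2) xy(3)] by blast
    obtain s where s: "bl (phi powi (2 * i)) (phi powi (2 * k)) = phi powi (2 * i) * B s"
      using ik(1) by (rule bl_phi)
    have first: "phi powi (2 * i) * B s \<in> OKplus p"
      by (intro OKplus_mult tpu_OKplus tpu_phi B_OKplus)
    have sum: "z = phi powi (2 * i) * B s + bl (x - phi powi (2 * i)) (y - phi powi (2 * k))"
      unfolding s[symmetric] z bl_def by (simp add: algebra_simps)
    have "x - phi powi (2 * i) - (y - phi powi (2 * k)) = (x - y) - (phi powi (2 * i) - phi powi (2 * k))" by simp
    hence I: "x - phi powi (2 * i) - (y - phi powi (2 * k)) \<in> sqrt5_ideal"
      using sqrt5_ideal_diff[OF xy(3) sqrt5_ideal_parity[OF ik(1)]] by (simp only:)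
    have "x - phi powi (2 * i) = 0 \<and> y - phi powi (2 * k) = 0"
    proof (rule ccontr)
      assume "\<not> ?thesis"
      hence "bl (x - phi powi (2 * i)) (y - phi powi (2 * k)) \<in> OKplus p"
        using ik I by (intro bl_OKplus) auto
      thus False using nodec[OF first _ sum] by blast
    qed
    hence "z = phi powi (2 * i) * B s" using sum by (simp add: bl_def)
    thus ?thesis using assoc_I[OF tpu_phi] by blast
  qed
qed

theorem indec_classification:
  assumes "indecomposable p z"
  shows "assoc_tp p 1 z \<or> (\<exists>t. assoc_tp p (B t) z)"
proof -
  obtain u where u: "totpos_unit p u" "Q1 (u * z) \<or> Q2 (u * z)"
    using unit_reduction assms unfolding indecomposable_def by blast
  have bk: "assoc_tp p (u * z) z" by (rule assoc_sym[OF assoc_I[OF u(1)]])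
  from indec_reduced[OF indec_unit_mult[OF assms u(1)] u(2)] show ?thesis
    using assoc_trans[OF _ bk] by blast
qed

subsection \<open>Which classes are indecomposable\<close>

lemma theta_sum: "theta + inverse theta = 2 * of_int X"
  and theta_diff: "theta - inverse theta = 2 * sqrt 5 * sp"
  unfolding inverse_theta unfolding theta_def by simp_all

lemma m_t0: "int m + 1 = 4 * (3 * int n + 1)"
  by (simp add: m_eq)

lemma emb_B:
  shows "emb p 1 (-1) (B t) = phi / sqrt 5 * (1 + phi powi (4 * t) * inverse theta)"
    and "emb p (-1) 1 (B t) = inverse phi / sqrt 5 * (1 + phi powi (- (4 * t)) * inverse theta)"
    and "emb p (-1) (-1) (B t) = inverse phi / sqrt 5 * (1 + phi powi (- (4 * t)) * theta)"
proof -
  have "emb p (-1) 1 (phi powi (4 * t)) = phi powi (- (4 * t))" using tau_phi_even[of "2 * t"] by simp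
  thus "emb p 1 (-1) (B t) = phi / sqrt 5 * (1 + phi powi (4 * t) * inverse theta)"
    "emb p (-1) 1 (B t) = inverse phi / sqrt 5 * (1 + phi powi (- (4 * t)) * inverse theta)"
    "emb p (-1) (-1) (B t) = inverse phi / sqrt 5 * (1 + phi powi (- (4 * t)) * theta)"
    unfolding B_def by (simp_all only: emb_bl Zphi_0_1 Zphi_phi_powi emb_int)
qed

text \<open>Conjugation preserves indecomposability, so that \<open>indec_B_bound\<close> only has
  to exclude large positive t.\<close>

lemma B_neg: "B (- t) = phi powi (2 * (- 2 * t)) * theta * emb p 1 (-1) (B t)"
proof -
  have w: "phi powi (4 * (- t)) = inverse (phi powi (4 * t))" "phi powi (2 * (- 2 * t)) = inverse (phi powi (4 * t))"
    by (simp_all add: power_int_minus[symmetric])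
  have "phi powi (4 * t) \<noteq> 0" by simp
  thus ?thesis unfolding emb_B unfolding B_def bl_def w by (simp add: field_simps)
qed

lemma assoc_B_neg: "assoc_tp p (emb p 1 (-1) (B t)) (B (- t))"
  unfolding B_neg by (intro assoc_I tpu_mult tpu_phi tpu_theta)

lemma phi_powi_m: "phi powi (int m + int k) = phi ^ m * phi ^ k"
  by (simp add: power_int_add)

text \<open>Here 4t = m + 5, and t is too small for the estimate of \<open>B_decomp2\<close>: at (1,
  -1) the element stays below phi^4. By \<open>theta_eta\<close> it is the sum of the units
  phi^(m+3) eta and phi^4 theta eta; the exponent m + 3 is even, so both are totally
  positive.\<close>

lemma B_decomp1:
  assumes "t = 3 * int n + 2"
  shows "\<not> indecomposable p (B t)"
proof -
  have "4 * t = int m + int 5" using m_t0 assms by simp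
  hence w: "phi powi (4 * t) = phi ^ m * phi ^ 5" by (simp only: phi_powi_m)
  define q where "q = phi ^ m"
  have q0: "q \<noteq> 0" by (simp add: q_def)
  have e: "sqrt 5 * eta = theta + 2 * inverse q" using theta_eta by (simp add: q_def)
  have th: "theta * theta = 2 * (q - inverse q) * theta - 1"
  proof -
    have "theta * theta = (theta + inverse theta) * theta - 1" by (simp add: algebra_simps)
    thus ?thesis unfolding theta_sum X_phi q_def .
  qed
  have p3: "phi * phi ^ 5 = phi ^ 3 + 2 * phi ^ 4" "2 * phi ^ 3 - phi ^ 4 = phi"
    using phi_rel(1) unfolding phi_power_small by (simp_all add: algebra_simps)
  have "sqrt 5 * B t = phi * (1 + q * phi ^ 5 * theta)" by (simp add: B_def bl_def w q_def)
  also have "\<dots> = phi + (phi * phi ^ 5) * (q * theta)" by (simp add: algebra_simps)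
  also have "\<dots> = (2 * phi ^ 3 - phi ^ 4) + (phi ^ 3 + 2 * phi ^ 4) * (q * theta)" unfolding p3 by simp
  also have "\<dots> = phi ^ 3 * q * (theta + 2 * inverse q) + phi ^ 4 * (theta * theta) + 2 * phi ^ 4 * inverse q * theta"
    unfolding th using q0 by (simp add: algebra_simps)
  also have "\<dots> = phi ^ 3 * q * (theta + 2 * inverse q) + phi ^ 4 * theta * (theta + 2 * inverse q)"
    by (simp add: algebra_simps)
  also have "\<dots> = sqrt 5 * (phi ^ 3 * q * eta + phi ^ 4 * theta * eta)" unfolding e[symmetric] by (simp add: algebra_simps)
  finally have B: "B t = phi ^ 3 * q * eta + phi ^ 4 * theta * eta" by simp
  have "3 + m = 2 * (6 * n + 3)" by (simp add: m_eq)
  hence "phi ^ 3 * q = phi powi (2 * int (6 * n + 3))"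
    unfolding q_def power_add[symmetric] by (metis of_nat_mult of_nat_numeral power_int_of_nat)
  hence "phi ^ 3 * q * eta \<in> OKplus p" by (simp only: OKplus_mult tpu_OKplus tpu_phi tpu_eta)
  moreover have "phi ^ 4 \<in> OKplus p" using tpu_OKplus[OF tpu_phi[of 2]] by simp
  hence "phi ^ 4 * theta * eta \<in> OKplus p" by (intro OKplus_mult tpu_OKplus[OF tpu_theta] tpu_OKplus[OF tpu_eta])
  ultimately show ?thesis unfolding indecomposable_def B by blast
qed

text \<open>The unit phi^4 can be subtracted. Where phi is fixed this follows from phi^(4t) >=
  phi^(m+9), theta < 2 phi^m and 2 sqrt 5 < phi^6. Where it is conjugated, sqrt 5 < phi^3 gives 1 /
  (phi sqrt 5) > phi^-4; with phi^2 in place of phi^4 this comparison would fail.\<close>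

lemma B_decomp2:
  assumes "t \<ge> 3 * int n + 3"
  shows "\<not> indecomposable p (B t)"
proof -
  define w where "w = phi powi (4 * t)"
  have w0: "w > 0" by (simp add: w_def)
  have "phi powi (int m + int 9) \<le> w" unfolding w_def
    by (rule power_int_increasing) (use assms m_t0 in \<open>auto simp: less_imp_le\<close>)
  hence "phi ^ m * phi ^ 9 \<le> w" by (simp only: phi_powi_m)
  moreover have "phi ^ 9 = phi ^ 6 * phi ^ 3" by (simp add: power_add[symmetric])
  ultimately have w1: "phi ^ m * (phi ^ 6 * phi ^ 3) \<le> w" by (simp only:)
  have th: "theta < 2 * phi ^ m"
    using theta_sum inverse_phi_m_lt(2) positive_imp_inverse_positive[OF theta_pos(1)]
    unfolding X_phi right_diff_distrib by linarith
  have s56: "2 * sqrt 5 < phi ^ 6" using phi_bounds sqrt5_bounds by (simp add: phi_power_small)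
  have "sqrt 5 * phi ^ 3 * theta < sqrt 5 * phi ^ 3 * (2 * phi ^ m)"
    using th by (intro mult_strict_left_mono) auto
  also have "\<dots> = (2 * sqrt 5) * (phi ^ m * phi ^ 3)" by simp
  also have "\<dots> < phi ^ 6 * (phi ^ m * phi ^ 3)" using s56 by (intro mult_strict_right_mono) auto
  also have "\<dots> \<le> w" using w1 by (simp add: mult_ac)
  finally have ww: "sqrt 5 * phi ^ 3 < w * inverse theta" by (simp add: field_simps)
  have s1: "phi / sqrt 5 * (1 + c) > phi ^ 4" if "sqrt 5 * phi ^ 3 < c" for c
  proof -
    have "phi / sqrt 5 * (sqrt 5 * phi ^ 3) < phi / sqrt 5 * (1 + c)"
      using that by (intro mult_strict_left_mono) auto
    moreover have "phi / sqrt 5 * (sqrt 5 * phi ^ 3) = phi ^ 4" by (simp add: power_Suc[symmetric])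
    ultimately show ?thesis by simp
  qed
  have s2: "inverse phi / sqrt 5 * (1 + c) > inverse (phi ^ 4)" if "c > 0" for c
  proof -
    have "sqrt 5 < phi ^ 3" using phi_bounds sqrt5_bounds by (simp add: phi_power_small)
    hence "inverse (phi ^ 3) < inverse (sqrt 5)" by (simp add: field_simps)
    hence "inverse phi * inverse (phi ^ 3) < inverse phi * inverse (sqrt 5)" by (intro mult_strict_left_mono) auto
    moreover have "inverse phi * inverse (phi ^ 3) = inverse (phi ^ 4)"
      by (simp add: inverse_mult_distrib[symmetric] power_Suc[symmetric] del: inverse_mult_distrib)
    ultimately have "inverse (phi ^ 4) < inverse phi / sqrt 5 * 1" by (simp only: divide_inverse mult_1_right)
    also have "\<dots> < inverse phi / sqrt 5 * (1 + c)" using that by (intro mult_strict_left_mono) auto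
    finally show ?thesis .
  qed
  have it: "inverse theta < theta" using theta_gt by (simp add: field_simps power2_eq_square less_1_mult)
  have ww': "sqrt 5 * phi ^ 3 < w * theta"
    using ww mult_strict_left_mono[OF it w0] by linarith
  have p4: "phi ^ 4 \<in> OKplus p" using tpu_OKplus[OF tpu_phi[of 2]] by simp
  have t4: "emb p (-1) 1 (phi ^ 4) = inverse (phi ^ 4)" "emb p (-1) (-1) (phi ^ 4) = inverse (phi ^ 4)"
    using tau_phi_even[of 2] sta_Zphi[of "phi ^ 4"] by (simp_all add: power_int_minus)
  have wi: "phi powi (- (4 * t)) > 0" by simp
  have "B t - phi ^ 4 \<in> OKplus p"
    unfolding OKplus_iff
  proof (intro conjI)
    show "B t - phi ^ 4 \<in> Lam" using OKplus_Lam[OF B_OKplus] OKplus_Lam[OF p4] by simp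
    show "B t - phi ^ 4 > 0" using s1[OF ww'] by (simp add: B_def bl_def w_def)
    show "emb p 1 (-1) (B t - phi ^ 4) > 0"
      using s1[OF ww] OKplus_Lam[OF B_OKplus] OKplus_Lam[OF p4]
      by (simp add: embL_hom emb_B w_def emb_Zphi_s1)
    show "emb p (-1) 1 (B t - phi ^ 4) > 0"
      using s2[of "phi powi (- (4 * t)) * inverse theta"] wi OKplus_Lam[OF B_OKplus] OKplus_Lam[OF p4]
      by (simp add: embL_hom emb_B t4)
    show "emb p (-1) (-1) (B t - phi ^ 4) > 0"
      using s2[of "phi powi (- (4 * t)) * theta"] wi OKplus_Lam[OF B_OKplus] OKplus_Lam[OF p4]
      by (simp add: embL_hom emb_B t4)
  qed
  moreover have "B t = phi ^ 4 + (B t - phi ^ 4)" by simp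
  ultimately show ?thesis unfolding indecomposable_def using p4 by blast
qed

lemma indec_B_bound:
  assumes "indecomposable p (B t)"
  shows "\<bar>t\<bar> \<le> 3 * int n + 1"
proof -
  have pos: "t \<le> 3 * int n + 1" if "indecomposable p (B t)" for t
    using that B_decomp1[of t] B_decomp2[of t] by linarith
  have "indecomposable p (B (- t))"
    using indec_assoc[OF indec_emb[OF assms] assoc_B_neg] by simp
  from pos[OF this] pos[OF assms] show ?thesis by linarith
qed

section \<open>Indecomposability through a trace functional\<close>

lemma bl_unique:
  assumes "bl x y = bl x' y'" "x \<in> Zphi" "y \<in> Zphi" "x' \<in> Zphi" "y' \<in> Zphi"
  shows "x = x' \<and> y = y'"
proof -
  have "emb p 1 (-1) (bl x y) = emb p 1 (-1) (bl x' y')" using assms(1) by simp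
  hence 1: "x + y * inverse theta = x' + y' * inverse theta" using assms(2-5) by (simp add: emb_bl)
  have 2: "x + y * theta = x' + y' * theta" using assms(1) by (simp add: bl_def)
  have "(y - y') * (theta - inverse theta) = 0" using 1 2 by (simp add: algebra_simps)
  hence "y = y'" unfolding theta_diff using sp_pos by simp
  with 2 show ?thesis by simp
qed

text \<open>The expression is affine in c and positive at both ends of the interval.\<close>

lemma between_pos:
  fixes x y c e :: real
  assumes "x + y * e > 0" "x + y * inverse e > 0" "inverse e \<le> c" "c \<le> e"
  shows "x + c * y > 0"
proof (cases "y \<ge> 0")
  case True
  have "y * inverse e \<le> y * c" using True assms(3) by (rule mult_left_mono[rotated])
  thus ?thesis using assms by (simp add: mult.commute)
next
  case False
  hence "y * e \<le> y * c" using assms(4) by (intro mult_left_mono_neg) auto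
  thus ?thesis using assms by (simp add: mult.commute)
qed

text \<open>For odd \<open>e\<close> the functional \<open>bl x y \<mapsto> Tr (x + phi\<^sup>2\<^sup>e y) / 5\<close> is integral on the ring of
  integers because \<open>phi\<^sup>2\<close> is congruent to \<open>-1\<close> modulo \<open>sqrt 5\<close>.\<close>
lemma trace_functional:
  assumes "bl x y \<in> OKplus p" "x \<in> Zphi" "y \<in> Zphi" "x - y \<in> sqrt5_ideal" "odd e" "\<bar>2 * e\<bar> \<le> int m + 1"
  shows "x + phi powi (2 * e) * y + emb p (-1) 1 (x + phi powi (2 * e) * y) \<ge> 5"
proof -
  \<comment> \<open>For |k| <= m + 1 the power phi^k lies between 1 / theta and theta, so
    \<open>between_pos\<close> carries positivity from the four embeddings over to x + phi^(2e) y
    and its conjugate.\<close>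
  have up: "phi powi k \<le> theta" if "k \<le> int m + 1" for k
  proof -
    have "phi powi k \<le> phi powi (int m + int 1)" by (rule power_int_increasing) (use that in \<open>auto simp: less_imp_le\<close>)
    also have "\<dots> < theta" using theta_gt_phi by (simp only: phi_powi_m power_add)
    finally show ?thesis by simp
  qed
  have lo: "inverse theta \<le> phi powi k" if "- k \<le> int m + 1" for k
  proof -
    have "inverse theta \<le> inverse (phi powi (- k))"
      using up[OF that] by (intro le_imp_inverse_le) auto
    thus ?thesis by (simp add: power_int_minus)
  qed
  let ?z = "x + phi powi (2 * e) * y"
  have tz: "emb p (-1) 1 ?z = emb p (-1) 1 x + phi powi (- (2 * e)) * emb p (-1) 1 y"
    using assms by (simp add: embL_hom tau_phi_even)
  have pos: "x + y * theta > 0" "x + y * inverse theta > 0"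
    "emb p (-1) 1 x + emb p (-1) 1 y * theta > 0" "emb p (-1) 1 x + emb p (-1) 1 y * inverse theta > 0"
  proof -
    have c: "phi / sqrt 5 > 0" "inverse phi / sqrt 5 > 0" by simp_all
    have "phi / sqrt 5 * (x + y * theta) > 0" "phi / sqrt 5 * (x + y * inverse theta) > 0"
      "inverse phi / sqrt 5 * (emb p (-1) 1 x + emb p (-1) 1 y * theta) > 0"
      "inverse phi / sqrt 5 * (emb p (-1) 1 x + emb p (-1) 1 y * inverse theta) > 0"
      using assms(1) unfolding OKplus_iff emb_bl[OF assms(2,3)] unfolding bl_def by blast+
    thus "x + y * theta > 0" "x + y * inverse theta > 0"
      "emb p (-1) 1 x + emb p (-1) 1 y * theta > 0" "emb p (-1) 1 x + emb p (-1) 1 y * inverse theta > 0"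
      using c by (blast intro: zero_less_mult_pos)+
  qed
  have "?z > 0" by (rule between_pos[OF pos(1,2)]) (rule up lo, use assms(6) in linarith)+
  moreover have "emb p (-1) 1 ?z > 0" unfolding tz
    by (rule between_pos[OF pos(3,4)]) (rule up lo, use assms(6) in linarith)+
  moreover have "?z \<in> sqrt5_ideal"
  proof -
    have "?z = (x - y) + y * (phi powi (2 * e) + 1)" by (simp add: algebra_simps)
    thus ?thesis using assms phi_powi_even_sqrt5_ideal(2)[OF assms(5)] by (simp only: sqrt5_ideal_add sqrt5_ideal_mult)
  qed
  then obtain a b where ab: "?z / sqrt 5 = of_int a + of_int b * phi" unfolding sqrt5_ideal_def by (auto elim: Zphi_cases)
  have z: "?z = sqrt 5 * (of_int a + of_int b * phi)" using ab by (simp add: field_simps)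
  \<comment> \<open>The trace of sqrt 5 (a + b phi) is 5b, so a positive trace is at least
    5.\<close>
  have "emb p (-1) 1 ?z = - sqrt 5 * (of_int a + of_int b * psi)"
    unfolding z by (subst embL_hom) (simp_all add: emb_Zphi emb_sqrt5)
  hence "?z + emb p (-1) 1 ?z = sqrt 5 * (of_int b * (phi - psi))" unfolding z by (simp add: algebra_simps)
  hence s: "?z + emb p (-1) 1 ?z = of_int (5 * b)" unfolding phi_rel by simp
  ultimately have "real_of_int (5 * b) > 0" by linarith
  hence "b \<ge> 1" by simp
  thus ?thesis unfolding s by simp
qed

theorem indec_B:
  assumes "\<bar>t\<bar> \<le> 3 * int n + 1"
  shows "indecomposable p (B t)"
proof -
  \<comment> \<open>With e + 2t equal to 1 or -1 the trace at \<open>B t\<close> is 2 + phi^2 +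
    phi^-2 = 5, whereas two summands would contribute at least 5 each. The sign with the smaller |e|
    is taken, and then 2 |e| <= m + 1 holds on the whole range of t.\<close>
  define e where "e = (if t \<ge> 0 then 1 - 2 * t else - 1 - 2 * t)"
  define f where "f = e + 2 * t"
  have e: "odd e" "\<bar>2 * e\<bar> \<le> int m + 1" using assms m_t0 by (auto simp: e_def)
  have "False" if u: "u \<in> OKplus p" and v: "v \<in> OKplus p" and uv: "B t = u + v" for u v
  proof -
    obtain x y where xy: "x \<in> Zphi" "y \<in> Zphi" "x - y \<in> sqrt5_ideal" "u = bl x y" using OKplus_Lam[OF u] by (rule Lam_bl)
    obtain x' y' where xy': "x' \<in> Zphi" "y' \<in> Zphi" "x' - y' \<in> sqrt5_ideal" "v = bl x' y'" using OKplus_Lam[OF v] by (rule Lam_bl)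
    have "bl 1 (phi powi (4 * t)) = bl (x + x') (y + y')"
      using uv unfolding B_def xy(4) xy'(4) by (simp add: bl_def algebra_simps add_divide_distrib)
    from bl_unique[OF this] xy xy' have s: "x + x' = 1" "y + y' = phi powi (4 * t)" by auto
    let ?f = "\<lambda>x y. x + phi powi (2 * e) * y + emb p (-1) 1 (x + phi powi (2 * e) * y)"
    have "?f x y + ?f x' y' = ?f (x + x') (y + y')"
      using xy xy' by (simp add: embL_hom algebra_simps)
    also have "\<dots> = 1 + phi powi (2 * e) * phi powi (4 * t) + emb p (-1) 1 (1 + phi powi (2 * e) * phi powi (4 * t))"
      unfolding s ..
    also have "phi powi (2 * e) * phi powi (4 * t) = phi powi (2 * f)"
      unfolding f_def by (simp add: power_int_add[symmetric] algebra_simps)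
    also have "1 + phi powi (2 * f) + emb p (-1) 1 (1 + phi powi (2 * f))
        = 2 + (phi powi (2 * f) + phi powi (- (2 * f)))"
      by (subst embL_hom) (simp_all add: tau_phi_even)
    also have "phi powi (2 * f) + phi powi (- (2 * f)) = phi ^ 2 + inverse (phi ^ 2)"
      by (auto simp: f_def e_def power_int_minus)
    also have "inverse (phi ^ 2) = 2 - phi"
      by (rule inverse_unique) (use phi_rel(1) in \<open>simp add: phi_power_small algebra_simps\<close>)
    finally have "?f x y + ?f x' y' = 5" by (simp add: phi_power_small)
    moreover have "?f x y \<ge> 5" using trace_functional[OF _ xy(1-3) e] u xy(4) by simp
    moreover have "?f x' y' \<ge> 5" using trace_functional[OF _ xy'(1-3) e] v xy'(4) by simp
    ultimately show False by linarith
  qed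
  thus ?thesis unfolding indecomposable_def using B_OKplus by blast
qed

subsection \<open>Norms and non-associated classes\<close>

definition Nm :: "real \<Rightarrow> real" where
  "Nm x = x * emb p 1 (-1) x * (emb p (-1) 1 x * emb p (-1) (-1) x)"

lemma Nm_mult: "x \<in> Lam \<Longrightarrow> y \<in> Lam \<Longrightarrow> Nm (x * y) = Nm x * Nm y"
  by (simp add: Nm_def embL_hom)

lemma Nm_Zphi: "x \<in> Zphi \<Longrightarrow> Nm x = (x * emb p (-1) 1 x) ^ 2"
  by (simp add: Nm_def emb_Zphi_s1 sta_Zphi power2_eq_square)

lemma Nm_sp: "Nm sp = of_int p ^ 2"
proof -
  have "Nm sp = (sp * sp) * (sp * sp)" unfolding Nm_def emb_sp by simp
  thus ?thesis unfolding sp_sq by (simp add: power2_eq_square)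
qed

lemma Nm_int:
  assumes "x \<in> Lam" shows "Nm x \<in> \<int>"
proof -
  from assms obtain a b where ab: "a \<in> Zphi" "b \<in> Zphi" "x = a + b * sp" by (rule Lam_cases)
  define w where "w = a * a - of_int p * (b * b)"
  have tw: "emb p (-1) 1 w = emb p (-1) 1 a * emb p (-1) 1 a - of_int p * (emb p (-1) 1 b * emb p (-1) 1 b)"
    unfolding w_def using ab by (simp add: embL_hom)
  have d: "(u + v * sp) * (u - v * sp) = u * u - of_int p * (v * v)" for u v
  proof -
    have "(u + v * sp) * (u - v * sp) = u * u - (sp * sp) * (v * v)" by (simp only: algebra_simps)
    thus ?thesis by (simp only: sp_sq)
  qed
  have e: "emb p 1 (-1) x = a - b * sp" "emb p (-1) 1 x = emb p (-1) 1 a + emb p (-1) 1 b * sp"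
    "emb p (-1) (-1) x = emb p (-1) 1 a - emb p (-1) 1 b * sp"
    unfolding ab(3) using ab(1,2) by (simp_all add: embL_hom emb_sp emb_Zphi_s1 sta_Zphi)
  have "Nm x = w * emb p (-1) 1 w" unfolding Nm_def e tw unfolding ab(3) d w_def ..
  moreover have "w \<in> Zphi" unfolding w_def using ab by simp
  then obtain c f where "w = of_int c + of_int f * phi" by (rule Zphi_cases)
  ultimately have "Nm x = (of_int c + of_int f * phi) * (of_int c + of_int f * psi)" by (simp add: emb_Zphi)
  also have "\<dots> = of_int c * of_int c + of_int c * of_int f * (phi + psi) + of_int f * of_int f * (phi * psi)"
    by (simp add: algebra_simps)
  finally show ?thesis unfolding phi_rel by simp
qed

lemma Nm_pos: "x \<in> OKplus p \<Longrightarrow> Nm x > 0"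
  by (simp add: Nm_def OKplus_iff)

lemma Nm_ge_1: "x \<in> OKplus p \<Longrightarrow> Nm x \<ge> 1"
proof -
  assume x: "x \<in> OKplus p"
  obtain k where k: "Nm x = of_int k" using Nm_int[OF OKplus_Lam[OF x]] by (rule Ints_cases)
  with Nm_pos[OF x] show ?thesis by simp
qed

lemma Nm_tpu: "totpos_unit p e \<Longrightarrow> Nm e = 1"
proof -
  assume e: "totpos_unit p e"
  have i: "totpos_unit p (inverse e)" by (rule tpu_inverse[OF e])
  have "e > 0" using e by (simp add: tpu_OKplus OKplus_pos)
  hence "Nm e * Nm (inverse e) = Nm 1"
    using Nm_mult[of e "inverse e"] e i by (simp add: tpu_OKplus OKplus_Lam)
  also have "Nm 1 = 1" by (simp add: Nm_def)
  finally have "Nm e * Nm (inverse e) = 1" .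
  moreover have "Nm e \<ge> 1" "Nm (inverse e) \<ge> 1" using Nm_ge_1 e i by (simp_all add: tpu_OKplus)
  ultimately show ?thesis
    by (smt (verit) mult_le_cancel_left1)
qed

lemma assoc_Nm: "assoc_tp p x y \<Longrightarrow> x \<in> Lam \<Longrightarrow> Nm y = Nm x"
  unfolding assoc_tp_def by (auto simp: Nm_mult Nm_tpu OKplus_Lam tpu_OKplus)

text \<open>A summand of 1 has all conjugates strictly between 0 and 1, hence norm below 1.\<close>

lemma indec_1: "indecomposable p 1"
proof -
  have False if h: "x \<in> OKplus p" "y \<in> OKplus p" "1 = x + y" for x y
  proof -
    have lt: "emb p s t x < 1" if "s \<in> {-1, 1}" "t \<in> {-1, 1}" for s t
    proof -
      have "1 = emb p s t x + emb p s t y"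
        using embL_hom(1)[OF OKplus_Lam[OF h(1)] OKplus_Lam[OF h(2)] that] h(3) emb_int(2)[of s t] by simp
      moreover have "emb p s t y > 0" using h(2) that by (auto simp: OKplus_def)
      ultimately show ?thesis by linarith
    qed
    have "x < 1" using h OKplus_pos[of y] by linarith
    have ml: "a * b < 1" if "0 < a" "a < 1" "0 < b" "b < 1" for a b :: real
      using mult_strict_mono[OF that(2,4)] that by simp
    have "Nm x < 1" unfolding Nm_def
      using h(1) \<open>x < 1\<close> lt by (intro ml) (auto simp: OKplus_iff)
    with Nm_ge_1[OF h(1)] show False by simp
  qed
  thus ?thesis unfolding indecomposable_def using tpu_OKplus[OF tpu_1] by blast
qed

text \<open>Conjugates are paired along sqrt p: (1 + w theta)(1 + w / theta) = w (w + 1/w + 2X). The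
  factors w and 1/w of the two pairs cancel, as do those of \<open>phi\<close>.\<close>

lemma Nm_B: "Nm (B t) = ((phi powi (4 * t) + phi powi (- (4 * t)) + 2 * of_int X) / 5) ^ 2"
proof -
  define w v where "w = phi powi (4 * t)" and "v = phi powi (- (4 * t))"
  have wv: "w * v = 1" by (simp add: w_def v_def power_int_minus)
  have id: "(1 + z * theta) * (1 + z * inverse theta) = 1 + z * (2 * of_int X) + z * z" for z
    unfolding theta_sum[symmetric] by (simp add: algebra_simps)
  have "Nm (B t) = (phi / sqrt 5 * (1 + w * theta)) * (phi / sqrt 5 * (1 + w * inverse theta))
      * ((inverse phi / sqrt 5 * (1 + v * inverse theta)) * (inverse phi / sqrt 5 * (1 + v * theta)))"
    unfolding Nm_def emb_B by (simp only: w_def v_def B_def bl_def)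
  also have "\<dots> = ((1 + w * theta) * (1 + w * inverse theta)) * ((1 + v * theta) * (1 + v * inverse theta)) / 25"
    by (simp add: field_simps)
  also have "\<dots> = ((1 + w * (2 * of_int X) + w * w) * (1 + v * (2 * of_int X) + v * v)) / 25"
    unfolding id ..
  also have "(1 + w * (2 * of_int X) + w * w) * (1 + v * (2 * of_int X) + v * v)
      = (w * v) * (w + v + 2 * of_int X) * (w + v + 2 * of_int X)"
  proof -
    have "1 + w * (2 * of_int X) + w * w = w * (w + v + 2 * of_int X)" 
      "1 + v * (2 * of_int X) + v * v = v * (w + v + 2 * of_int X)"
      using wv by (simp_all add: algebra_simps)
    thus ?thesis by (simp only: mult_ac)
  qed
  finally show ?thesis unfolding wv by (simp add: w_def v_def power2_eq_square)
qed

lemma B_base_pos: "phi powi k + phi powi (- k) + 2 * of_int X \<ge> 10"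
proof -
  have "phi powi k + phi powi (- k) \<ge> 2"
  proof -
    have p: "phi powi k > 0" by simp
    have "0 \<le> (phi powi k - 1) ^ 2" by simp
    hence "2 * phi powi k \<le> phi powi k * phi powi k + 1" by (simp add: power2_eq_square algebra_simps)
    hence "2 * phi powi k \<le> (phi powi k + phi powi (- k)) * phi powi k"
      by (simp add: algebra_simps power_int_minus)
    thus ?thesis using p by simp
  qed
  thus ?thesis using X_ge by linarith
qed

lemma not_assoc_1_B: "\<not> assoc_tp p 1 (B t)"
proof
  assume "assoc_tp p 1 (B t)"
  hence "Nm (B t) = 1" using assoc_Nm[of 1 "B t"] by (simp add: Nm_def)
  moreover have "Nm (B t) \<ge> 2 ^ 2" unfolding Nm_B
    by (rule power_mono) (use B_base_pos[of "4 * t"] in auto)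
  ultimately show False by simp
qed

lemma assoc_B_eq_or_neg:
  assumes "assoc_tp p (B t) (B t')" shows "t = t' \<or> t = - t'"
proof -
  have "Nm (B t') = Nm (B t)" using assoc_Nm[OF assms] OKplus_Lam[OF B_OKplus] by simp
  hence "(phi powi (4 * t') + phi powi (- (4 * t')) + 2 * of_int X) / 5 = (phi powi (4 * t) + phi powi (- (4 * t)) + 2 * of_int X) / 5"
    unfolding Nm_B using B_base_pos[of "4 * t"] B_base_pos[of "4 * t'"]
    by (simp add: power2_eq_iff_nonneg)
  hence e: "phi powi (4 * t') + phi powi (- (4 * t')) = phi powi (4 * t) + phi powi (- (4 * t))" by simp
  define a b where "a = phi powi (4 * t)" and "b = phi powi (4 * t')"
  have ab: "a > 0" "b > 0" by (simp_all add: a_def b_def)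
  have "b + inverse b = a + inverse a" using e by (simp add: a_def b_def power_int_minus)
  hence "(a - b) * (a * b - 1) = 0" using ab by (simp add: field_simps)
  hence "a = b \<or> a * b = 1" by auto
  moreover have inj: "i = j" if "phi powi i = phi powi j" for i j
    using that power_int_strict_increasing[of i j phi] power_int_strict_increasing[of j i phi]
    by (metis linorder_neqE_linordered_idom order_less_irrefl phi_pos(2))
  moreover have "a * b = phi powi (4 * t + 4 * t')" by (simp add: a_def b_def power_int_add)
  ultimately have "4 * t = 4 * t' \<or> 4 * t + 4 * t' = 0"
    unfolding a_def b_def by (metis power_int_0_right)
  thus ?thesis by linarith
qed

text \<open>If the conjugate of \<open>B k\<close> is e times \<open>B k\<close>, then
  \<open>B k\<close> divides the difference of the two. Let M^2 be its norm. Comparing norms gives M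
  | 4p, and the norm equation of phi^(4k) gives M | F^2 for the Fibonacci number F =
  \<open>ys (4 * k)\<close>. As p is squarefree, the odd part of M divides F, but M is too large for
  that.\<close>

lemma not_assoc_neg:
  assumes k: "0 < k" "k \<le> 3 * n"
  shows "\<not> assoc_tp p (B (int k)) (B (- int k))"
proof
  assume "assoc_tp p (B (int k)) (B (- int k))"
  hence "assoc_tp p (B (int k)) (emb p 1 (-1) (B (int k)))"
    using assoc_sym[OF assoc_B_neg] by (rule assoc_trans)
  then obtain e where e: "totpos_unit p e" "emb p 1 (-1) (B (int k)) = e * B (int k)"
    by (auto simp: assoc_tp_def)
  define q where "q = phi ^ (4 * k)"
  have qp: "phi powi (4 * int k) = q" by (metis of_nat_mult of_nat_numeral power_int_of_nat q_def)
  have q1: "q > 1" unfolding q_def using k by (intro one_less_power) auto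
  have BL: "B (int k) \<in> Lam" and eL: "e \<in> Lam" using OKplus_Lam[OF B_OKplus] e(1) by (auto simp: OKplus_Lam tpu_OKplus)
  have "B (int k) * (1 - e) = B (int k) - emb p 1 (-1) (B (int k))" by (simp add: e(2) algebra_simps)
  also have "\<dots> = phi / sqrt 5 * q * (theta - inverse theta)"
    unfolding emb_B unfolding B_def bl_def qp by (simp add: algebra_simps add_divide_distrib diff_divide_distrib)
  also have "\<dots> = 2 * phi * q * sp" unfolding theta_diff by simp
  finally have prod: "B (int k) * (1 - e) = 2 * phi * q * sp" .
  have xs4: "real_of_int (xs (4 * k)) = q + inverse q"
  proof -
    have "psi ^ (4 * k) = psi powi (4 * int k)" by (metis of_nat_mult of_nat_numeral power_int_of_nat)
    also have "\<dots> = inverse q" unfolding psi_powi power_int_minus qp by simp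
    finally show ?thesis by (simp add: xs_binet q_def)
  qed
  have ys4: "real_of_int (ys (4 * k)) * sqrt 5 = q - inverse q"
    using ys_binet[of "4 * k"] xs_binet[of "4 * k"] xs4 by (simp add: q_def)
  obtain a where a: "xs (4 * k) - 2 = 5 * a" using xs_mod5[of k] by (auto elim: dvdE)
  obtain b where b: "X + 1 = 5 * b" using X_mod5 by (auto elim: dvdE)
  \<comment> \<open>By \<open>Nm_B\<close> this is the square root of the norm of
    \<open>B k\<close>. It is an integer because xs (4k) = 2 and X = -1 modulo 5.\<close>
  define M where "M = a + 2 * b"
  have M: "5 * M = xs (4 * k) + 2 * X" using a b by (simp add: M_def)
  have MR: "real_of_int M = (q + inverse q + 2 * of_int X) / 5"
  proof -
    have "real_of_int (5 * M) = q + inverse q + 2 * of_int X" unfolding M using xs4 by simp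
    thus ?thesis by simp
  qed
  have NB: "Nm (B (int k)) = of_int (M ^ 2)"
    unfolding Nm_B power_int_minus qp by (simp add: MR)
  have "Nm (2 * phi * q * sp) = of_int ((4 * p) ^ 2)"
  proof -
    have "Nm (2 * phi * q * sp) = Nm 2 * Nm phi * Nm q * Nm sp"
      by (simp add: Nm_mult q_def)
    moreover have "Nm phi = 1" by (simp add: Nm_Zphi emb_phi phi_rel)
    moreover have "Nm q = 1"
      using Nm_tpu[OF tpu_phi[of "2 * int k"]] by (simp add: qp[symmetric])
    moreover have "Nm 2 = 16" by (simp add: Nm_def)
    ultimately show ?thesis unfolding Nm_sp by (simp add: power_mult_distrib)
  qed
  moreover have "Nm (B (int k) * (1 - e)) = Nm (B (int k)) * Nm (1 - e)"
    using BL eL by (intro Nm_mult) auto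
  moreover obtain j where "Nm (1 - e) = of_int j" using Nm_int[of "1 - e"] eL by (auto elim: Ints_cases)
  ultimately have "of_int ((4 * p) ^ 2) = (of_int (M ^ 2 * j) :: real)" unfolding prod NB by simp
  hence "(4 * p) ^ 2 = M ^ 2 * j" by (simp only: of_int_eq_iff)
  hence "M ^ 2 dvd (4 * p) ^ 2" by simp
  hence M4p: "M dvd 4 * p" by (simp only: pow_divides_pow_iff zero_less_numeral)
  \<comment> \<open>2X is divisible by 4, while xs (4k) = xs (2k)^2 - 2 never is.\<close>
  have n4: "\<not> 4 dvd M"
  proof
    assume "4 dvd M"
    hence "4 dvd xs (4 * k) + 2 * X" unfolding M[symmetric] by simp
    moreover have "4 dvd 2 * X" using X_Y_even(1) by (auto elim!: evenE)
    ultimately have "4 dvd xs (4 * k)" by (simp add: dvd_add_left_iff)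
    moreover have "xs (4 * k) = xs (2 * k) ^ 2 - 2" using xs_double[of "2 * k"] by simp
    moreover have "\<not> 4 dvd z ^ 2 - 2" for z :: int
    proof (cases "even z")
      case True
      then obtain u where "z = 2 * u" by (rule evenE)
      hence "z ^ 2 - 2 = 4 * (u ^ 2) - 2" by (simp add: power_mult_distrib)
      thus ?thesis by presburger
    next
      case False
      hence "odd (z ^ 2 - 2)" by simp
      thus ?thesis by (meson dvd_trans even_numeral)
    qed
    ultimately show False by simp
  qed
  \<comment> \<open>Substituting xs (4k) = 5M - 2X into the norm equation and using X^2 - 1 = 5p
    gives F^2 = M (5M - 4X) + 4p.\<close>
  have MF: "M dvd ys (4 * k) ^ 2"
  proof -
    have "xs (4 * k) ^ 2 - 5 * ys (4 * k) ^ 2 = 4" using xs_ys_norm[of "4 * k"] by simp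
    moreover have "xs (4 * k) = 5 * M - 2 * X" using M by simp
    ultimately have "(5 * M - 2 * X) ^ 2 - 4 = 5 * ys (4 * k) ^ 2" by simp
    hence "25 * M ^ 2 - 20 * M * X + 4 * (X ^ 2 - 1) = 5 * ys (4 * k) ^ 2"
      by (simp add: power2_eq_square algebra_simps)
    hence "ys (4 * k) ^ 2 = M * (5 * M - 4 * X) + 4 * p" unfolding X_sq
      by (simp add: power2_eq_square algebra_simps)
    thus ?thesis using M4p by simp
  qed
  obtain M' where M': "M = M' \<or> M = 2 * M'" "odd M'"
  proof (cases "even M")
    case True
    then obtain M' where "M = 2 * M'" by (rule evenE)
    moreover have "odd M'" using n4 calculation by auto
    ultimately show ?thesis using that by blast
  qed (use that in blast)
  have "M' dvd M" using M'(1) by auto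
  hence "M' dvd 4 * p" using M4p by (rule dvd_trans)
  moreover have "coprime M' 4"
  proof -
    have "coprime M' (2 ^ 2)" using M'(2) by (subst coprime_power_right_iff) (simp add: coprime_right_2_iff_odd)
    thus ?thesis by simp
  qed
  ultimately have "M' dvd p" by (simp add: coprime_dvd_mult_right_iff)
  hence "squarefree M'" using sqf_p by (rule squarefree_mono)
  moreover have "M' dvd ys (4 * k) ^ 2" using \<open>M' dvd M\<close> MF by (rule dvd_trans)
  ultimately have "M' dvd ys (4 * k)" by (rule squarefree_dvd_power)
  moreover have yp: "real_of_int (ys (4 * k)) * sqrt 5 > 0"
    unfolding ys4 using q1 inverse_less_1_iff[of q] by simp
  hence "ys (4 * k) > 0" by (simp add: zero_less_mult_iff)
  ultimately have "M' \<le> ys (4 * k)" by (simp add: zdvd_imp_le)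
  moreover have "M \<le> 2 * M'"
  proof -
    have "M > 0" unfolding of_int_0_less_iff[where ?'a = real, symmetric] MR using q1 X_ge by (simp add: add_pos_pos)
    thus ?thesis using M'(1) by auto
  qed
  ultimately have "M \<le> 2 * ys (4 * k)" by simp
  hence "real_of_int M \<le> 2 * real_of_int (ys (4 * k))" by linarith
  moreover have "2 * real_of_int (ys (4 * k)) < q"
  proof -
    have "real_of_int (ys (4 * k)) > 0" using \<open>ys (4 * k) > 0\<close> by simp
    hence "real_of_int (ys (4 * k)) * 2 < real_of_int (ys (4 * k)) * sqrt 5"
      using sqrt5_bounds by (intro mult_strict_left_mono) auto
    also have "\<dots> < q" unfolding ys4 using q1 by simp
    finally show ?thesis by simp
  qed
  ultimately have 1: "q + inverse q + 2 * of_int X < 5 * q" unfolding MR by simp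
  \<comment> \<open>M <= 2F < q would give q + 2X < 5q. But k <= 3n means 4k + 3 <= m, so X is about
    phi^m >= phi^3 q, more than 4q.\<close>
  have "q * phi ^ 3 \<le> phi ^ m"
    unfolding q_def power_add[symmetric] using k by (intro power_increasing) (auto simp: m_eq less_imp_le)
  moreover have "q * (4236 / 1000) \<le> q * phi ^ 3"
    using q1 phi_bounds by (intro mult_left_mono) (auto simp: phi_power_small)
  ultimately have "q * (4236 / 1000) \<le> phi ^ m" by linarith
  moreover have "inverse q > 0" using q1 by simp
  ultimately show False using 1 q1 inverse_phi_m_lt unfolding X_phi right_diff_distrib by linarith
qed

subsection \<open>The discriminant\<close>

definition omega0 :: "nat \<Rightarrow> real" where
  "omega0 j = (if j = 0 then 1 else if j = 1 then phi else if j = 2 then sp else phi * sp)"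

definition embmat :: "(nat \<Rightarrow> real) \<Rightarrow> nat \<Rightarrow> nat \<Rightarrow> real" where
  "embmat w i j = emb p (fst (sgnpair i)) (snd (sgnpair i)) (w j)"

lemma sum4: "(\<Sum>l<4::nat. f l) = f 0 + f 1 + f 2 + (f 3 :: real)"
  by (simp add: eval_nat_numeral)

lemma omega0_Lam: "omega0 j \<in> Lam"
  by (simp add: omega0_def)

lemma omega0_basis: "integral_basis p omega0"
  unfolding integral_basis_def OK_eq_Lam
proof (intro conjI allI ballI impI)
  show "omega0 i \<in> Lam" for i by (rule omega0_Lam)
next
  fix x assume "x \<in> Lam"
  then obtain a b c d :: int where x: "x = (of_int a + of_int b * phi) + (of_int c + of_int d * phi) * sp"
    by (elim Lam_cases Zphi_cases) auto
  show "\<exists>c :: nat \<Rightarrow> int. x = (\<Sum>i<4. of_int (c i) * omega0 i)"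
    by (rule exI[of _ "\<lambda>i. if i = 0 then a else if i = 1 then b else if i = 2 then c else d"])
      (simp add: sum4 omega0_def x algebra_simps)
next
  fix c :: "nat \<Rightarrow> int" and i :: nat
  assume s: "(\<Sum>i<4. of_int (c i) * omega0 i) = 0" and i: "i < 4"
  have "((of_int (c 0) + of_int (c 1) / 2) + (of_int (c 1) / 2) * sqrt 5)
      + ((of_int (c 2) + of_int (c 3) / 2) + (of_int (c 3) / 2) * sqrt 5) * sp = 0"
    using s by (simp add: sum4 omega0_def phi_def field_simps)
  hence "of_int (c 0) + of_int (c 1) / 2 = (0::real) \<and> of_int (c 1) / 2 = (0::real)
      \<and> of_int (c 2) + of_int (c 3) / 2 = (0::real) \<and> of_int (c 3) / 2 = (0::real)"
    by (rule indep[rotated 4]) simp_all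
  hence "c 0 = 0" "c 1 = 0" "c 2 = 0" "c 3 = 0" by auto
  moreover have "i = 0 \<or> i = 1 \<or> i = 2 \<or> i = 3" using i by linarith
  ultimately show "c i = 0" by auto
qed

lemma embmat_change:
  assumes "integral_basis p w" "integral_basis p w'"
  shows "\<exists>k::int. det4 (embmat w) = det4 (embmat w') * of_int k"
proof -
  have L: "w j \<in> Lam" "w' j \<in> Lam" if "j < 4" for j
    using assms that by (auto simp: integral_basis_def OK_eq_Lam)
  have "\<forall>j<4. \<exists>c :: nat \<Rightarrow> int. w j = (\<Sum>l<4. of_int (c l) * w' l)"
    using assms L by (auto simp: integral_basis_def OK_eq_Lam)
  then obtain c :: "nat \<Rightarrow> nat \<Rightarrow> int" where c: "\<And>j. j < 4 \<Longrightarrow> w j = (\<Sum>l<4. of_int (c j l) * w' l)"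
    by metis
  have "det4 (embmat w) = det4 (\<lambda>i j. \<Sum>l<4. embmat w' i l * of_int (c j l))"
  proof (rule det4_cong)
    fix i j :: nat assume "j < 4"
    have sg: "fst (sgnpair i) \<in> {-1, 1}" "snd (sgnpair i) \<in> {-1, 1}" by (auto simp: sgnpair_def)
    have "w' 0 \<in> Lam" "w' 1 \<in> Lam" "w' 2 \<in> Lam" "w' 3 \<in> Lam" using L by auto
    thus "embmat w i j = (\<Sum>l<4. embmat w' i l * of_int (c j l))"
      unfolding embmat_def c[OF \<open>j < 4\<close>] sum4 using sg by (simp add: embL_hom mult.commute)
  qed
  thus ?thesis using det4_int_mult[of "embmat w'" c] by simp
qed

lemma det_omega0: "det4 (embmat omega0) ^ 2 = 400 * of_int p ^ 2"
proof -
  let ?M = "\<lambda>i j. if i = 0 then (if j = 0 then 1 else if j = 1 then phi else if j = 2 then sp else phi * sp)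
     else if i = 1 then (if j = 0 then 1 else if j = 1 then phi else if j = 2 then - sp else - (phi * sp))
     else if i = 2 then (if j = 0 then 1 else if j = 1 then psi else if j = 2 then sp else psi * sp)
     else (if j = 0 then 1 else if j = 1 then psi else if j = 2 then - sp else - (psi * sp))"
  have "det4 (embmat omega0) = det4 ?M"
  proof (rule det4_cong)
    fix i j :: nat
    have "i = 0 \<or> i = 1 \<or> i = 2 \<or> (i \<noteq> 0 \<and> i \<noteq> 1 \<and> i \<noteq> 2)" by auto
    thus "embmat omega0 i j = ?M i j"
      by (elim disjE) (simp_all add: embmat_def omega0_def sgnpair_def embL_hom emb_phi emb_sp)
  qed
  hence "det4 (embmat omega0) ^ 2 = 16 * sp ^ 4 * (phi - psi) ^ 4" by (simp only: det4_explicit)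
  also have "sp ^ 4 = (sp * sp) * (sp * sp)" by (simp only: power4_eq_xxxx mult.assoc)
  also have "(phi - psi) ^ 4 = (sqrt 5 * sqrt 5) * (sqrt 5 * sqrt 5)" unfolding phi_rel by (simp only: power4_eq_xxxx mult.assoc)
  finally show ?thesis unfolding sp_sq by (simp add: power2_eq_square)
qed

theorem disc_eq: "disc p = 400 * of_int p ^ 2"
  unfolding disc_def embmat_def[symmetric]
proof (rule the_equality)
  show "\<exists>w. integral_basis p w \<and> 400 * of_int p ^ 2 = det4 (embmat w) ^ 2"
    using omega0_basis det_omega0 by metis
next
  fix d assume "\<exists>w. integral_basis p w \<and> d = det4 (embmat w) ^ 2"
  then obtain w where w: "integral_basis p w" "d = det4 (embmat w) ^ 2" by blast
  \<comment> \<open>Each basis is integral over the other, so the determinants differ by a factor 1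
    or -1 and their squares agree. This makes the description in \<open>disc\<close> unique.\<close>
  obtain k l :: int where kl: "det4 (embmat w) = det4 (embmat omega0) * of_int k"
    "det4 (embmat omega0) = det4 (embmat w) * of_int l"
    using embmat_change w(1) omega0_basis by metis
  have "det4 (embmat omega0) \<noteq> 0" using det_omega0 p_ge by auto
  moreover have "det4 (embmat omega0) = det4 (embmat omega0) * of_int (k * l)"
    using kl by (metis mult.assoc of_int_mult)
  ultimately have "real_of_int (k * l) = 1" by simp
  hence "k * l = 1" by (simp only: of_int_eq_1_iff)
  hence "k = 1 \<or> k = -1" by (metis zmult_eq_1_iff)
  hence "of_int k ^ 2 = (1::real)" by auto
  thus "d = 400 * of_int p ^ 2" unfolding w(2) kl(1) power_mult_distrib det_omega0 by simp
qed

text \<open>The discriminant is the square of 20p = 4 (X^2 - 1), which is about 4 phi^(2m) and lies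
  between phi^(2m+2) = phi^(24n+8) and phi^(2m+6) = phi^(24n+12). Dividing the doubled logarithm by
  8 ln phi places the quotient between 6n + 2 and 6n + 3.\<close>

lemma disc_bounds:
  shows "ln (disc p) / (8 * ln phi) \<le> 6 * real n + 3"
    and "6 * real n + 3 \<le> ln (disc p) / (8 * ln phi) + 1"
proof -
  define q where "q = phi ^ m"
  have q: "q > 4236 / 1000" "inverse q > 0" "inverse q < 1 / 4"
    using phi_m_gt inverse_phi_m_lt by (simp_all add: q_def)
  have "20 * real_of_int p = 4 * (of_int X * of_int X - 1)" unfolding X_sq_real by simp
  also have "of_int X * of_int X = q * q - 2 + inverse q * inverse q"
    unfolding X_phi q_def by (simp add: algebra_simps)
  finally have pq: "20 * real_of_int p = 4 * (q * q) - 12 + 4 * (inverse q * inverse q)" by simp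
  have qq: "q * q \<ge> 4236 / 1000 * (4236 / 1000)" using q by (intro mult_mono) auto
  have iq: "inverse q * inverse q < 1 / 4 * (1 / 4)" using q by (intro mult_strict_mono) auto
  have "m + m + 6 = 24 * n + 12" "m + m + 2 = 24 * n + 8" by (simp_all add: m_eq)
  hence pw: "phi ^ (24 * n + 12) = q * q * phi ^ 6" "phi ^ (24 * n + 8) = q * q * phi ^ 2"
    unfolding q_def by (metis power_add)+
  have p0: "20 * real_of_int p > 0" using p_ge by simp
  have "q * q * 4 \<le> q * q * phi ^ 6" using phi_bounds q by (intro mult_left_mono) (auto simp: phi_power_small)
  hence up: "20 * real_of_int p \<le> phi ^ (24 * n + 12)" unfolding pw pq using iq by linarith
  have "q * q * phi ^ 2 \<le> q * q * (262 / 100)" using phi_bounds q by (intro mult_left_mono) (auto simp: phi_power_small)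
  moreover have "inverse q * inverse q > 0" using q by simp
  ultimately have lo: "phi ^ (24 * n + 8) \<le> 20 * real_of_int p" unfolding pw pq using qq by linarith
  have lnp: "ln phi > 0" by simp
  have "disc p = (20 * real_of_int p) ^ 2" by (simp add: disc_eq power_mult_distrib)
  hence ld: "ln (disc p) = 2 * ln (20 * real_of_int p)" using p0 by (simp only: ln_realpow of_nat_numeral)
  have "ln (20 * real_of_int p) \<le> ln (phi ^ (24 * n + 12))" using up p0 by (subst ln_le_cancel_iff) auto
  hence 1: "ln (20 * real_of_int p) \<le> (24 * real n + 12) * ln phi" by (simp add: ln_realpow)
  have "ln (phi ^ (24 * n + 8)) \<le> ln (20 * real_of_int p)" using lo p0 by (subst ln_le_cancel_iff) auto
  hence 2: "(24 * real n + 8) * ln phi \<le> ln (20 * real_of_int p)" by (simp add: ln_realpow)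
  show "ln (disc p) / (8 * ln phi) \<le> 6 * real n + 3"
    unfolding ld using 1 lnp by (simp add: pos_divide_le_eq algebra_simps)
  have "6 * real n + 2 \<le> ln (disc p) / (8 * ln phi)"
    unfolding ld using 2 lnp by (simp add: pos_le_divide_eq algebra_simps)
  thus "6 * real n + 3 \<le> ln (disc p) / (8 * ln phi) + 1" by simp
qed

subsection \<open>The representatives\<close>

definition rho :: real where
  "rho = real_of_int (X + Y) / 2 - (1/2) * sp + (1/2) * sqrt (of_int (X ^ 2 - 1))"

definition gam :: "nat \<Rightarrow> real" where
  "gam j = real_of_int (ys (2*j-1) * X + 1) / 2
     + real_of_int (xs (2*j-1) * X - (-1)^j) / 10 * sqrt 5
     + (-1)^j * real_of_int (xs (2*j-1)) / 2 * sp
     + (-1)^j * real_of_int (ys (2*j-1)) / 2 * sqrt (of_int (X ^ 2 - 1))"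

lemma sqrt_r: "sqrt (of_int (X ^ 2 - 1)) = sqrt 5 * sp"
  unfolding X_sq by (simp add: real_sqrt_mult)

lemma inverse_phi_sqrt: "inverse phi = (sqrt 5 - 1) / 2"
  unfolding inverse_phi(1) unfolding phi_def by (simp add: field_simps)

text \<open>The coordinates of \<open>rho\<close> encode sqrt 5 rho = phi^m + theta / phi.\<close>

lemma rho_assoc: "assoc_tp p (B (- (3 * int n + 1))) rho"
proof -
  have "rho = phi powi (2 * (6 * int n + 1)) * B (- (3 * int n + 1))"
  proof -
    have e: "4 * (- (3 * int n + 1)) = - (int m + 1)" "2 * (6 * int n + 1) = int m - 1"
      using m_t0 by simp_all
    have "phi powi (int m + 1) = phi ^ m * phi" by (simp add: power_int_add)
    hence pm: "phi powi (- (int m + 1)) = inverse (phi ^ m * phi)" "phi powi (int m - 1) = phi ^ m / phi"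
      unfolding power_int_minus by (simp_all add: power_int_diff)
    have "phi powi (2 * (6 * int n + 1)) * B (- (3 * int n + 1)) = (phi ^ m + inverse phi * theta) / sqrt 5"
      unfolding B_def bl_def e pm by (simp add: field_simps)
    also have "phi ^ m = (of_int X + of_int Y * sqrt 5) / 2" using xs_ys_phi[of m] by (simp add: X_eq Y_eq)
    also have "((of_int X + of_int Y * sqrt 5) / 2 + inverse phi * theta) / sqrt 5 = rho"
      unfolding inverse_phi_sqrt rho_def sqrt_r theta_def by (simp add: field_simps)
    finally show ?thesis ..
  qed
  thus ?thesis by (simp only: assoc_I tpu_phi)
qed

text \<open>At 4t = m + 1 the relation \<open>theta_eta\<close> and the quadratic equation of
  \<open>theta\<close> give eta (phi^(m+1) + theta) = 1 + phi^(m+1) theta.\<close>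

lemma B_top_assoc: "assoc_tp p (B (- (3 * int n + 1))) (B (3 * int n + 1))"
proof -
  define q where "q = phi ^ m"
  have q0: "q > 0" by (simp add: q_def)
  have e: "4 * (- (3 * int n + 1)) = - (int m + 1)" "4 * (3 * int n + 1) = int m + 1"
    "2 * (2 * (3 * int n + 1)) = int m + 1" using m_t0 by simp_all
  have "phi powi (int m + 1) = q * phi" by (simp add: power_int_add q_def)
  hence pm: "phi powi (- (int m + 1)) = inverse (q * phi)" "phi powi (int m + 1) = q * phi"
    unfolding power_int_minus by simp_all
  have th: "theta * theta = 2 * (q - inverse q) * theta - 1"
  proof -
    have "theta * theta = (theta + inverse theta) * theta - 1" by (simp add: algebra_simps)
    thus ?thesis unfolding theta_sum X_phi q_def .
  qed
  have "sqrt 5 * (eta * (q * phi + theta)) = (sqrt 5 * eta) * (q * phi + theta)" by simp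
  also have "\<dots> = (theta + 2 * inverse q) * (q * phi + theta)" using theta_eta by (simp add: q_def)
  also have "\<dots> = theta * theta + q * phi * theta + 2 * phi + 2 * inverse q * theta"
    using q0 by (simp add: algebra_simps)
  also have "\<dots> = (phi + 2) * (q * theta) + (2 * phi - 1)" unfolding th by (simp add: algebra_simps)
  also have "phi + 2 = sqrt 5 * phi" using phi_rel(1) by (simp add: sqrt5_eq algebra_simps)
  also have "2 * phi - 1 = sqrt 5" by (simp add: sqrt5_eq)
  finally have "sqrt 5 * (eta * (q * phi + theta)) = sqrt 5 * (1 + q * phi * theta)" by (simp add: algebra_simps)
  hence key: "eta * (q * phi + theta) = 1 + q * phi * theta" by simp
  have "B (3 * int n + 1) = phi / sqrt 5 * (eta * (q * phi + theta))"
    unfolding B_def bl_def e(2) pm key by simp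
  also have "\<dots> = (phi powi (2 * (2 * (3 * int n + 1))) * eta) * B (- (3 * int n + 1))"
    unfolding B_def bl_def e pm using q0 by (simp add: field_simps)
  finally show ?thesis by (simp only: assoc_I tpu_mult tpu_phi tpu_eta)
qed

text \<open>The t for which gamma_j belongs to \<open>B t\<close>. The sign (-1)^j decides whether
  \<open>theta\<close> or its inverse occurs in gamma_j, and hence the sign of t.\<close>

definition idx :: "nat \<Rightarrow> int" where
  "idx j = (if even j then int (j div 2) else - int (j div 2))"

lemma gam_assoc:
  assumes "j \<ge> 1" shows "assoc_tp p (B (idx j)) (gam j)"
proof -
  define P where "P = phi ^ (2 * j - 1)"
  have P: "P = (of_int (xs (2 * j - 1)) + of_int (ys (2 * j - 1)) * sqrt 5) / 2"
    unfolding P_def xs_ys_phi ..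
  have Pp: "phi * P = phi powi (2 * int j)"
  proof -
    have "phi * P = phi ^ (2 * j)" unfolding P_def using assms by (simp add: power_Suc[symmetric] del: power_Suc)
    thus ?thesis by (metis of_nat_mult of_nat_numeral power_int_of_nat)
  qed
  \<comment> \<open>For even j the bracket is \<open>theta\<close> and the constant is (sqrt 5 -
    1)/2 = 1/phi; for odd j they are the inverse of \<open>theta\<close> and (sqrt 5 + 1)/2 =
    phi.\<close>
  have g: "gam j = (P * (of_int X + (-1) ^ j * (sqrt 5 * sp)) + (sqrt 5 - (-1) ^ j) / 2) / sqrt 5"
    unfolding gam_def sqrt_r P by (simp add: field_simps)
  show ?thesis
  proof (cases "even j")
    case True
    then obtain i where i: "j = 2 * i" by (rule evenE)
    have ix: "4 * idx j = 2 * int j" using i by (simp add: idx_def)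
    have "gam j = (P * theta + inverse phi) / sqrt 5"
      unfolding g inverse_phi_sqrt theta_def using True by simp
    also have "\<dots> = phi powi (2 * (-1)) * B (idx j)"
      unfolding B_def bl_def ix Pp[symmetric] by (simp add: power_int_minus power2_eq_square field_simps)
    finally show ?thesis by (simp only: assoc_I tpu_phi)
  next
    case False
    then obtain i where i: "j = 2 * i + 1" by (rule oddE)
    have ix: "4 * idx j = - (2 * (int j - 1))" using i by (simp add: idx_def)
    have pj: "phi powi (2 * (int j - 1)) = phi * P / phi ^ 2"
      unfolding Pp by (simp add: right_diff_distrib power_int_diff)
    have P0: "P > 0" by (simp add: P_def)
    have "gam j = (P * inverse theta + phi) / sqrt 5"
      unfolding g inverse_theta phi_def using False by (simp add: algebra_simps)
    also have "\<dots> = phi powi (2 * (int j - 1)) * inverse theta * B (idx j)"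
      unfolding B_def bl_def ix power_int_minus pj using P0
      by (simp add: power2_eq_square field_simps)
    finally show ?thesis by (simp only: assoc_I tpu_mult tpu_phi tpu_inverse tpu_theta)
  qed
qed

text \<open>The range is asymmetric because -(3n + 1) gives the same class as 3n + 1. Inside it, t =
  -t' with t nonzero forces |t| <= 3n, where \<open>not_assoc_neg\<close> applies.\<close>

lemma B_assoc_inj:
  assumes "- (3 * int n) \<le> t" "t \<le> 3 * int n + 1" "- (3 * int n) \<le> t'" "t' \<le> 3 * int n + 1"
    and "assoc_tp p (B t) (B t')"
  shows "t = t'"
proof (rule ccontr)
  assume ne: "t \<noteq> t'"
  hence n: "t = - t'" using assoc_B_eq_or_neg[OF assms(5)] by blast
  define k where "k = nat \<bar>t\<bar>"
  have k: "0 < k" "k \<le> 3 * n" using ne n assms by (auto simp: k_def)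
  have "assoc_tp p (B (int k)) (B (- int k))"
  proof (cases "t \<ge> 0")
    case True
    thus ?thesis using assms(5) n by (simp add: k_def)
  next
    case False
    thus ?thesis using assoc_sym[OF assms(5)] n by (simp add: k_def)
  qed
  with not_assoc_neg[OF k] show False by blast
qed

lemma idx_range: "1 \<le> j \<Longrightarrow> j \<le> 6 * n + 1 \<Longrightarrow> - (3 * int n) \<le> idx j \<and> idx j \<le> 3 * int n"
  by (auto simp: idx_def elim!: evenE oddE)

lemma idx_inj:
  assumes "1 \<le> i" "1 \<le> j" "idx i = idx j" shows "i = j"
  using assms unfolding idx_def by (cases "even i"; cases "even j") (auto elim!: evenE oddE)

lemma idx_surj:
  assumes "- (3 * int n) \<le> t" "t \<le> 3 * int n"
  shows "\<exists>j. 1 \<le> j \<and> j \<le> 6 * n + 1 \<and> idx j = t"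
proof (cases "t > 0")
  case True
  thus ?thesis using assms by (intro exI[of _ "2 * nat t"]) (auto simp: idx_def)
next
  case False
  thus ?thesis using assms by (intro exI[of _ "2 * nat (- t) + 1"]) (auto simp: idx_def)
qed

definition reps :: "real set" where
  "reps = {1, rho} \<union> {gam j | j. 1 \<le> j \<and> j \<le> 6 * n + 1}"

text \<open>Names each class by its normal form, \<open>None\<close> for that of 1 and
  \<open>Some t\<close> for that of \<open>B t\<close>. Associated elements have equal labels, so
  all comparisons of representatives become comparisons of integers.\<close>

definition has_label :: "real \<Rightarrow> int option \<Rightarrow> bool" where
  "has_label s l \<longleftrightarrow> (case l of None \<Rightarrow> s = 1
     | Some t \<Rightarrow> - (3 * int n) \<le> t \<and> t \<le> 3 * int n + 1 \<and> assoc_tp p (B t) s)"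

lemma rho_label: "has_label rho (Some (3 * int n + 1))"
  unfolding has_label_def using assoc_trans[OF assoc_sym[OF B_top_assoc] rho_assoc] by simp

lemma gam_label: "1 \<le> j \<Longrightarrow> j \<le> 6 * n + 1 \<Longrightarrow> has_label (gam j) (Some (idx j))"
  unfolding has_label_def using gam_assoc[of j] idx_range[of j] by simp

lemma label_unique:
  assumes "has_label s l" "has_label s' l'" "assoc_tp p s s'" shows "l = l'"
proof -
  have mixed: "\<not> assoc_tp p s s'" if "has_label s None" "has_label s' (Some t)" for s s' t
  proof
    assume h: "assoc_tp p s s'"
    have "s = 1" "assoc_tp p (B t) s'" using that by (auto simp: has_label_def)
    hence "assoc_tp p 1 (B t)" using assoc_trans[OF h assoc_sym] by blast
    thus False using not_assoc_1_B by blast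
  qed
  show ?thesis
  proof (cases l)
    case None
    thus ?thesis using assms mixed[of s s'] by (cases l') auto
  next
    case (Some t)
    show ?thesis
    proof (cases l')
      case None
      thus ?thesis using assms Some mixed[of s' s t] assoc_sym by auto
    next
      case (Some t')
      have h: "assoc_tp p (B t) s" "assoc_tp p (B t') s'" using assms \<open>l = Some t\<close> Some by (auto simp: has_label_def)
      have "assoc_tp p (B t) (B t')"
        using assoc_trans[OF assoc_trans[OF h(1) assms(3)] assoc_sym[OF h(2)]] .
      hence "t = t'" using assms \<open>l = Some t\<close> Some by (intro B_assoc_inj) (auto simp: has_label_def)
      thus ?thesis using \<open>l = Some t\<close> Some by simp
    qed
  qed
qed

lemma one_label: "has_label 1 None"
  by (simp add: has_label_def)

lemma reps_label:
  assumes "s \<in> reps"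
  obtains "s = 1" "has_label s None" | "s = rho" "has_label s (Some (3 * int n + 1))"
    | j where "1 \<le> j" "j \<le> 6 * n + 1" "s = gam j" "has_label s (Some (idx j))"
  using assms one_label rho_label gam_label unfolding reps_def by blast

lemma reps_inj:
  assumes "s \<in> reps" "s' \<in> reps" "assoc_tp p s s'" shows "s = s'"
  using assms(1)
proof (cases rule: reps_label)
  case 1
  from assms(2) show ?thesis
    by (cases rule: reps_label) (use 1 label_unique[OF _ _ assms(3)] in blast)+
next
  case 2
  from assms(2) show ?thesis
  proof (cases rule: reps_label)
    case (3 j)
    have "3 * int n + 1 = idx j" using label_unique[OF 2(2) 3(4) assms(3)] by simp
    thus ?thesis using idx_range[OF 3(1,2)] by simp
  qed (use 2 label_unique[OF _ _ assms(3)] in blast)+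
next
  case (3 i)
  note i = 3
  from assms(2) show ?thesis
  proof (cases rule: reps_label)
    case 1
    thus ?thesis using label_unique[OF i(4) _ assms(3)] by blast
  next
    case 2
    have "idx i = 3 * int n + 1" using label_unique[OF i(4) 2(2) assms(3)] by simp
    thus ?thesis using idx_range[OF i(1,2)] by simp
  next
    case (3 j)
    have "idx i = idx j" using label_unique[OF i(4) 3(4) assms(3)] by simp
    thus ?thesis using idx_inj[OF i(1) 3(1)] i(3) 3(3) by simp
  qed
qed

lemma reps_indec: "s \<in> reps \<Longrightarrow> indecomposable p s"
proof (elim reps_label)
  have *: "indecomposable p s" if "has_label s (Some t)" for t
    using that indec_assoc[OF indec_B[of t]] by (auto simp: has_label_def)
  show "has_label s (Some (3 * int n + 1)) \<Longrightarrow> indecomposable p s" by (rule *)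
  show "indecomposable p s" if "has_label s (Some (idx j))" for j using * that .
  show "s = 1 \<Longrightarrow> indecomposable p s" using indec_1 by simp
qed

lemma reps_complete:
  assumes "indecomposable p z" shows "\<exists>s\<in>reps. assoc_tp p s z"
proof -
  consider "assoc_tp p 1 z" | t where "assoc_tp p (B t) z" using indec_classification[OF assms] by blast
  thus ?thesis
  proof cases
    case 1
    thus ?thesis by (auto simp: reps_def)
  next
    case (2 t)
    have "indecomposable p (B t)" using indec_assoc[OF assms assoc_sym[OF 2]] .
    hence t: "\<bar>t\<bar> \<le> 3 * int n + 1" by (rule indec_B_bound)
    have rt: "assoc_tp p (B t) rho" if "t = 3 * int n + 1 \<or> t = - (3 * int n + 1)"
      using that rho_assoc assoc_trans[OF assoc_sym[OF B_top_assoc] rho_assoc] by auto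
    show ?thesis
    proof (cases "t = 3 * int n + 1 \<or> t = - (3 * int n + 1)")
      case True
      thus ?thesis using assoc_trans[OF assoc_sym[OF rt[OF True]] 2] by (auto simp: reps_def)
    next
      case False
      hence "- (3 * int n) \<le> t" "t \<le> 3 * int n" using t by linarith+
      then obtain j where j: "1 \<le> j" "j \<le> 6 * n + 1" "idx j = t" using idx_surj by blast
      have "assoc_tp p (gam j) z" using assoc_trans[OF assoc_sym[OF gam_assoc[OF j(1)]]] 2 j(3) by simp
      thus ?thesis using j by (auto simp: reps_def)
    qed
  qed
qed

lemma card_reps: "card reps = 6 * n + 3"
proof -
  have neq: "s \<noteq> s'" if "has_label s l" "has_label s' l'" "l \<noteq> l'" for s s' l l'
    using label_unique[OF that(1,2)] that(3) assoc_refl by metis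
  have inj: "inj_on gam {1..6 * n + 1}"
  proof (rule inj_onI)
    fix i j assume h: "i \<in> {1..6 * n + 1}" "j \<in> {1..6 * n + 1}" "gam i = gam j"
    have "Some (idx i) = Some (idx j)"
      using neq[OF gam_label[of i] gam_label[of j]] h by (metis atLeastAtMost_iff)
    thus "i = j" using idx_inj[of i j] h by simp
  qed
  have r: "reps = insert 1 (insert rho (gam ` {1..6 * n + 1}))" by (auto simp: reps_def)
  have "rho \<notin> gam ` {1..6 * n + 1}"
  proof
    assume "rho \<in> gam ` {1..6 * n + 1}"
    then obtain j where j: "1 \<le> j" "j \<le> 6 * n + 1" "rho = gam j" by auto
    have "Some (3 * int n + 1) = Some (idx j)" using neq[OF rho_label gam_label[OF j(1,2)]] j(3) by metis
    thus False using idx_range[OF j(1,2)] by simp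
  qed
  moreover have "1 \<notin> insert rho (gam ` {1..6 * n + 1})"
    using neq[OF one_label rho_label] neq[OF one_label gam_label] by auto
  ultimately show ?thesis unfolding r using card_image[OF inj] by simp
qed

lemma iota_eq: "iota p = 6 * n + 3"
proof -
  let ?cl = "\<lambda>a. {b. indecomposable p b \<and> assoc_tp p a b}"
  have cl_eq: "?cl a = ?cl s" if "assoc_tp p s a" for a s
    using assoc_trans[OF that] assoc_trans[OF assoc_sym[OF that]] by blast
  have "{?cl a | a. indecomposable p a} = ?cl ` reps"
  proof (intro equalityI subsetI)
    fix c assume "c \<in> {?cl a | a. indecomposable p a}"
    then obtain a where a: "indecomposable p a" "c = ?cl a" by blast
    obtain s where s: "s \<in> reps" "assoc_tp p s a" using reps_complete[OF a(1)] by blast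
    have "c = ?cl s" unfolding a(2) by (rule cl_eq[OF s(2)])
    thus "c \<in> ?cl ` reps" using s(1) by (rule image_eqI)
  next
    fix c assume "c \<in> ?cl ` reps"
    then obtain s where "s \<in> reps" "c = ?cl s" by blast
    thus "c \<in> {?cl a | a. indecomposable p a}" using reps_indec by blast
  qed
  moreover have "inj_on ?cl reps"
  proof (rule inj_onI)
    fix s s' assume h: "s \<in> reps" "s' \<in> reps" "?cl s = ?cl s'"
    have "s' \<in> ?cl s" unfolding h(3) using reps_indec[OF h(2)] assoc_refl by simp
    thus "s = s'" using reps_inj[OF h(1,2)] by simp
  qed
  ultimately show ?thesis unfolding iota_def using card_image[of ?cl reps] card_reps by simp
qed

end

theorem theorem4p1:
  fixes n :: nat
  defines "X \<equiv> xs (12 * n + 3)" and "Y \<equiv> ys (12 * n + 3)"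
  defines "p \<equiv> Y ^ 2 - 1" and "r \<equiv> X ^ 2 - 1"
  defines "\<rho> \<equiv> real_of_int (X + Y) / 2 - (1/2) * sqrt (of_int p) + (1/2) * sqrt (of_int r)"
  defines "\<gamma> \<equiv> (\<lambda>j::nat. real_of_int (ys (2*j-1) * X + 1) / 2
              + real_of_int (xs (2*j-1) * X - (-1)^j) / 10 * sqrt 5
              + (-1)^j * real_of_int (xs (2*j-1)) / 2 * sqrt (of_int p)
              + (-1)^j * real_of_int (ys (2*j-1)) / 2 * sqrt (of_int r))"
  defines "S \<equiv> {1, \<rho>} \<union> {\<gamma> j | j. 1 \<le> j \<and> j \<le> 6 * n + 1}"
  defines "w \<equiv> ln ((1 + sqrt 5) / 2)"
  assumes "squarefree p" and "squarefree r"
  shows "(\<forall>s\<in>S. indecomposable p s)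
       \<and> (\<forall>\<alpha>. indecomposable p \<alpha> \<longrightarrow> (\<exists>s\<in>S. assoc_tp p s \<alpha>))
       \<and> (\<forall>s\<in>S. \<forall>s'\<in>S. assoc_tp p s s' \<longrightarrow> s = s')
       \<and> iota p = 6 * n + 3
       \<and> ln (disc p) / (8 * w) \<le> real (iota p)
       \<and> real (iota p) \<le> ln (disc p) / (8 * w) + 1"
proof -
  have "X ^ 2 - 1 = 5 * p"
    using xs_ys_norm[of "12 * n + 3"] by (simp add: X_def Y_def p_def)
  hence "squarefree (5 * p)" using assms(10) by (simp add: r_def)
  then interpret fibonacci_biquadratic n "12 * n + 3" X Y p
    using assms(9) by unfold_locales (simp_all add: X_def Y_def p_def)
  have S: "S = reps"
    unfolding S_def reps_def \<rho>_def rho_def \<gamma>_def gam_def r_def ..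
  have w: "w = ln phi" by (simp add: w_def phi_def)
  have i: "real (iota p) = 6 * real n + 3" by (simp add: iota_eq)
  show ?thesis unfolding S w i
    using reps_indec reps_complete reps_inj iota_eq disc_bounds by blast
qed

end
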